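(* Let $\beta>0$ and let $X=(X_t)_{t\in[0,\infty)}$ be a continuous $\beta$-self-similar Volterra Gaussian process with non-degenerate Volterra kernel $z_X$, defined on its coordinate space $(\Omega,\mathcal{F},\mathbb{P})$. Let $\alpha>-\frac12$ and $T>0$. Then the automorphisms $\mathcal{Z}^{\alpha}$ and $\mathcal{Z}^{\alpha,-1}$ are Kolmogorov automorphisms with $$\mathcal{A}=\bigvee_{n\in-\mathbb{N}}\sigma\bigl(\mathcal{Z}^{\alpha,n}_T(X)\bigr)\quad\text{and}\quad \mathcal{A}=\mathcal{F}^X_T,$$ respectively.
   Context: Setting. $X=(X_t)_{t\in[0,\infty)}$ is a continuous Volterra Gaussian process on a complete probability space: $X_t=\int_0^t z_X(t,s)\,dW_s$ a.s. for every $t\ge 0$, where $W$ is a standard Brownian motion and $z_X\in L^2_{\mathrm{loc}}([0,\infty)^2)$ is a deterministic kernel which is Volterra, i.e. $z_X(t,s)=0$ for $s\ge t$, with $z_X(t,\cdot)\in L^2([0,\infty))$ for each $t$. So $X$ is centered Gaussian with covariance $R^X(s,t)=\int_0^s z_X(s,u)z_X(t,u)\,du$, $0\le s\le t$. $z_X$ is non-degenerate if the family $\{z_X(t,\cdot): t\in(0,\infty)\}$ is linearly independent and its linear span is dense in $L^2([0,\infty))$. $X$ is $\beta$-self-similar if for every $a>0$ the processes $(X_{at})_{t\ge0}$ and $(a^{\beta}X_t)_{t\ge0}$ have the same finite-dimensional distributions. Coordinate space of $X$: $\Omega=\{\omega:[0,\infty)\to\mathbb{R}\mid \omega \text{ continuous}\}$,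 $X_t(\omega)=\omega(t)$, $\mathcal{F}=\sigma(X_t: t\ge 0)$, and $\mathbb{P}$ is the probability measure under which the coordinate process is centered Gaussian with covariance $R^X$. $(\mathcal{F}^X_t)_{t\ge0}$ is the completed natural filtration of $X$. All $\sigma$-algebras are understood to be completed by $\mathbb{P}$-null sets; equalities and inclusions of $\sigma$-algebras (in particular with the trivial $\sigma$-algebra $\{\Omega,\emptyset\}$) are modulo $\mathbb{P}$-null sets. For $\alpha>-\frac12$, $\mathcal{Z}^\alpha$ is the measure-preserving invertible transformation (automorphism, modulo null sets) of the coordinate space of $X$ given by $$\mathcal{Z}^{\alpha}_t(X)=X_t-(2\alpha+1)t^{\beta-\alpha-\frac12}\int_0^t s^{\alpha-\beta-\frac12}X_s\,ds,\quad t\ge0,$$ with inverse $$\mathcal{Z}^{\alpha,-1}_t(X)=X_t-(2\alpha+1)t^{\alpha+\beta+\frac12}\int_t^\infty X_s s^{-\beta-\alpha-\frac32}\,ds\quad\text{a.s.},\ t\ge0$$ (integrals as $L^2(\mathbb{P})$-limits of Riemann sums, value $0$ at $t=0$). For $n\in\mathbb{Z}$, $\mathcal{Z}^{\alpha,n}=(\mathcal{Z}^\alpha)^n$ is the $n$-th iterate (iterates of the inverse for $n<0$, identity for $n=0$), and $\mathcal{Z}^{\alpha,n}_T(X)$ is its value at time $T$. $\mathbb{N}=\{1,2,\dots\}$, $-\mathbb{N}=\{-1,-2,\dots\}$, $\mathbb{N}_0=\{0,1,2,\dots\}$. An automorphism $\mathcal{Z}$ of $(\Omega,\mathcal{F},\mathbb{P})$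 is a Kolmogorov automorphism (with $\sigma$-algebra $\mathcal{A}$) if $\mathcal{A}\subseteq\mathcal{F}$ is a $\sigma$-algebra such that $\mathcal{Z}^{-1}\mathcal{A}\subseteq\mathcal{A}$, $\bigvee_{m\in\mathbb{Z}}\mathcal{Z}^m\mathcal{A}=\mathcal{F}$ and $\bigcap_{m\in\mathbb{N}_0}\mathcal{Z}^{-m}\mathcal{A}=\{\Omega,\emptyset\}$. Convention for the action on $\sigma$-algebras: for $m\in\mathbb{Z}$, $\mathcal{Z}^m\mathcal{A}:=\{\{\omega:\mathcal{Z}^m(\omega)\in B\}: B\in\mathcal{A}\}$, i.e. if $\mathcal{A}$ is generated by random variables $f_i(X)$, then $\mathcal{Z}^m\mathcal{A}$ is generated by the random variables $f_i(\mathcal{Z}^m(X))$; for example $\mathcal{Z}^{\alpha,m}\,\sigma(\mathcal{Z}^{\alpha,n}_T(X))=\sigma(\mathcal{Z}^{\alpha,n+m}_T(X))$. *)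

theory Defs
  imports "HOL-Probability.Probability"
begin

section \<open>Square-integrable functions and $L^2$-distance\<close>

definition square_integrable :: "'a measure \<Rightarrow> ('a \<Rightarrow> real) \<Rightarrow> bool" where
  "square_integrable M f \<longleftrightarrow> f \<in> borel_measurable M \<and> integrable M (\<lambda>x. (f x)\<^sup>2)"

text \<open>The squared $L^2$-distance, with values in \<^typ>\<open>ennreal\<close> so that a small or vanishing value
  really means $L^2$-closeness, also for functions that are not known to be square integrable.\<close>

definition l2_dist2 :: "'a measure \<Rightarrow> ('a \<Rightarrow> real) \<Rightarrow> ('a \<Rightarrow> real) \<Rightarrow> ennreal" where
  "l2_dist2 M f g = (\<integral>\<^sup>+x. ennreal ((f x - g x)\<^sup>2) \<partial>M)"


section \<open>Volterra kernels\<close>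

text \<open>Processes and kernels are indexed by \<^typ>\<open>real\<close>; only nonnegative indices are meaningful.\<close>

definition volterra_kernel :: "(real \<Rightarrow> real \<Rightarrow> real) \<Rightarrow> bool" where
  "volterra_kernel z \<longleftrightarrow>
     (\<forall>r\<ge>0. square_integrable (lebesgue_on ({0..r} \<times> {0..r})) (\<lambda>(t, s). z t s)) \<and>
     (\<forall>t\<ge>0. square_integrable (lebesgue_on {0..}) (z t)) \<and>
     (\<forall>t\<ge>0. \<forall>s\<ge>t. z t s = 0)"

text \<open>Linear independence and density are those of the Hilbert space $L^2([0,\infty))$, i.e.\ of
  functions up to Lebesgue-null sets.\<close>

definition nondegenerate_kernel :: "(real \<Rightarrow> real \<Rightarrow> real) \<Rightarrow> bool" where
  "nondegenerate_kernel z \<longleftrightarrow>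
     (\<forall>F c. finite F \<and> F \<subseteq> {0<..} \<and> (AE s in lebesgue_on {0..}. (\<Sum>t\<in>F. c t * z t s) = 0)
        \<longrightarrow> (\<forall>t\<in>F. c t = 0)) \<and>
     (\<forall>f e. square_integrable (lebesgue_on {0..}) f \<and> e > 0 \<longrightarrow>
        (\<exists>F c. finite F \<and> F \<subseteq> {0<..} \<and>
           l2_dist2 (lebesgue_on {0..}) f (\<lambda>s. \<Sum>t\<in>F. c t * z t s) < e))"

definition volterra_covariance :: "(real \<Rightarrow> real \<Rightarrow> real) \<Rightarrow> real \<Rightarrow> real \<Rightarrow> real" where
  "volterra_covariance z s t = (LINT u|lebesgue_on {0..min s t}. z s u * z t u)"


section \<open>Gaussian processes, Brownian motion and Wiener integrals\<close>

text \<open>A point mass at $0$ counts as a centered Gaussian law.\<close>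

definition centered_gaussian :: "'a measure \<Rightarrow> ('a \<Rightarrow> real) \<Rightarrow> bool" where
  "centered_gaussian M Y \<longleftrightarrow> Y \<in> borel_measurable M \<and>
     ((AE \<omega> in M. Y \<omega> = 0) \<or> (\<exists>\<sigma>>0. distributed M lborel Y (normal_density 0 \<sigma>)))"

definition centered_gaussian_process :: "'a measure \<Rightarrow> (real \<Rightarrow> 'a \<Rightarrow> real) \<Rightarrow> bool" where
  "centered_gaussian_process M X \<longleftrightarrow>
     (\<forall>F c. finite F \<and> F \<subseteq> {0..} \<longrightarrow> centered_gaussian M (\<lambda>\<omega>. \<Sum>t\<in>F. c t * X t \<omega>))"

definition brownian_motion :: "'a measure \<Rightarrow> (real \<Rightarrow> 'a \<Rightarrow> real) \<Rightarrow> bool" where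
  "brownian_motion M W \<longleftrightarrow>
     (\<forall>t\<ge>0. W t \<in> borel_measurable M) \<and>
     (AE \<omega> in M. W 0 \<omega> = 0) \<and>
     (\<forall>s t. 0 \<le> s \<and> s < t \<longrightarrow>
        distributed M lborel (\<lambda>\<omega>. W t \<omega> - W s \<omega>) (normal_density 0 (sqrt (t - s)))) \<and>
     (\<forall>(n::nat) t. 0 \<le> t 0 \<and> (\<forall>i<n. t i \<le> t (Suc i)) \<longrightarrow>
        prob_space.indep_vars M (\<lambda>_. borel) (\<lambda>i \<omega>. W (t (Suc i)) \<omega> - W (t i) \<omega>) {..<n}) \<and>
     (AE \<omega> in M. continuous_on {0..} (\<lambda>t. W t \<omega>))"

text \<open>A list of triples $(c,a,b)$ stands for the elementary integrand
  $\sum c\,1_{(a,b]}$. The Wiener integral is the $L^2$-continuous extension of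
  $\sum c\,1_{(a,b]} \mapsto \sum c\,(W_b-W_a)$; as it is determined only up to null sets, it is
  rendered as a relation between the integrand and the random variable.\<close>

definition elementary_fun :: "(real \<times> real \<times> real) list \<Rightarrow> real \<Rightarrow> real" where
  "elementary_fun xs u = (\<Sum>(c, a, b)\<leftarrow>xs. c * indicat_real {a<..b} u)"

definition elementary_integral ::
    "(real \<Rightarrow> 'a \<Rightarrow> real) \<Rightarrow> (real \<times> real \<times> real) list \<Rightarrow> 'a \<Rightarrow> real" where
  "elementary_integral W xs \<omega> = (\<Sum>(c, a, b)\<leftarrow>xs. c * (W b \<omega> - W a \<omega>))"

definition is_wiener_integral ::
    "'a measure \<Rightarrow> (real \<Rightarrow> 'a \<Rightarrow> real) \<Rightarrow> (real \<Rightarrow> real) \<Rightarrow> ('a \<Rightarrow> real) \<Rightarrow> bool" where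
  "is_wiener_integral M W f Y \<longleftrightarrow> Y \<in> borel_measurable M \<and>
     (\<exists>xs :: nat \<Rightarrow> (real \<times> real \<times> real) list.
        (\<forall>k. \<forall>(c, a, b)\<in>set (xs k). 0 \<le> a \<and> a \<le> b) \<and>
        (\<lambda>k. l2_dist2 (lebesgue_on {0..}) (elementary_fun (xs k)) f) \<longlonglongrightarrow> 0 \<and>
        (\<lambda>k. l2_dist2 M (elementary_integral W (xs k)) Y) \<longlonglongrightarrow> 0)"

definition continuous_volterra_gaussian_process ::
    "'a measure \<Rightarrow> (real \<Rightarrow> 'a \<Rightarrow> real) \<Rightarrow> (real \<Rightarrow> real \<Rightarrow> real) \<Rightarrow> (real \<Rightarrow> 'a \<Rightarrow> real) \<Rightarrow> bool" where
  "continuous_volterra_gaussian_process M W z X \<longleftrightarrow>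
     prob_space M \<and> complete_measure M \<and> brownian_motion M W \<and> volterra_kernel z \<and>
     (\<forall>t\<ge>0. is_wiener_integral M W (\<lambda>s. indicat_real {0..t} s * z t s) (X t)) \<and>
     (\<forall>\<omega>\<in>space M. continuous_on {0..} (\<lambda>t. X t \<omega>))"

definition self_similar :: "'a measure \<Rightarrow> real \<Rightarrow> (real \<Rightarrow> 'a \<Rightarrow> real) \<Rightarrow> bool" where
  "self_similar M \<beta> X \<longleftrightarrow>
     (\<forall>a>0. \<forall>J. finite J \<and> J \<subseteq> {0..} \<longrightarrow>
        distr M (PiM J (\<lambda>_. borel)) (\<lambda>\<omega>. \<lambda>t\<in>J. X (a * t) \<omega>) =
        distr M (PiM J (\<lambda>_. borel)) (\<lambda>\<omega>. \<lambda>t\<in>J. a powr \<beta> * X t \<omega>))"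


section \<open>The coordinate space\<close>

text \<open>Paths $[0,\infty)\to\mathbb{R}$ are functions on \<^typ>\<open>real\<close> that are \<^const>\<open>undefined\<close> outside
  \<open>{0..}\<close> (this is part of the space of the product \<^const>\<open>PiM\<close>). The trace of the product
  $\sigma$-algebra on the continuous paths is $\sigma(X_t : t\ge 0)$. The measure carried by
  \<open>path_space\<close> is irrelevant, only its space and its measurable sets matter.\<close>

definition path_space :: "(real \<Rightarrow> real) measure" where
  "path_space = restrict_space (PiM {0..} (\<lambda>_. borel)) {\<omega>. continuous_on {0..} \<omega>}"

definition coord :: "real \<Rightarrow> (real \<Rightarrow> real) \<Rightarrow> real" where
  "coord t \<omega> = \<omega> t"

definition coordinate_law :: "(real \<Rightarrow> real \<Rightarrow> real) \<Rightarrow> (real \<Rightarrow> real) measure \<Rightarrow> bool" where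
  "coordinate_law z P \<longleftrightarrow>
     prob_space P \<and> sets P = sets path_space \<and>
     centered_gaussian_process P coord \<and>
     (\<forall>s\<ge>0. \<forall>t\<ge>0. (LINT \<omega>|P. coord s \<omega> * coord t \<omega>) = volterra_covariance z s t)"


section \<open>Mean-square integrals and the transformation\<close>

text \<open>\<open>Y\<close> is the $L^2$-limit of the Riemann sums of the process \<open>f\<close> over \<open>{a..b}\<close> as the mesh tends
  to $0$ (the gauge is a ball of constant radius).\<close>

definition ms_riemann_integral ::
    "'a measure \<Rightarrow> (real \<Rightarrow> 'a \<Rightarrow> real) \<Rightarrow> real \<Rightarrow> real \<Rightarrow> ('a \<Rightarrow> real) \<Rightarrow> bool" where
  "ms_riemann_integral M f a b Y \<longleftrightarrow> Y \<in> borel_measurable M \<and>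
     (\<forall>e>0. \<exists>d>0. \<forall>p. p tagged_division_of {a..b} \<and> (\<lambda>x. ball x d) fine p \<longrightarrow>
        l2_dist2 M (\<lambda>\<omega>. \<Sum>(s, K)\<in>p. measure lborel K * f s \<omega>) Y < e)"

text \<open>Integrals over $(0,t]$ and $[t,\infty)$ are improper in the mean-square sense, as the integrands
  below may be singular at $0$.\<close>

definition ms_integral_from_0 ::
    "'a measure \<Rightarrow> (real \<Rightarrow> 'a \<Rightarrow> real) \<Rightarrow> real \<Rightarrow> ('a \<Rightarrow> real) \<Rightarrow> bool" where
  "ms_integral_from_0 M f t Y \<longleftrightarrow> Y \<in> borel_measurable M \<and>
     (\<exists>J. (\<forall>a. 0 < a \<and> a < t \<longrightarrow> ms_riemann_integral M f a t (J a)) \<and>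
          ((\<lambda>a. l2_dist2 M (J a) Y) \<longlongrightarrow> 0) (at_right 0))"

definition ms_integral_to_infinity ::
    "'a measure \<Rightarrow> (real \<Rightarrow> 'a \<Rightarrow> real) \<Rightarrow> real \<Rightarrow> ('a \<Rightarrow> real) \<Rightarrow> bool" where
  "ms_integral_to_infinity M f t Y \<longleftrightarrow> Y \<in> borel_measurable M \<and>
     (\<exists>J. (\<forall>b>t. ms_riemann_integral M f t b (J b)) \<and>
          ((\<lambda>b. l2_dist2 M (J b) Y) \<longlongrightarrow> 0) at_top)"

text \<open>\<open>M\<close> is the completed coordinate space. The formulas determine the path-valued maps
  $\mathcal{Z}^{\alpha}$ and $\mathcal{Z}^{\alpha,-1}$ up to a null set only, hence the following
  predicates say that \<open>Z\<close> is a version of the respective transformation. That versions are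
  measure preserving and inverse to each other is not part of these predicates.\<close>

definition is_Z_transform ::
    "(real \<Rightarrow> real) measure \<Rightarrow> real \<Rightarrow> real \<Rightarrow> ((real \<Rightarrow> real) \<Rightarrow> (real \<Rightarrow> real)) \<Rightarrow> bool" where
  "is_Z_transform M \<alpha> \<beta> Z \<longleftrightarrow> Z \<in> M \<rightarrow>\<^sub>M path_space \<and>
     (AE \<omega> in M. coord 0 (Z \<omega>) = 0) \<and>
     (\<forall>t>0. \<exists>Y. ms_integral_from_0 M (\<lambda>s \<omega>. s powr (\<alpha> - \<beta> - 1/2) * coord s \<omega>) t Y \<and>
        (AE \<omega> in M. coord t (Z \<omega>) =
           coord t \<omega> - (2 * \<alpha> + 1) * t powr (\<beta> - \<alpha> - 1/2) * Y \<omega>))"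

definition is_Z_inverse_transform ::
    "(real \<Rightarrow> real) measure \<Rightarrow> real \<Rightarrow> real \<Rightarrow> ((real \<Rightarrow> real) \<Rightarrow> (real \<Rightarrow> real)) \<Rightarrow> bool" where
  "is_Z_inverse_transform M \<alpha> \<beta> Z \<longleftrightarrow> Z \<in> M \<rightarrow>\<^sub>M path_space \<and>
     (AE \<omega> in M. coord 0 (Z \<omega>) = 0) \<and>
     (\<forall>t>0. \<exists>Y. ms_integral_to_infinity M (\<lambda>s \<omega>. coord s \<omega> * s powr (- \<beta> - \<alpha> - 3/2)) t Y \<and>
        (AE \<omega> in M. coord t (Z \<omega>) =
           coord t \<omega> - (2 * \<alpha> + 1) * t powr (\<alpha> + \<beta> + 1/2) * Y \<omega>))"


section \<open>$\sigma$-algebras modulo null sets and Kolmogorov automorphisms\<close>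

text \<open>In this section \<open>M\<close> is a complete probability space. Every $\sigma$-algebra is completed by
  the null sets, so that equality and inclusion modulo null sets become plain equality and
  inclusion. In particular \<open>null_completion M {{}, space M}\<close> is the trivial $\sigma$-algebra.\<close>

definition null_completion :: "'a measure \<Rightarrow> 'a set set \<Rightarrow> 'a set set" where
  "null_completion M \<G> = sigma_sets (space M) (\<G> \<union> null_sets M)"

definition sigma_rv :: "'a measure \<Rightarrow> ('a \<Rightarrow> real) \<Rightarrow> 'a set set" where
  "sigma_rv M Y = null_completion M {Y -` B \<inter> space M | B. B \<in> sets borel}"

definition sigma_join :: "'a measure \<Rightarrow> 'i set \<Rightarrow> ('i \<Rightarrow> 'a set set) \<Rightarrow> 'a set set" where
  "sigma_join M I \<A> = null_completion M (\<Union>i\<in>I. \<A> i)"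

definition completed_natural_filtration ::
    "'a measure \<Rightarrow> (real \<Rightarrow> 'a \<Rightarrow> real) \<Rightarrow> real \<Rightarrow> 'a set set" where
  "completed_natural_filtration M X t = sigma_join M {0..t} (\<lambda>s. sigma_rv M (X s))"

definition automorphism :: "'a measure \<Rightarrow> ('a \<Rightarrow> 'a) \<Rightarrow> ('a \<Rightarrow> 'a) \<Rightarrow> bool" where
  "automorphism M Z Zi \<longleftrightarrow>
     Z \<in> M \<rightarrow>\<^sub>M M \<and> Zi \<in> M \<rightarrow>\<^sub>M M \<and> distr M M Z = M \<and> distr M M Zi = M \<and>
     (AE \<omega> in M. Zi (Z \<omega>) = \<omega>) \<and> (AE \<omega> in M. Z (Zi \<omega>) = \<omega>)"

definition iterate :: "('a \<Rightarrow> 'a) \<Rightarrow> ('a \<Rightarrow> 'a) \<Rightarrow> int \<Rightarrow> 'a \<Rightarrow> 'a" where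
  "iterate Z Zi n = (if n \<ge> 0 then Z ^^ nat n else Zi ^^ nat (- n))"

text \<open>Sign convention: $\mathcal{Z}^m\mathcal{A} = \{\{\omega : \mathcal{Z}^m(\omega)\in B\} : B\in\mathcal{A}\}$,
  i.e.\ the preimage under the \<open>m\<close>-th iterate itself.\<close>

definition sigma_action ::
    "'a measure \<Rightarrow> ('a \<Rightarrow> 'a) \<Rightarrow> ('a \<Rightarrow> 'a) \<Rightarrow> int \<Rightarrow> 'a set set \<Rightarrow> 'a set set" where
  "sigma_action M Z Zi m \<A> = null_completion M {iterate Z Zi m -` B \<inter> space M | B. B \<in> \<A>}"

text \<open>\<open>Zi\<close> is the inverse of \<open>Z\<close>, which is unique up to null sets.\<close>

definition kolmogorov_automorphism ::
    "'a measure \<Rightarrow> ('a \<Rightarrow> 'a) \<Rightarrow> ('a \<Rightarrow> 'a) \<Rightarrow> 'a set set \<Rightarrow> bool" where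
  "kolmogorov_automorphism M Z Zi \<A> \<longleftrightarrow>
     automorphism M Z Zi \<and>
     sigma_algebra (space M) \<A> \<and> \<A> \<subseteq> sets M \<and>
     sigma_action M Z Zi (-1) \<A> \<subseteq> null_completion M \<A> \<and>
     sigma_join M UNIV (\<lambda>m. sigma_action M Z Zi m \<A>) = sets M \<and>
     (\<Inter>m::nat. sigma_action M Z Zi (- int m) \<A>) = null_completion M {{}, space M}"

end

theory Submission
  imports Defs "HOL-Library.Function_Algebras"
begin

text \<open>
The transformation acts on random variables by \<open>V f = f \<circ> Z\<close>. Put \<open>a = \<alpha> + 1/2\<close>. Dividing \<open>X\<close> at time \<open>t\<close> by
\<open>t powr \<beta>\<close> and using logarithmic time turns \<open>X\<close> into a stationary Gaussian process, and \<open>V\<close> into the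
all-pass filter \<open>(D - a) / (D + a)\<close>, where \<open>D\<close> is the generator of the time shift. This filter is unitary
and looks only into the past; its inverse looks only into the future.

Everything about \<open>V\<close> is drawn from one identity. Let \<open>J = X / (D + a)\<close> be the causal average of \<open>X\<close>, so that
\<open>V X = X - 2 a J\<close>. For a bounded symmetric form \<open>q\<close> on the Hilbert space,
\<open>q (V X, V X) - q (X, X)\<close> is \<open>- 2 a\<close> times the derivative of \<open>q (J, J)\<close> along the time shift
(\<open>form_J_derivative\<close>). Hence \<open>q\<close> is invariant under \<open>V\<close> exactly if \<open>q (J, J)\<close> is invariant under time shifts.

For the inner product, the shift invariance is known; so \<open>V\<close> is isometric on \<open>X\<close>, and, the process being
Gaussian, \<open>Z\<close> preserves the measure (\<open>Z_measure_preserving\<close>). Conversely, let \<open>q\<close> be the form of the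
projection onto a closed subspace that \<open>V\<close> and its inverse leave invariant. Then \<open>q\<close> is \<open>V\<close>-invariant, thus
\<open>q (J, J)\<close> is constant in logarithmic time, and it vanishes as soon as \<open>q (X, X)\<close> is small along some times
(\<open>invariant_form_vanishes\<close>). This has three consequences.

\<^item> The closed span of the orbit of \<open>X\<close> at the single time \<open>T\<close> is reducing, and its complement does not see \<open>X\<close>
at \<open>T\<close>; so it contains \<open>X\<close> at all times (\<open>total_orbit\<close>). Hence the \<open>\<sigma>\<close>-algebras generate everything.
\<^item> The tail of the filtration is reducing. At late times the normalised process is almost orthogonal to the
past up to \<open>T\<close>, because by self-similarity this is the statement that the kernel \<open>z 1\<close> has little mass near
\<open>0\<close>. So the tail is orthogonal to \<open>X\<close> (\<open>tail_of_filtration\<close>).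
\<^item> The remote past of the stationary sequence \<open>V ^ n X\<close> at time \<open>T\<close> is reducing as well. Reversing the sequence
does not change its covariance, and its remote future lies in the tail just treated. So the remote past is
orthogonal to \<open>X\<close>, too (\<open>tail_of_orbit_past\<close>).

For Gaussian spaces, orthogonality means independence, and a tail event is independent of itself
(\<open>tail_zero_one\<close>). This carries the statements from closed subspaces to \<open>\<sigma>\<close>-algebras
(\<open>kolmogorov_if_gaussian\<close>).
\<close>


section \<open>Projections in semi-inner product spaces\<close>

text \<open>The square-integrable functions of a measure carry an inner product that is definite only up to
null sets. Keeping functions instead of classes costs a seminorm, but lets random variables be
composed with transformations pointwise. The carrier \<open>H\<close> is a subspace of a larger vector space
for the same reason.\<close>

locale semi_inner =
  fixes H :: "'v::real_vector set" and ip :: "'v \<Rightarrow> 'v \<Rightarrow> real"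
  assumes subspace_H: "subspace H"
    and ip_add_left: "x \<in> H \<Longrightarrow> y \<in> H \<Longrightarrow> w \<in> H \<Longrightarrow> ip (x + y) w = ip x w + ip y w"
    and ip_scale_left: "x \<in> H \<Longrightarrow> w \<in> H \<Longrightarrow> ip (c *\<^sub>R x) w = c * ip x w"
    and ip_commute: "ip x y = ip y x"
    and ip_nonneg: "0 \<le> ip x x"
begin

definition nrm :: "'v \<Rightarrow> real" where
  "nrm x = sqrt (ip x x)"

lemma H_add [simp, intro]: "x \<in> H \<Longrightarrow> y \<in> H \<Longrightarrow> x + y \<in> H"
  and H_scale [simp, intro]: "x \<in> H \<Longrightarrow> c *\<^sub>R x \<in> H"
  and H_diff [simp, intro]: "x \<in> H \<Longrightarrow> y \<in> H \<Longrightarrow> x - y \<in> H"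
  and H_minus [simp, intro]: "x \<in> H \<Longrightarrow> - x \<in> H"
  and H_zero [simp, intro]: "0 \<in> H"
  using subspace_H
  by (auto intro: subspace_add subspace_scale subspace_diff subspace_neg subspace_0)

lemma ip_add_right: "x \<in> H \<Longrightarrow> y \<in> H \<Longrightarrow> w \<in> H \<Longrightarrow> ip w (x + y) = ip w x + ip w y"
  using ip_add_left ip_commute by metis

lemma ip_scale_right: "x \<in> H \<Longrightarrow> w \<in> H \<Longrightarrow> ip w (c *\<^sub>R x) = c * ip w x"
  using ip_scale_left ip_commute by metis

lemma ip_minus_left: "x \<in> H \<Longrightarrow> w \<in> H \<Longrightarrow> ip (- x) w = - ip x w"
  using ip_scale_left[of x w "-1"] by simp

lemma ip_minus_right: "x \<in> H \<Longrightarrow> w \<in> H \<Longrightarrow> ip w (- x) = - ip w x"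
  using ip_minus_left ip_commute by metis

lemma ip_diff_left: "x \<in> H \<Longrightarrow> y \<in> H \<Longrightarrow> w \<in> H \<Longrightarrow> ip (x - y) w = ip x w - ip y w"
  using ip_add_left[of x "- y" w] ip_minus_left[of y w] by simp

lemma ip_diff_right: "x \<in> H \<Longrightarrow> y \<in> H \<Longrightarrow> w \<in> H \<Longrightarrow> ip w (x - y) = ip w x - ip w y"
  using ip_diff_left ip_commute by metis

lemmas ip_linear = ip_add_left ip_add_right ip_diff_left ip_diff_right ip_scale_left ip_scale_right
  ip_minus_left ip_minus_right

lemma ip_zero_left [simp]: "w \<in> H \<Longrightarrow> ip 0 w = 0"
  using ip_scale_left[of 0 w 0] by simp

lemma ip_zero_right [simp]: "w \<in> H \<Longrightarrow> ip w 0 = 0"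
  using ip_zero_left ip_commute by metis

lemma ip_sum_left:
  assumes "\<And>i. i \<in> I \<Longrightarrow> f i \<in> H" "w \<in> H"
  shows "ip (\<Sum>i\<in>I. f i) w = (\<Sum>i\<in>I. ip (f i) w)"
  using assms
proof (induction I rule: infinite_finite_induct)
  case (insert i I)
  then have "sum f I \<in> H" by (intro subspace_sum[OF subspace_H]) auto
  with insert show ?case by (simp add: ip_add_left)
qed auto

lemma nrm_nonneg [simp]: "0 \<le> nrm x"
  by (simp add: nrm_def ip_nonneg)

lemma nrm_square: "(nrm x)\<^sup>2 = ip x x"
  by (simp add: nrm_def ip_nonneg)

lemma nrm_zero [simp]: "nrm 0 = 0"
  by (simp add: nrm_def)

lemma nrm_scale: "x \<in> H \<Longrightarrow> nrm (c *\<^sub>R x) = \<bar>c\<bar> * nrm x"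
  by (simp add: nrm_def ip_linear real_sqrt_mult flip: mult.assoc power2_eq_square)

lemma nrm_minus: "x \<in> H \<Longrightarrow> nrm (- x) = nrm x"
  by (simp add: nrm_def ip_linear)

lemma nrm_diff_commute: "x \<in> H \<Longrightarrow> y \<in> H \<Longrightarrow> nrm (x - y) = nrm (y - x)"
  using nrm_minus[of "x - y"] by simp

lemma Cauchy_Schwarz:
  assumes "x \<in> H" "y \<in> H"
  shows "\<bar>ip x y\<bar> \<le> nrm x * nrm y"
proof -
  have *: "0 \<le> ip x x - 2 * c * ip x y + c\<^sup>2 * ip y y" for c
    using ip_nonneg[of "x - c *\<^sub>R y"] assms
    by (simp add: ip_linear ip_commute[of y x] power2_eq_square algebra_simps)
  have "(ip x y)\<^sup>2 \<le> ip x x * ip y y"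
  proof (cases "ip y y = 0")
    case True
    have "ip x y = 0"
    proof (rule ccontr)
      assume "ip x y \<noteq> 0"
      then show False
        using *[of "(ip x x + 1) / (2 * ip x y)"] True by (simp add: field_simps)
    qed
    then show ?thesis using True by simp
  next
    case False
    then have pos: "ip y y > 0" using ip_nonneg[of y] by simp
    show ?thesis
      using *[of "ip x y / ip y y"] pos
      by (simp add: field_simps power2_eq_square)
  qed
  then show ?thesis
    by (metis nrm_def real_sqrt_abs real_sqrt_le_iff real_sqrt_mult)
qed

lemma nrm_triangle:
  assumes "x \<in> H" "y \<in> H"
  shows "nrm (x + y) \<le> nrm x + nrm y"
proof (rule power2_le_imp_le)
  have "(nrm (x + y))\<^sup>2 = (nrm x)\<^sup>2 + 2 * ip x y + (nrm y)\<^sup>2"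
    using assms by (simp add: nrm_square ip_linear ip_commute[of y x])
  also have "\<dots> \<le> (nrm x)\<^sup>2 + 2 * (nrm x * nrm y) + (nrm y)\<^sup>2"
    using Cauchy_Schwarz[OF assms] by (simp add: abs_le_iff)
  finally show "(nrm (x + y))\<^sup>2 \<le> (nrm x + nrm y)\<^sup>2"
    by (simp add: power2_sum)
qed simp

lemma nrm_triangle_diff: "x \<in> H \<Longrightarrow> y \<in> H \<Longrightarrow> w \<in> H \<Longrightarrow> nrm (x - w) \<le> nrm (x - y) + nrm (y - w)"
  using nrm_triangle[of "x - y" "y - w"] by simp

lemma nrm_diff_bound: "x \<in> H \<Longrightarrow> y \<in> H \<Longrightarrow> \<bar>nrm x - nrm y\<bar> \<le> nrm (x - y)"
  using nrm_triangle[of "x - y" y] nrm_triangle[of "y - x" x] nrm_diff_commute[of x y]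
  by simp

lemma nrm_zero_ip: "nrm x = 0 \<Longrightarrow> x \<in> H \<Longrightarrow> y \<in> H \<Longrightarrow> ip x y = 0"
  using Cauchy_Schwarz[of x y] by simp

text \<open>As distances are seminorms, a closed subspace in this sense contains every vector at distance
\<open>0\<close> from one of its elements.\<close>

definition closed_sub :: "'v set \<Rightarrow> bool" where
  "closed_sub S \<longleftrightarrow> subspace S \<and> S \<subseteq> H \<and>
     (\<forall>x\<in>H. (\<forall>e>0. \<exists>y\<in>S. nrm (x - y) < e) \<longrightarrow> x \<in> S)"

lemma closed_subD:
  assumes "closed_sub S"
  shows "subspace S" "S \<subseteq> H" "\<And>x. x \<in> S \<Longrightarrow> x \<in> H"
    "\<And>x. x \<in> H \<Longrightarrow> (\<And>e. e > 0 \<Longrightarrow> \<exists>y\<in>S. nrm (x - y) < e) \<Longrightarrow> x \<in> S"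
  using assms unfolding closed_sub_def by blast+

lemma closed_sub_congruent:
  assumes "closed_sub S" "x \<in> S" "y \<in> H" "nrm (y - x) = 0"
  shows "y \<in> S"
  using closed_subD(4)[OF assms(1,3)] assms(2,4) by metis

lemma closed_sub_Inter:
  assumes "\<And>i. i \<in> I \<Longrightarrow> closed_sub (S i)" "I \<noteq> {}"
  shows "closed_sub (\<Inter>i\<in>I. S i)"
  unfolding closed_sub_def
proof (intro conjI ballI impI)
  show "subspace (\<Inter>i\<in>I. S i)"
    using assms(1) closed_subD(1) by (auto intro!: subspace_Inter)
  show "(\<Inter>i\<in>I. S i) \<subseteq> H" using assms closed_subD(2) by blast
  fix x assume x: "x \<in> H" "\<forall>e>0. \<exists>y\<in>(\<Inter>i\<in>I. S i). nrm (x - y) < e"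
  show "x \<in> (\<Inter>i\<in>I. S i)"
  proof
    fix i assume "i \<in> I"
    then show "x \<in> S i"
      using x(2) by (intro closed_subD(4)[OF assms(1)[OF \<open>i \<in> I\<close>] x(1)]) (meson INT_D)
  qed
qed

definition cspan :: "'v set \<Rightarrow> 'v set" where
  "cspan A = {x \<in> H. \<forall>e>0. \<exists>y\<in>span A. nrm (x - y) < e}"

lemma span_subset_H: "A \<subseteq> H \<Longrightarrow> span A \<subseteq> H"
  by (rule span_minimal[OF _ subspace_H])

lemma span_subset_cspan: "A \<subseteq> H \<Longrightarrow> span A \<subseteq> cspan A"
  proof
  fix x assume "A \<subseteq> H" "x \<in> span A"
  then show "x \<in> cspan A" using span_subset_H[of A] unfolding cspan_def
    by (intro CollectI conjI allI impI bexI[of _ x]) auto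
qed

lemma cspan_superset: "A \<subseteq> H \<Longrightarrow> A \<subseteq> cspan A"
  using span_subset_cspan span_superset by blast

lemma closed_sub_cspan:
  assumes A: "A \<subseteq> H"
  shows "closed_sub (cspan A)"
  unfolding closed_sub_def
proof (intro conjI ballI impI)
  note sH = span_subset_H[OF A, THEN subsetD]
  show sub: "cspan A \<subseteq> H" unfolding cspan_def by auto
  show "subspace (cspan A)"
  proof (intro subspaceI)
    show "0 \<in> cspan A" using span_subset_cspan[OF A] span_zero by blast
    fix x y assume xy: "x \<in> cspan A" "y \<in> cspan A"
    show "x + y \<in> cspan A"
      unfolding cspan_def
    proof (intro CollectI conjI allI impI)
      show "x + y \<in> H" using xy sub by auto
      fix e :: real assume "e > 0"
      then obtain x' y' where *: "x' \<in> span A" "nrm (x - x') < e / 2" "y' \<in> span A" "nrm (y - y') < e / 2"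
        using xy unfolding cspan_def by (auto dest!: spec[of _ "e / 2"])
      have "nrm ((x - x') + (y - y')) \<le> nrm (x - x') + nrm (y - y')"
        using * xy sub sH by (intro nrm_triangle) auto
      then show "\<exists>w\<in>span A. nrm (x + y - w) < e"
        using * by (intro bexI[of _ "x' + y'"]) (auto simp: algebra_simps span_add)
    qed
  next
    fix x and c :: real assume x: "x \<in> cspan A"
    show "c *\<^sub>R x \<in> cspan A"
      unfolding cspan_def
    proof (intro CollectI conjI allI impI)
      show "c *\<^sub>R x \<in> H" using x sub by auto
      fix e :: real assume "e > 0"
      then have "e / (\<bar>c\<bar> + 1) > 0" by simp
      then obtain x' where *: "x' \<in> span A" "nrm (x - x') < e / (\<bar>c\<bar> + 1)"
        using x unfolding cspan_def by blast
      have "nrm (c *\<^sub>R x - c *\<^sub>R x') = \<bar>c\<bar> * nrm (x - x')"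
        using * x sub sH nrm_scale[of "x - x'" c] by (auto simp: scaleR_diff_right)
      also have "\<dots> \<le> (\<bar>c\<bar> + 1) * nrm (x - x')" by (simp add: mult_right_mono)
      also have "\<dots> < e" using *(2) by (simp add: field_simps)
      finally show "\<exists>w\<in>span A. nrm (c *\<^sub>R x - w) < e"
        using * span_scale by blast
    qed
  qed
  fix x assume x: "x \<in> H" "\<forall>e>0. \<exists>y\<in>cspan A. nrm (x - y) < e"
  show "x \<in> cspan A"
    unfolding cspan_def
  proof (intro CollectI conjI allI impI)
    fix e :: real assume "e > 0"
    then obtain y where y: "y \<in> cspan A" "nrm (x - y) < e / 2" using x(2) half_gt_zero by blast
    then obtain w where w: "w \<in> span A" "nrm (y - w) < e / 2"
      using \<open>e > 0\<close> half_gt_zero unfolding cspan_def by blast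
    have "nrm (x - w) \<le> nrm (x - y) + nrm (y - w)"
      using x y w sub sH by (intro nrm_triangle_diff) auto
    then show "\<exists>w\<in>span A. nrm (x - w) < e" using w y by (intro bexI[of _ w]) auto
  qed (fact x)
qed

lemma cspan_minimal:
  assumes "A \<subseteq> S" "closed_sub S"
  shows "cspan A \<subseteq> S"
proof
  fix x assume x: "x \<in> cspan A"
  have "span A \<subseteq> S" using assms closed_subD(1) span_minimal by blast
  then show "x \<in> S"
    using x unfolding cspan_def by (intro closed_subD(4)[OF assms(2)]) blast+
qed

lemma cspan_mono: "A \<subseteq> B \<Longrightarrow> cspan A \<subseteq> cspan B"
  unfolding cspan_def using span_mono by blast

lemma ip_bound_cspan:
  assumes A: "A \<subseteq> H" and x: "x \<in> H" and y: "y \<in> cspan A" and c: "0 \<le> c"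
    and bound: "\<And>y. y \<in> span A \<Longrightarrow> \<bar>ip x y\<bar> \<le> c * nrm y"
  shows "\<bar>ip x y\<bar> \<le> c * nrm y"
proof (rule field_le_epsilon)
  fix e :: real assume "e > 0"
  have yH: "y \<in> H" using y by (simp add: cspan_def)
  define d where "d = e / (nrm x + c + 1)"
  have "nrm x + c + 1 > 0" using c by (simp add: add_nonneg_pos)
  then have "d > 0" and d: "d * (nrm x + c) \<le> e"
    using \<open>e > 0\<close> c by (auto simp: d_def field_simps)
  then obtain w where w: "w \<in> span A" "nrm (y - w) < d" using y unfolding cspan_def by blast
  have wH: "w \<in> H" using w span_subset_H[OF A] by blast
  have "\<bar>ip x y\<bar> = \<bar>ip x (y - w) + ip x w\<bar>" using x yH wH by (simp add: ip_linear)
  also have "\<dots> \<le> nrm x * nrm (y - w) + c * nrm w"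
    using Cauchy_Schwarz[of x "y - w"] bound[OF w(1)] x yH wH by auto
  also have "\<dots> \<le> nrm x * d + c * (nrm y + d)"
    using w(2) c nrm_diff_bound[of y w] yH wH
    by (intro add_mono mult_left_mono) auto
  also have "\<dots> \<le> c * nrm y + e" using d by (simp add: algebra_simps)
  finally show "\<bar>ip x y\<bar> \<le> c * nrm y + e" .
qed

end

locale semi_hilbert = semi_inner H ip
  for H :: "'v::real_vector set" and ip +
  assumes complete: "(\<And>n. u n \<in> H) \<Longrightarrow>
     (\<And>e. e > 0 \<Longrightarrow> \<exists>N. \<forall>m\<ge>N. \<forall>n\<ge>N. ip (u m - u n) (u m - u n) < e) \<Longrightarrow>
     \<exists>x\<in>H. (\<lambda>n. ip (u n - x) (u n - x)) \<longlonglongrightarrow> 0"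
begin

lemma complete_nrm:
  assumes "\<And>n. u n \<in> H" "\<And>e. e > 0 \<Longrightarrow> \<exists>N. \<forall>m\<ge>N. \<forall>n\<ge>N. (nrm (u m - u n))\<^sup>2 < e"
  obtains x where "x \<in> H" "(\<lambda>n. nrm (u n - x)) \<longlonglongrightarrow> 0"
proof -
  have "\<exists>x\<in>H. (\<lambda>n. ip (u n - x) (u n - x)) \<longlonglongrightarrow> 0"
    using complete[of u] assms by (simp add: nrm_square)
  then obtain x where x: "x \<in> H" "(\<lambda>n. ip (u n - x) (u n - x)) \<longlonglongrightarrow> 0" by blast
  then have "(\<lambda>n. nrm (u n - x)) \<longlonglongrightarrow> 0"
    unfolding nrm_def using tendsto_real_sqrt by fastforce
  with x that show ?thesis by blast
qed

text \<open>The usual argument: by the parallelogram law a minimising sequence is Cauchy, and a nearest point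
has an orthogonal remainder.\<close>

theorem projection_exists:
  assumes S: "closed_sub S" and x: "x \<in> H"
  shows "\<exists>p\<in>S. \<forall>y\<in>S. ip (x - p) y = 0"
proof -
  note SH = closed_subD(3)[OF S]
  note Ssub = closed_subD(1)[OF S]
  define d where "d = Inf ((\<lambda>y. (nrm (x - y))\<^sup>2) ` S)"
  have bdd: "bdd_below ((\<lambda>y. (nrm (x - y))\<^sup>2) ` S)" by (rule bdd_belowI[of _ 0]) auto
  have ne: "S \<noteq> {}" using subspace_0[OF Ssub] by auto
  have d_le: "d \<le> (nrm (x - y))\<^sup>2" if "y \<in> S" for y
    unfolding d_def using that by (intro cInf_lower[OF _ bdd]) auto
  have "\<exists>y\<in>S. (nrm (x - y))\<^sup>2 < d + 1 / real (Suc n)" for n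
  proof -
    have "Inf ((\<lambda>y. (nrm (x - y))\<^sup>2) ` S) < d + 1 / real (Suc n)" by (simp add: d_def)
    then show ?thesis using cInf_less_iff[OF _ bdd] ne by auto
  qed
  then obtain u where u: "\<And>n. u n \<in> S" "\<And>n. (nrm (x - u n))\<^sup>2 < d + 1 / real (Suc n)" by metis
  have par: "(nrm (v - w))\<^sup>2 \<le> 2 * (nrm (x - v))\<^sup>2 + 2 * (nrm (x - w))\<^sup>2 - 4 * d" if "v \<in> S" "w \<in> S" for v w
  proof -
    have m: "(1/2) *\<^sub>R (v + w) \<in> S" using that Ssub by (intro subspace_scale subspace_add) auto
    have "(nrm (v - w))\<^sup>2 = 2 * (nrm (x - v))\<^sup>2 + 2 * (nrm (x - w))\<^sup>2 - 4 * (nrm (x - (1/2) *\<^sub>R (v + w)))\<^sup>2"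
      using that SH x by (simp add: nrm_square ip_linear ip_commute[of w v] ip_commute[of v x] ip_commute[of w x] field_simps)
    then show ?thesis using d_le[OF m] by linarith
  qed
  obtain p where p: "p \<in> H" "(\<lambda>n. nrm (u n - p)) \<longlonglongrightarrow> 0"
  proof (rule complete_nrm[of u])
    show "u n \<in> H" for n using u(1) SH by blast
    fix e :: real assume "e > 0"
    then obtain N where N: "1 / real (Suc N) < e / 4"
      by (metis nat_approx_posE zero_less_divide_iff zero_less_numeral)
    show "\<exists>N. \<forall>m\<ge>N. \<forall>n\<ge>N. (nrm (u m - u n))\<^sup>2 < e"
    proof (intro exI allI impI)
      fix m n assume "N \<le> m" "N \<le> n"
      then have "1 / real (Suc m) \<le> 1 / real (Suc N)" "1 / real (Suc n) \<le> 1 / real (Suc N)"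
        by (auto intro!: divide_left_mono)
      then have "1 / real (Suc m) < e / 4" "1 / real (Suc n) < e / 4"
        using N by linarith+
      then show "(nrm (u m - u n))\<^sup>2 < e"
        using par[OF u(1) u(1), of m n] u(2)[of m] u(2)[of n] by argo
    qed
  qed
  have pS: "p \<in> S"
  proof (rule closed_subD(4)[OF S p(1)])
    fix e :: real assume "e > 0"
    then obtain n where "nrm (u n - p) < e"
      using order_tendstoD(2)[OF p(2)] unfolding eventually_sequentially by auto
    then show "\<exists>y\<in>S. nrm (p - y) < e"
      using u(1) SH p(1) nrm_diff_commute by metis
  qed
  have "nrm (x - p) \<le> sqrt d"
  proof (rule LIMSEQ_le_const)
    show "(\<lambda>n. sqrt (d + 1 / real (Suc n)) + nrm (u n - p)) \<longlonglongrightarrow> sqrt d"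
      using tendsto_add[OF tendsto_real_sqrt[OF LIMSEQ_inverse_real_of_nat_add[of d]] p(2)]
      by (simp add: inverse_eq_divide)
    show "\<exists>N. \<forall>n\<ge>N. nrm (x - p) \<le> sqrt (d + 1 / real (Suc n)) + nrm (u n - p)"
    proof (intro exI allI impI)
      fix n
      have "nrm (x - u n) \<le> sqrt (d + 1 / real (Suc n))"
        using u(2)[of n] real_le_rsqrt by auto
      then show "nrm (x - p) \<le> sqrt (d + 1 / real (Suc n)) + nrm (u n - p)"
        using nrm_triangle_diff[of x "u n" p] x p(1) u(1) SH by (meson add_mono_thms_linordered_semiring(3) order_trans)
    qed
  qed
  moreover have "0 \<le> d" unfolding d_def using ne by (intro cInf_greatest) auto
  ultimately have best: "(nrm (x - p))\<^sup>2 \<le> d" by (metis nrm_nonneg power_mono real_sqrt_pow2)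
  have "ip (x - p) y = 0" if y: "y \<in> S" for y
  proof -
    have *: "0 \<le> c\<^sup>2 * ip y y - 2 * c * ip (x - p) y" for c
    proof -
      have "p + c *\<^sub>R y \<in> S" using pS y Ssub by (intro subspace_add subspace_scale)
      then have "(nrm (x - p))\<^sup>2 \<le> (nrm (x - (p + c *\<^sub>R y)))\<^sup>2" using order_trans[OF best d_le] by blast
      also have "x - (p + c *\<^sub>R y) = (x - p) - c *\<^sub>R y" by simp
      also have "(nrm \<dots>)\<^sup>2 = (nrm (x - p))\<^sup>2 - 2 * c * ip (x - p) y + c\<^sup>2 * ip y y"
        using x p(1) SH[OF y] unfolding nrm_square
        by (simp add: ip_linear ip_commute[of y x] ip_commute[of y p] power2_eq_square algebra_simps)
      finally show ?thesis by simp
    qed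
    show ?thesis
    proof (cases "ip y y = 0")
      case True then show ?thesis using *[of 1] *[of "-1"] by simp
    next
      case False
      then have "ip y y > 0" using ip_nonneg[of y] by simp
      then have "(ip (x - p) y)\<^sup>2 \<le> 0" using *[of "ip (x - p) y / ip y y"]
        by (simp add: field_simps power2_eq_square)
      then show ?thesis by simp
    qed
  qed
  then show ?thesis using pS by blast
qed

text \<open>Projections are unique only up to distance \<open>0\<close>, so one is chosen; only inner products with it
matter below.\<close>

definition proj :: "'v set \<Rightarrow> 'v \<Rightarrow> 'v" where
  "proj S x = (SOME p. p \<in> S \<and> (\<forall>y\<in>S. ip (x - p) y = 0))"

lemma
  assumes "closed_sub S" "x \<in> H"
  shows proj_in: "proj S x \<in> S" and proj_in_H: "proj S x \<in> H"
    and proj_orth: "y \<in> S \<Longrightarrow> ip (x - proj S x) y = 0"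
    and ip_proj: "y \<in> S \<Longrightarrow> ip (proj S x) y = ip x y"
proof -
  show 1: "proj S x \<in> S" and 2: "\<And>y. y \<in> S \<Longrightarrow> ip (x - proj S x) y = 0"
    using someI_ex[of "\<lambda>p. p \<in> S \<and> (\<forall>y\<in>S. ip (x - p) y = 0)"] projection_exists[OF assms]
    unfolding proj_def by blast+
  then show "proj S x \<in> H" using closed_subD(2)[OF assms(1)] by blast
  then show "ip (proj S x) y = ip x y" if "y \<in> S"
    using 2[OF that] assms(2) that closed_subD(2)[OF assms(1)] by (auto simp: ip_linear)
qed

lemma ip_proj_left:
  assumes "closed_sub S" "x \<in> H" "y \<in> H"
  shows "ip (proj S x) (proj S y) = ip (proj S x) y"
  using ip_proj[OF assms(1,3) proj_in[OF assms(1,2)]] ip_commute by metis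

lemma ip_proj_sym:
  assumes "closed_sub S" "x \<in> H" "y \<in> H"
  shows "ip (proj S x) y = ip x (proj S y)"
  using ip_proj_left[OF assms] ip_proj_left[OF assms(1,3,2)] ip_commute by metis

lemma nrm_proj_le:
  assumes "closed_sub S" "x \<in> H"
  shows "nrm (proj S x) \<le> nrm x"
proof -
  have "ip (proj S x) (proj S x) = ip (proj S x) x" using ip_proj_left[OF assms assms(2)] .
  then have "(nrm (proj S x))\<^sup>2 \<le> nrm (proj S x) * nrm x"
    using Cauchy_Schwarz[OF proj_in_H[OF assms] assms(2)] by (simp add: nrm_square)
  then show ?thesis
    by (metis mult_le_cancel_left_pos nrm_nonneg order_le_less power2_eq_square)
qed

lemma nrm_proj_le_bound:
  assumes S: "closed_sub S" and x: "x \<in> H" and c: "0 \<le> c"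
    and bound: "\<And>y. y \<in> S \<Longrightarrow> \<bar>ip x y\<bar> \<le> c * nrm y"
  shows "nrm (proj S x) \<le> c"
proof -
  have "(nrm (proj S x))\<^sup>2 = ip x (proj S x)"
    using ip_proj[OF S x proj_in[OF S x]] by (simp add: nrm_square)
  also have "\<dots> \<le> c * nrm (proj S x)" using bound[OF proj_in[OF S x]] by simp
  finally show ?thesis
    using c by (metis mult_le_cancel_right_pos nrm_nonneg order_le_less power2_eq_square)
qed

lemma ip_le_nrm_proj:
  assumes S: "closed_sub S" and x: "x \<in> H" and y: "y \<in> S"
  shows "\<bar>ip x y\<bar> \<le> nrm (proj S x) * nrm y"
  using Cauchy_Schwarz[OF proj_in_H[OF S x] closed_subD(3)[OF S y]] ip_proj[OF S x y] by simp

lemma proj_mono: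
  assumes S: "closed_sub S" and S': "closed_sub S'" and "S \<subseteq> S'" and x: "x \<in> H"
  shows "nrm (proj S x) \<le> nrm (proj S' x)"
  using assms by (intro nrm_proj_le_bound) (auto intro: ip_le_nrm_proj)

text \<open>The squared lengths of the projections decrease, so by Pythagoras the projections form a
  Cauchy sequence; its limit lies in the intersection.\<close>

lemma proj_decreasing_tendsto_zero:
  assumes S: "\<And>n. closed_sub (S n)" and dec: "\<And>n. S (Suc n) \<subseteq> S n" and x: "x \<in> H"
    and zero: "nrm (proj (\<Inter>n. S n) x) = 0"
  shows "(\<lambda>n. nrm (proj (S n) x)) \<longlonglongrightarrow> 0"
proof -
  define p where "p n = proj (S n) x" for n
  have pS: "p n \<in> S n" and pH: "p n \<in> H" for n
    using proj_in[OF S x] proj_in_H[OF S x] by (auto simp: p_def)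
  have mono: "S n \<subseteq> S m" if "m \<le> n" for m n using dec that by (rule lift_Suc_antimono_le)
  have ipp: "ip (p m) (p n) = (nrm (p n))\<^sup>2" if "m \<le> n" for m n
    using ip_proj[OF S x, of "p n" n] ip_proj[OF S x, of "p n" m] pS[of n] mono[OF that]
    by (auto simp: p_def nrm_square)
  have diff: "(nrm (p m - p n))\<^sup>2 = (nrm (p m))\<^sup>2 - (nrm (p n))\<^sup>2" if "m \<le> n" for m n
    using ipp[OF that] pH by (simp add: nrm_square ip_linear ip_commute[of "p n" "p m"])
  have "decseq (\<lambda>n. (nrm (p n))\<^sup>2)"
  proof (rule antimonoI)
    fix m n :: nat assume "m \<le> n"
    from diff[OF this, symmetric] show "(nrm (p n))\<^sup>2 \<le> (nrm (p m))\<^sup>2"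
      using zero_le_power2[of "nrm (p m - p n)"] by linarith
  qed
  then obtain L where "(\<lambda>n. (nrm (p n))\<^sup>2) \<longlonglongrightarrow> L"
    using decseq_convergent[of "\<lambda>n. (nrm (p n))\<^sup>2" 0] by auto
  then have cau: "Cauchy (\<lambda>n. (nrm (p n))\<^sup>2)" by (rule LIMSEQ_imp_Cauchy)
  obtain l where l: "l \<in> H" "(\<lambda>n. nrm (p n - l)) \<longlonglongrightarrow> 0"
  proof (rule complete_nrm[of p])
    fix e :: real assume "e > 0"
    then obtain N where N: "\<And>m n. m \<ge> N \<Longrightarrow> n \<ge> N \<Longrightarrow> \<bar>(nrm (p m))\<^sup>2 - (nrm (p n))\<^sup>2\<bar> < e"
      using cau unfolding Cauchy_def dist_real_def by blast
    have "(nrm (p m - p n))\<^sup>2 < e" if "m \<ge> N" "n \<ge> N" for m n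
      using N[OF that] diff[of m n] diff[of n m] nrm_diff_commute[OF pH pH, of m n]
      by (cases "m \<le> n") auto
    then show "\<exists>N. \<forall>m\<ge>N. \<forall>n\<ge>N. (nrm (p m - p n))\<^sup>2 < e" by blast
  qed (use pH in auto)
  have lS: "l \<in> (\<Inter>n. S n)"
  proof
    fix n
    show "l \<in> S n"
    proof (rule closed_subD(4)[OF S l(1)])
      fix e :: real assume "e > 0"
      then have "eventually (\<lambda>k. nrm (p k - l) < e) sequentially" using l(2) by (intro order_tendstoD)
      then obtain k where k: "k \<ge> n" "nrm (p k - l) < e"
        unfolding eventually_sequentially by (meson nle_le)
      then show "\<exists>y\<in>S n. nrm (l - y) < e"
        using mono[of n k] pS[of k] nrm_diff_commute[OF pH l(1)] by (auto intro!: bexI[of _ "p k"])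
    qed
  qed
  have N: "closed_sub (\<Inter>n. S n)" using closed_sub_Inter[of UNIV S] S by simp
  have "ip (p n) l = 0" for n
  proof -
    have "ip (p n) l = ip x l" using ip_proj[OF S x, of l n] lS by (auto simp: p_def)
    also have "\<dots> = 0"
      using ip_proj[OF N x lS] nrm_zero_ip[OF zero proj_in_H[OF N x] l(1)] by simp
    finally show ?thesis .
  qed
  then have "(nrm (p n - l))\<^sup>2 = (nrm (p n))\<^sup>2 + (nrm l)\<^sup>2" for n
    using pH l(1) by (simp add: nrm_square ip_linear ip_commute[of l "p n"])
  then have le: "nrm (p n) \<le> nrm (p n - l)" for n
    by (intro power2_le_imp_le[of "nrm (p n)"]) simp_all
  show ?thesis
    unfolding p_def[symmetric]
    by (rule tendsto_sandwich[OF _ _ tendsto_const l(2)]) (simp_all add: le)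
qed

end


section \<open>The causal filter of a self-similar curve\<close>

lemma deriv_zero_if_quadratic:
  fixes g :: "real \<Rightarrow> real"
  assumes "d > 0" and bound: "\<And>v. \<bar>v - u\<bar> < d \<Longrightarrow> \<bar>g v\<bar> \<le> K * (v - u)\<^sup>2"
  shows "(g has_real_derivative 0) (at u)"
proof -
  have gu: "g u = 0" using bound[of u] assms(1) by simp
  have "((\<lambda>v. \<bar>K\<bar> * \<bar>v - u\<bar>) \<longlongrightarrow> \<bar>K\<bar> * \<bar>u - u\<bar>) (at u)"
    by (intro tendsto_intros)
  then have lim: "((\<lambda>v. \<bar>K\<bar> * \<bar>v - u\<bar>) \<longlongrightarrow> 0) (at u)" by simp
  have "((\<lambda>v. (g v - g u) / (v - u)) \<longlongrightarrow> 0) (at u)"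
  proof (rule Lim_null_comparison[OF _ lim])
    show "\<forall>\<^sub>F v in at u. norm ((g v - g u) / (v - u)) \<le> \<bar>K\<bar> * \<bar>v - u\<bar>"
      unfolding eventually_at
    proof (intro exI[of _ d] conjI ballI impI)
      fix v assume "v \<noteq> u \<and> dist v u < d"
      then have v: "v \<noteq> u" "\<bar>g v\<bar> \<le> K * (v - u)\<^sup>2" using bound[of v] by (auto simp: dist_real_def)
      have "\<bar>g v\<bar> \<le> \<bar>K\<bar> * \<bar>v - u\<bar> * \<bar>v - u\<bar>"
        using order_trans[OF v(2) mult_right_mono[OF abs_ge_self zero_le_power2]]
        by (simp add: power2_eq_square abs_mult_self_eq mult.assoc)
      then show "norm ((g v - g u) / (v - u)) \<le> \<bar>K\<bar> * \<bar>v - u\<bar>"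
        using v(1) gu by (simp add: abs_divide divide_le_eq)
    qed (fact assms(1))
  qed
  then show ?thesis by (simp add: has_field_derivative_iff)
qed

lemma deriv_eq_on_pos:
  fixes f g :: "real \<Rightarrow> real"
  assumes "(f has_real_derivative D) (at t)" "t > 0" "\<And>v. v > 0 \<Longrightarrow> f v = g v"
  shows "(g has_real_derivative D) (at t)"
  by (rule has_field_derivative_transform_within_open[OF assms(1), of "{0<..}"]) (use assms in auto)

lemma deriv_scale_arg:
  fixes f :: "real \<Rightarrow> real"
  assumes "(f has_real_derivative D) (at (u * t))"
  shows "((\<lambda>t. f (u * t)) has_real_derivative u * D) (at t)" "((\<lambda>u. f (u * t)) has_real_derivative t * D) (at u)"
  using DERIV_chain2[where f = f and g = "\<lambda>t. u * t" and x = t and Db = u, OF assms]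
    DERIV_chain2[where f = f and g = "\<lambda>u. u * t" and x = u and Db = t, OF assms]
    DERIV_cmult_right[OF DERIV_ident, of u t UNIV] DERIV_cmult_right[OF DERIV_ident, of t u UNIV]
  by (simp_all add: mult.commute)

lemma equal_if_equal_derivatives:
  fixes f g f' :: "real \<Rightarrow> real"
  assumes f: "\<And>t. t > 0 \<Longrightarrow> (f has_real_derivative f' t) (at t)" "(f \<longlongrightarrow> 0) (at_right 0)"
    and g: "\<And>t. t > 0 \<Longrightarrow> (g has_real_derivative f' t) (at t)" "(g \<longlongrightarrow> 0) (at_right 0)"
    and t: "t > 0"
  shows "f t = g t"
proof -
  have "((\<lambda>t. f t - g t) has_field_derivative 0) (at t within {0<..})" if "t \<in> {0<..}" for t
    using that DERIV_diff[OF f(1) g(1), of t] by (auto intro: DERIV_subset)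
  then have "\<exists>c. \<forall>t\<in>{0<..}. f t - g t = c"
    by (intro has_field_derivative_zero_constant[OF convex_real_interval(3)])
  then obtain c where c: "\<And>t. t > 0 \<Longrightarrow> f t - g t = c" by auto
  have "((\<lambda>t. f t - g t) \<longlongrightarrow> c) (at_right 0)"
    by (rule tendsto_eventually, rule eventually_mono[OF eventually_at_right_less]) (simp add: c)
  moreover have "((\<lambda>t. f t - g t) \<longlongrightarrow> 0) (at_right 0)"
    using tendsto_diff[OF f(2) g(2)] by simp
  ultimately have "c = 0" by (rule tendsto_unique[OF trivial_limit_at_right_real])
  then show ?thesis using c[of t] t by simp
qed

context semi_inner
begin

text \<open>The forms of interest are the inner product itself and the inner products of projections onto, or
off, a closed subspace. The last conjunct says that the form comes from a bounded operator without
having to single out its values, which are determined only up to distance \<open>0\<close>.\<close>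

definition contraction_form :: "('v \<Rightarrow> 'v \<Rightarrow> real) \<Rightarrow> bool" where
  "contraction_form q \<longleftrightarrow>
     (\<forall>x\<in>H. \<forall>y\<in>H. q x y = q y x) \<and> (\<forall>x\<in>H. 0 \<le> q x x \<and> q x x \<le> ip x x) \<and>
     (\<forall>y\<in>H. \<exists>y'\<in>H. \<forall>x\<in>H. q x y = ip x y')"

lemma contraction_form_ip: "contraction_form ip"
  unfolding contraction_form_def using ip_commute ip_nonneg by auto

text \<open>Restricting a form to \<open>H\<close> gives a semi-inner product again, so that it inherits the
  Cauchy--Schwarz inequality and the linearity rules.\<close>

lemma semi_inner_of_form:
  assumes q: "contraction_form q" and q': "q' = (\<lambda>x y. if x \<in> H \<and> y \<in> H then q x y else 0)"
  shows "semi_inner H q'"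
proof
  note qd = q[unfolded contraction_form_def]
  show "subspace H" by (fact subspace_H)
  fix x y w and c :: real
  show "q' x y = q' y x" using qd q' by auto
  show "0 \<le> q' x x" using qd q' by auto
  assume x: "x \<in> H" and w: "w \<in> H"
  then obtain w' where w': "w' \<in> H" "\<And>x. x \<in> H \<Longrightarrow> q x w = ip x w'" using qd by meson
  show "q' (c *\<^sub>R x) w = c * q' x w" using x w w' q' by (simp add: ip_linear)
  assume y: "y \<in> H"
  show "q' (x + y) w = q' x w + q' y w" using x y w w' q' by (simp add: ip_linear)
qed

lemma
  assumes q: "contraction_form q"
  shows form_scale_left: "x \<in> H \<Longrightarrow> w \<in> H \<Longrightarrow> q (c *\<^sub>R x) w = c * q x w"
    and form_diff_left: "x \<in> H \<Longrightarrow> y \<in> H \<Longrightarrow> w \<in> H \<Longrightarrow> q (x - y) w = q x w - q y w"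
    and form_scale_right: "x \<in> H \<Longrightarrow> w \<in> H \<Longrightarrow> q w (c *\<^sub>R x) = c * q w x"
    and form_diff_right: "x \<in> H \<Longrightarrow> y \<in> H \<Longrightarrow> w \<in> H \<Longrightarrow> q w (x - y) = q w x - q w y"
    and form_commute: "x \<in> H \<Longrightarrow> y \<in> H \<Longrightarrow> q x y = q y x"
    and form_nonneg: "x \<in> H \<Longrightarrow> 0 \<le> q x x"
    and form_Cauchy_Schwarz: "x \<in> H \<Longrightarrow> y \<in> H \<Longrightarrow> \<bar>q x y\<bar> \<le> sqrt (q x x) * sqrt (q y y)"
    and form_bounded: "x \<in> H \<Longrightarrow> y \<in> H \<Longrightarrow> \<bar>q x y\<bar> \<le> nrm x * nrm y"
    and form_represented: "y \<in> H \<Longrightarrow> \<exists>y'\<in>H. \<forall>x\<in>H. q x y = ip x y'"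
proof -
  define q' where "q' = (\<lambda>x y. if x \<in> H \<and> y \<in> H then q x y else 0)"
  interpret q: semi_inner H q' by (rule semi_inner_of_form[OF q q'_def])
  note qd = q[unfolded contraction_form_def]
  have eq: "q x y = q' x y" if "x \<in> H" "y \<in> H" for x y using that by (simp add: q'_def)
  show "x \<in> H \<Longrightarrow> w \<in> H \<Longrightarrow> q (c *\<^sub>R x) w = c * q x w"
    "x \<in> H \<Longrightarrow> y \<in> H \<Longrightarrow> w \<in> H \<Longrightarrow> q (x - y) w = q x w - q y w"
    "x \<in> H \<Longrightarrow> w \<in> H \<Longrightarrow> q w (c *\<^sub>R x) = c * q w x"
    "x \<in> H \<Longrightarrow> y \<in> H \<Longrightarrow> w \<in> H \<Longrightarrow> q w (x - y) = q w x - q w y"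
    by (simp_all add: eq q.ip_linear)
  show "x \<in> H \<Longrightarrow> y \<in> H \<Longrightarrow> q x y = q y x" and "x \<in> H \<Longrightarrow> 0 \<le> q x x"
    and "y \<in> H \<Longrightarrow> \<exists>y'\<in>H. \<forall>x\<in>H. q x y = ip x y'"
    using qd by blast+
  have le: "x \<in> H \<Longrightarrow> q x x \<le> ip x x" for x using qd by blast
  have CS: "x \<in> H \<Longrightarrow> y \<in> H \<Longrightarrow> \<bar>q x y\<bar> \<le> sqrt (q x x) * sqrt (q y y)" for x y
    using q.Cauchy_Schwarz[of x y] by (simp add: q.nrm_def eq)
  then show "x \<in> H \<Longrightarrow> y \<in> H \<Longrightarrow> \<bar>q x y\<bar> \<le> sqrt (q x x) * sqrt (q y y)" .
  assume xy: "x \<in> H" "y \<in> H"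
  have "sqrt (q x x) * sqrt (q y y) \<le> nrm x * nrm y"
    unfolding nrm_def using qd xy ip_nonneg
    by (intro mult_mono real_sqrt_le_mono le) (simp_all del: real_sqrt_le_iff)
  then show "\<bar>q x y\<bar> \<le> nrm x * nrm y" using CS[OF xy] by linarith
qed

lemma form_null:
  assumes q: "contraction_form q" and "x \<in> H" "y \<in> H" "q x x = 0"
  shows "q x y = 0" "q y x = 0"
  using form_Cauchy_Schwarz[OF q assms(2,3)] form_commute[OF q assms(2,3)] assms(4) by auto

end

text \<open>\<open>X\<close> is a self-similar curve of index \<open>\<beta>\<close> in the Hilbert space, and \<open>J\<close> its causal average: the last
assumption says, tested against every vector, that
\<open>J t = t powr (\<beta> - a) * (integral from 0 to t of s powr (a - 1 - \<beta>) * X s ds)\<close>. In logarithmic time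
\<open>v = ln t\<close> and after division by \<open>t powr \<beta>\<close>, the curve \<open>X\<close> becomes stationary, the
passage from \<open>X\<close> to \<open>J\<close> becomes the resolvent \<open>1 / (D + a)\<close> of the generator \<open>D\<close> of the time shift, and
\<open>Z = X - 2 a J\<close> becomes the all-pass filter \<open>(D - a) / (D + a)\<close>.\<close>

locale selfsimilar_filter = semi_hilbert H ip
  for H :: "'v::real_vector set" and ip +
  fixes X J :: "real \<Rightarrow> 'v" and a \<beta> :: real
  assumes a_pos: "0 < a"
    and X_H [simp, intro]: "t > 0 \<Longrightarrow> X t \<in> H" and J_H [simp, intro]: "t > 0 \<Longrightarrow> J t \<in> H"
    and homogeneous: "s > 0 \<Longrightarrow> t > 0 \<Longrightarrow> u > 0 \<Longrightarrow>
      ip (X (u * s)) (X (u * t)) = u powr (2 * \<beta>) * ip (X s) (X t)"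
    and weakly_continuous: "y \<in> H \<Longrightarrow> continuous_on {0<..} (\<lambda>t. ip (X t) y)"
    and J_average: "y \<in> H \<Longrightarrow> t > 0 \<Longrightarrow>
      ((\<lambda>e. integral {e..t} (\<lambda>u. u powr (a - 1 - \<beta>) * ip (X u) y))
         \<longlongrightarrow> t powr (a - \<beta>) * ip (J t) y) (at_right 0)"
begin

text \<open>\<open>I\<close> is the integral itself, before it is rescaled to \<open>J\<close>; its weak derivative is \<open>w t * X t\<close>.\<close>

definition w :: "real \<Rightarrow> real" where "w u = u powr (a - 1 - \<beta>)"
definition I :: "real \<Rightarrow> 'v" where "I t = t powr (a - \<beta>) *\<^sub>R J t"
definition Z :: "real \<Rightarrow> 'v" where "Z t = X t - (2 * a) *\<^sub>R J t"

lemma I_H [simp, intro]: "t > 0 \<Longrightarrow> I t \<in> H" by (simp add: I_def)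
lemma Z_H [simp, intro]: "t > 0 \<Longrightarrow> Z t \<in> H" by (simp add: Z_def)

lemma integrand_continuous: "y \<in> H \<Longrightarrow> continuous_on {0<..} (\<lambda>u. w u * ip (X u) y)"
  unfolding w_def by (intro continuous_intros weakly_continuous) auto

lemma integrand_integrable: "y \<in> H \<Longrightarrow> 0 < s \<Longrightarrow> (\<lambda>u. w u * ip (X u) y) integrable_on {s..t}"
  by (rule integrable_continuous_real[OF continuous_on_subset[OF integrand_continuous]]) auto

lemma I_increment:
  assumes y: "y \<in> H" and st: "0 < s" "s \<le> t"
  shows "ip (I t) y - ip (I s) y = integral {s..t} (\<lambda>u. w u * ip (X u) y)"
proof -
  define F where "F e t = integral {e..t} (\<lambda>u. w u * ip (X u) y)" for e t
  have lim: "((\<lambda>e. F e t) \<longlongrightarrow> ip (I t) y) (at_right 0)" if "t > 0" for t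
    using J_average[OF y that] that y by (simp add: F_def w_def I_def ip_linear)
  have "((\<lambda>e. F e t - F e s) \<longlongrightarrow> ip (I t) y - ip (I s) y) (at_right 0)"
    using st by (intro tendsto_diff lim) auto
  moreover have "\<forall>\<^sub>F e in at_right 0. F e t - F e s = F s t"
    unfolding eventually_at_right_field
  proof (intro exI[of _ s] conjI allI impI)
    fix e assume "0 < e" "e < s"
    then show "F e t - F e s = F s t"
      using Henstock_Kurzweil_Integration.integral_combine[OF less_imp_le[OF \<open>e < s\<close>] st(2) integrand_integrable[OF y \<open>0 < e\<close>]]
      by (simp add: F_def)
  qed (use st in auto)
  ultimately have "((\<lambda>e::real. F s t) \<longlongrightarrow> ip (I t) y - ip (I s) y) (at_right 0)"
    by (rule Lim_transform_eventually)
  then show ?thesis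
    using tendsto_unique[OF trivial_limit_at_right_real _ tendsto_const] unfolding F_def by metis
qed

lemma I_derivative:
  assumes y: "y \<in> H" and t: "0 < t"
  shows "((\<lambda>t. ip (I t) y) has_real_derivative w t * ip (X t) y) (at t)"
proof -
  have "((\<lambda>s. integral {t/2..s} (\<lambda>u. w u * ip (X u) y)) has_real_derivative w t * ip (X t) y)
      (at t within {t/2..2*t})"
    using t by (intro integral_has_real_derivative continuous_on_subset[OF integrand_continuous[OF y]]) auto
  then have "((\<lambda>s. integral {t/2..s} (\<lambda>u. w u * ip (X u) y)) has_real_derivative w t * ip (X t) y) (at t)"
    using t by (subst (asm) at_within_interior) auto
  then have "((\<lambda>s. ip (I (t/2)) y + integral {t/2..s} (\<lambda>u. w u * ip (X u) y))
      has_real_derivative 0 + w t * ip (X t) y) (at t)"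
    by (intro derivative_intros)
  then show ?thesis
  proof (subst (asm) DERIV_cong_ev[OF refl _ refl])
    show "\<forall>\<^sub>F s in nhds t. ip (I (t/2)) y + integral {t/2..s} (\<lambda>u. w u * ip (X u) y) = ip (I s) y"
      using t eventually_nhds_in_open[of "{t/2<..}" t]
      by (auto elim!: eventually_mono simp: I_increment[OF y, symmetric])
  qed simp
qed

lemma I_tendsto_0:
  assumes y: "y \<in> H"
  shows "((\<lambda>t. ip (I t) y) \<longlongrightarrow> 0) (at_right 0)"
proof -
  have "((\<lambda>e. integral {e..1} (\<lambda>u. w u * ip (X u) y)) \<longlongrightarrow> ip (I 1) y) (at_right 0)"
    using J_average[OF y, of 1] y by (simp add: w_def I_def ip_linear)
  then have "((\<lambda>e. ip (I 1) y - integral {e..1} (\<lambda>u. w u * ip (X u) y)) \<longlongrightarrow> ip (I 1) y - ip (I 1) y) (at_right 0)"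
    by (intro tendsto_intros)
  moreover have "\<forall>\<^sub>F e in at_right 0. ip (I 1) y - integral {e..1} (\<lambda>u. w u * ip (X u) y) = ip (I e) y"
    unfolding eventually_at_right_field
    by (intro exI[of _ 1]) (auto simp: I_increment[OF y, symmetric])
  ultimately show ?thesis
    using tendsto_cong by fastforce
qed

text \<open>A scaling relation for \<open>X\<close> passes to \<open>J\<close>: both sides, multiplied by \<open>t powr (a - \<beta>)\<close>, have the
same derivative and vanish at \<open>0\<close>. Used twice, it makes \<open>J\<close> jointly homogeneous with \<open>X\<close>.\<close>

lemma J_scaling:
  assumes y: "y \<in> H" "y' \<in> H" and u: "u > 0"
    and scal: "\<And>t. t > 0 \<Longrightarrow> ip (X (u * t)) y' = k * ip (X t) y" and t: "t > 0"
  shows "ip (J (u * t)) y' = k * ip (J t) y"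
proof -
  have "ip (I (u * t)) y' = u powr (a - \<beta>) * k * ip (I t) y"
  proof (rule equal_if_equal_derivatives[where f = "\<lambda>t. ip (I (u * t)) y'" and t = t
      and g = "\<lambda>t. u powr (a - \<beta>) * k * ip (I t) y" and f' = "\<lambda>t. u * (w (u * t) * ip (X (u * t)) y')"])
    fix t :: real assume t: "t > 0"
    show "((\<lambda>t. ip (I (u * t)) y') has_real_derivative u * (w (u * t) * ip (X (u * t)) y')) (at t)"
      by (rule deriv_scale_arg(1)[OF I_derivative[OF y(2)]]) (use t u in simp)
    have "u powr (a - \<beta>) * k * (w t * ip (X t) y) = u * (w (u * t) * ip (X (u * t)) y')"
      using t u scal[OF t] powr_mult_base[of u "a - \<beta> - 1"] by (simp add: w_def powr_mult algebra_simps)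
    then show "((\<lambda>t. u powr (a - \<beta>) * k * ip (I t) y) has_real_derivative u * (w (u * t) * ip (X (u * t)) y')) (at t)"
      using DERIV_cmult[OF I_derivative[OF y(1) t], of "u powr (a - \<beta>) * k"] by simp
  next
    have "filterlim (\<lambda>t. u * t) (at_right 0) (at_right 0)"
      using u by (intro filterlim_at_withinI tendsto_eq_intros) (auto simp: eventually_at_right_field intro!: exI[of _ 1])
    from filterlim_compose[OF I_tendsto_0[OF y(2)] this]
    show "((\<lambda>t. ip (I (u * t)) y') \<longlongrightarrow> 0) (at_right 0)" .
    show "((\<lambda>t. u powr (a - \<beta>) * k * ip (I t) y) \<longlongrightarrow> 0) (at_right 0)"
      using tendsto_mult_right_zero[OF I_tendsto_0[OF y(1)]] by blast
  qed (fact t)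
  then show ?thesis
    using t u y by (simp add: I_def ip_linear powr_mult)
qed

lemma JX_homogeneous:
  "s > 0 \<Longrightarrow> t > 0 \<Longrightarrow> u > 0 \<Longrightarrow> ip (J (u * s)) (X (u * t)) = u powr (2 * \<beta>) * ip (J s) (X t)"
  by (rule J_scaling) (auto simp: homogeneous)

lemma JJ_homogeneous:
  "s > 0 \<Longrightarrow> t > 0 \<Longrightarrow> u > 0 \<Longrightarrow> ip (J (u * s)) (J (u * t)) = u powr (2 * \<beta>) * ip (J s) (J t)"
  by (rule J_scaling) (auto simp: JX_homogeneous ip_commute[of "X _"])

lemma nrm_homogeneous:
  assumes "t > 0"
  shows "nrm (X t) = t powr \<beta> * nrm (X 1)" "nrm (J t) = t powr \<beta> * nrm (J 1)"
proof -
  have "sqrt (t powr (2 * \<beta>)) = t powr \<beta>"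
    using assms by (simp add: powr_half_sqrt[symmetric] powr_powr)
  then show "nrm (X t) = t powr \<beta> * nrm (X 1)" "nrm (J t) = t powr \<beta> * nrm (J 1)"
    using homogeneous[of 1 1 t] JJ_homogeneous[of 1 1 t] assms by (simp_all add: nrm_def real_sqrt_mult)
qed

text \<open>Weak derivatives alone do not differentiate a form in both arguments at once. The Lipschitz bound
makes the mixed increment quadratically small, which is what the product rule in
\<open>form_I_derivative\<close> needs. It is obtained by testing the increment against itself.\<close>

lemma I_locally_Lipschitz:
  assumes "t > 0"
  obtains K where "K \<ge> 0" "\<And>s r. t/2 \<le> s \<Longrightarrow> s \<le> 2*t \<Longrightarrow> t/2 \<le> r \<Longrightarrow> r \<le> 2*t \<Longrightarrow> nrm (I s - I r) \<le> K * \<bar>s - r\<bar>"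
proof -
  have "compact ((\<lambda>u. w u * nrm (X 1) * u powr \<beta>) ` {t/2..2*t})"
    unfolding w_def using assms by (intro compact_continuous_image continuous_intros) auto
  then have "\<exists>K. \<forall>u\<in>{t/2..2*t}. \<bar>w u * nrm (X 1) * u powr \<beta>\<bar> \<le> K"
    using compact_imp_bounded by (fastforce simp: bounded_iff)
  then obtain K where K: "\<And>u. u \<in> {t/2..2*t} \<Longrightarrow> \<bar>w u * nrm (X 1) * u powr \<beta>\<bar> \<le> K"
    by blast
  have K0: "K \<ge> 0" using K[of t] assms by (smt (verit) atLeastAtMost_iff field_sum_of_halves)
  have *: "nrm (I s - I r) \<le> K * (s - r)" if "t/2 \<le> r" "r \<le> s" "s \<le> 2*t" for s r
  proof -
    define D where "D = I s - I r"
    have pos: "0 < r" "0 < s" using that assms by auto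
    have DH: "D \<in> H" using pos by (auto simp: D_def)
    have "(nrm D)\<^sup>2 = ip (I s) D - ip (I r) D"
      using pos DH unfolding nrm_square by (subst D_def) (simp add: ip_linear)
    also have "\<dots> = integral {r..s} (\<lambda>u. w u * ip (X u) D)"
      by (rule I_increment) (use DH pos that in auto)
    also have "\<dots> \<le> norm \<dots>" by simp
    also have "\<dots> \<le> (K * nrm D) * (s - r)"
    proof (rule integral_bound)
      show "continuous_on {r..s} (\<lambda>u. w u * ip (X u) D)"
        by (rule continuous_on_subset[OF integrand_continuous[OF DH]]) (use pos in auto)
      fix u assume u: "u \<in> {r..s}"
      then have u0: "u > 0" and uI: "u \<in> {t/2..2*t}" using pos that by auto
      have "\<bar>ip (X u) D\<bar> \<le> (u powr \<beta> * nrm (X 1)) * nrm D"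
        using Cauchy_Schwarz[of "X u" D] nrm_homogeneous(1)[OF u0] u0 DH by simp
      then have "\<bar>w u\<bar> * \<bar>ip (X u) D\<bar> \<le> \<bar>w u\<bar> * ((u powr \<beta> * nrm (X 1)) * nrm D)"
        by (intro mult_left_mono) auto
      also have "\<dots> = \<bar>w u * nrm (X 1) * u powr \<beta>\<bar> * nrm D"
        by (simp add: abs_mult)
      also have "\<dots> \<le> K * nrm D" using K[OF uI] by (intro mult_right_mono) auto
      finally show "norm (w u * ip (X u) D) \<le> K * nrm D" by (simp add: abs_mult)
    qed (use that in auto)
    finally have "nrm D * nrm D \<le> K * (s - r) * nrm D" by (simp add: power2_eq_square algebra_simps)
    moreover have "0 \<le> K * (s - r)" using K0 that by simp
    ultimately show ?thesis
      unfolding D_def[symmetric] by (metis mult_le_cancel_right_pos nrm_nonneg order_le_less)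
  qed
  have "nrm (I s - I r) \<le> K * \<bar>s - r\<bar>" if "t/2 \<le> s" "s \<le> 2*t" "t/2 \<le> r" "r \<le> 2*t" for s r
    using *[of r s] *[of s r] that nrm_diff_commute[of "I s" "I r"] assms by (cases "r \<le> s") auto
  with K0 that show ?thesis by blast
qed

lemma form_I_derivative:
  assumes q: "contraction_form q" and st: "s > 0" "t > 0" and u: "u > 0"
  shows "((\<lambda>u. q (I (u * s)) (I (u * t))) has_real_derivative
      s * (w (u * s) * q (X (u * s)) (I (u * t))) + t * (w (u * t) * q (I (u * s)) (X (u * t)))) (at u)"
proof -
  have der: "((\<lambda>u. q (I (u * s)) y) has_real_derivative s * (w (u * s) * q (X (u * s)) y)) (at u)"
    if y: "y \<in> H" and s: "s > 0" for y s
  proof -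
    obtain y' where y': "y' \<in> H" "\<And>x. x \<in> H \<Longrightarrow> q x y = ip x y'"
      using form_represented[OF q y] by blast
    have "((\<lambda>u. ip (I (u * s)) y') has_real_derivative s * (w (u * s) * ip (X (u * s)) y')) (at u)"
      by (rule deriv_scale_arg(2)[OF I_derivative[OF y'(1)]]) (use s u in simp)
    then show ?thesis
      unfolding y'(2)[OF X_H[OF mult_pos_pos[OF u s]]]
      by (rule deriv_eq_on_pos[OF _ u]) (use s in \<open>simp add: y'(2)\<close>)
  qed
  \<comment> \<open>the product rule up to the mixed increment \<open>g\<close>, which has derivative \<open>0\<close> at \<open>u\<close>\<close>
  define g where "g v = q (I (v * s) - I (u * s)) (I (v * t) - I (u * t))" for v
  obtain K1 where K1: "K1 \<ge> 0" "\<And>v r. u * s / 2 \<le> v \<Longrightarrow> v \<le> 2 * (u * s) \<Longrightarrow> u * s / 2 \<le> r \<Longrightarrow> r \<le> 2 * (u * s) \<Longrightarrow> nrm (I v - I r) \<le> K1 * \<bar>v - r\<bar>"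
    using I_locally_Lipschitz[of "u * s"] st u by auto
  obtain K2 where K2: "K2 \<ge> 0" "\<And>v r. u * t / 2 \<le> v \<Longrightarrow> v \<le> 2 * (u * t) \<Longrightarrow> u * t / 2 \<le> r \<Longrightarrow> r \<le> 2 * (u * t) \<Longrightarrow> nrm (I v - I r) \<le> K2 * \<bar>v - r\<bar>"
    using I_locally_Lipschitz[of "u * t"] st u by auto
  have "(g has_real_derivative 0) (at u)"
  proof (rule deriv_zero_if_quadratic[of "u / 2"])
    fix v assume "\<bar>v - u\<bar> < u / 2"
    then have v: "u / 2 \<le> v" "v \<le> 2 * u" by arith+
    have m: "u * c / 2 \<le> v * c" "v * c \<le> 2 * (u * c)" if "c > 0" for c
      using mult_right_mono[OF v(1), of c] mult_right_mono[OF v(2), of c] that by auto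
    have v0: "v > 0" using v u by auto
    have ab: "\<bar>v * c - u * c\<bar> = \<bar>v - u\<bar> * c" if "c > 0" for c
      using that by (simp add: left_diff_distrib[symmetric] abs_mult)
    have "\<bar>g v\<bar> \<le> nrm (I (v * s) - I (u * s)) * nrm (I (v * t) - I (u * t))"
      unfolding g_def using v0 u st by (intro form_bounded[OF q] H_diff I_H) auto
    also have "\<dots> \<le> (K1 * (\<bar>v - u\<bar> * s)) * (K2 * (\<bar>v - u\<bar> * t))"
      using K1(2)[OF m[OF st(1)], of "u * s"] K2(2)[OF m[OF st(2)], of "u * t"] K1(1) K2(1) st u
      by (intro mult_mono) (auto simp: ab)
    also have "\<dots> = (K1 * s * K2 * t) * (v - u)\<^sup>2"
      by (simp add: power2_eq_square abs_mult_self_eq flip: mult.assoc)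
    finally show "\<bar>g v\<bar> \<le> (K1 * s * K2 * t) * (v - u)\<^sup>2" .
  qed (use u in auto)
  moreover have "((\<lambda>v. q (I (u * s)) (I (v * t))) has_real_derivative t * (w (u * t) * q (I (u * s)) (X (u * t)))) (at u)"
  proof -
    have *: "((\<lambda>v. q (I (v * t)) (I (u * s))) has_real_derivative t * (w (u * t) * q (X (u * t)) (I (u * s)))) (at u)"
      using st u by (intro der) auto
    show ?thesis
      unfolding form_commute[OF q I_H[OF mult_pos_pos[OF u st(1)]] X_H[OF mult_pos_pos[OF u st(2)]]]
      by (rule deriv_eq_on_pos[OF * u]) (use st u form_commute[OF q] in simp)
  qed
  moreover have "((\<lambda>v. q (I (v * s)) (I (u * t))) has_real_derivative s * (w (u * s) * q (X (u * s)) (I (u * t)))) (at u)"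
    using st u by (intro der) auto
  ultimately have "((\<lambda>v. q (I (v * s)) (I (u * t)) + q (I (u * s)) (I (v * t)) - q (I (u * s)) (I (u * t)) + g v)
     has_real_derivative s * (w (u * s) * q (X (u * s)) (I (u * t))) + t * (w (u * t) * q (I (u * s)) (X (u * t))) - 0 + 0) (at u)"
    by (intro DERIV_add DERIV_diff DERIV_const)
  then have "((\<lambda>v. q (I (v * s)) (I (u * t)) + q (I (u * s)) (I (v * t)) - q (I (u * s)) (I (u * t)) + g v)
     has_real_derivative s * (w (u * s) * q (X (u * s)) (I (u * t))) + t * (w (u * t) * q (I (u * s)) (X (u * t)))) (at u)"
    by simp
  then show ?thesis
    by (rule deriv_eq_on_pos[OF _ u])
      (use st u in \<open>simp add: g_def form_diff_left[OF q] form_diff_right[OF q]\<close>)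
qed

text \<open>The central identity. Writing \<open>X = (D + a) J\<close> and \<open>Z = (D - a) J\<close> in logarithmic time,
\<open>q (Z, Z) - q (X, X)\<close> is \<open>- 2 a (q (D J, J) + q (J, D J))\<close>, that is \<open>- 2 a\<close> times the derivative of
\<open>q (J, J)\<close> along the time shift. So the form does not distinguish \<open>Z\<close> from \<open>X\<close> exactly if it does
not see the scaling of \<open>J\<close>.\<close>

lemma form_J_derivative:
  assumes q: "contraction_form q" and st: "s > 0" "t > 0" and u: "u > 0"
  shows "((\<lambda>u. u powr (- 2 * \<beta>) * q (J (u * s)) (J (u * t))) has_real_derivative
      - (u powr (- 2 * \<beta> - 1)) * (q (Z (u * s)) (Z (u * t)) - q (X (u * s)) (X (u * t))) / (2 * a)) (at u)"
proof -
  define c where "c = s powr (a - \<beta>) * t powr (a - \<beta>)"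
  have c: "c > 0" using st by (simp add: c_def)
  define b where "b = q (J (u * s)) (J (u * t))"
  define m where "m = q (X (u * s)) (J (u * t)) + q (J (u * s)) (X (u * t))"
  have pos: "u * s > 0" "u * t > 0" using st u by auto
  have defect: "q (Z (u * s)) (Z (u * t)) - q (X (u * s)) (X (u * t)) = (2 * a)\<^sup>2 * b - 2 * a * m"
    using pos by (simp add: Z_def b_def m_def form_diff_left[OF q] form_diff_right[OF q]
      form_scale_left[OF q] form_scale_right[OF q] power2_eq_square algebra_simps)
  have eq: "v powr (- 2 * \<beta>) * q (J (v * s)) (J (v * t)) = inverse c * (v powr (- 2 * a) * q (I (v * s)) (I (v * t)))"
    if "v > 0" for v
  proof -
    have "q (I (v * s)) (I (v * t)) = c * v powr (2 * a - 2 * \<beta>) * q (J (v * s)) (J (v * t))"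
      using that st
      by (simp add: I_def form_scale_left[OF q] form_scale_right[OF q] powr_mult c_def powr_add[symmetric] mult_ac)
    then show ?thesis using c that by (simp add: powr_add[symmetric] field_simps)
  qed
  have "((\<lambda>v. v powr (- 2 * a) * q (I (v * s)) (I (v * t))) has_real_derivative
     (- 2 * a * u powr (- 2 * a - 1)) * q (I (u * s)) (I (u * t)) +
     (s * (w (u * s) * q (X (u * s)) (I (u * t))) + t * (w (u * t) * q (I (u * s)) (X (u * t)))) * u powr (- 2 * a)) (at u)"
    by (rule DERIV_mult'[THEN DERIV_cong, OF _ form_I_derivative[OF q st u]])
      (use u in \<open>auto intro!: derivative_eq_intros\<close>)
  also have "(- 2 * a * u powr (- 2 * a - 1)) * q (I (u * s)) (I (u * t)) +
     (s * (w (u * s) * q (X (u * s)) (I (u * t))) + t * (w (u * t) * q (I (u * s)) (X (u * t)))) * u powr (- 2 * a)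
     = c * u powr (- 2 * \<beta> - 1) * (m - 2 * a * b)"
  proof -
    define A where "A = u powr (a - \<beta>)"
    have w: "r * w (u * r) = r powr (a - \<beta>) * (A * u powr (- 1))" if "r > 0" for r
    proof -
      have "v powr (a - 1 - \<beta>) = v powr (a - \<beta>) / v" if "v > 0" for v
        using that powr_diff[of v "a - \<beta>" 1] by (simp add: algebra_simps)
      from this[of "u * r"] show ?thesis using that u by (simp add: w_def A_def powr_mult powr_minus divide_simps) (simp add: mult_ac)
    qed
    have I: "I (u * r) = (A * r powr (a - \<beta>)) *\<^sub>R J (u * r)" if "r > 0" for r
      using that u by (simp add: I_def A_def powr_mult)
    have A2: "A * u powr (- 1) * A * u powr (- 2 * a) = u powr (- 2 * \<beta> - 1)"
      "u powr (- 2 * a - 1) * (A * A) = u powr (- 2 * \<beta> - 1)"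
    proof -
      have "(a - \<beta>) + (- 1) + (a - \<beta>) + (- 2 * a) = - 2 * \<beta> - 1"
        "(- 2 * a - 1) + ((a - \<beta>) + (a - \<beta>)) = - 2 * \<beta> - 1" by simp_all
      then show "A * u powr (- 1) * A * u powr (- 2 * a) = u powr (- 2 * \<beta> - 1)"
        "u powr (- 2 * a - 1) * (A * A) = u powr (- 2 * \<beta> - 1)"
        unfolding A_def by (metis powr_add)+
    qed
    have "(- 2 * a * u powr (- 2 * a - 1)) * q (I (u * s)) (I (u * t)) +
       (s * (w (u * s) * q (X (u * s)) (I (u * t))) + t * (w (u * t) * q (I (u * s)) (X (u * t)))) * u powr (- 2 * a)
       = (- 2 * a * b) * c * (u powr (- 2 * a - 1) * (A * A)) +
         m * c * (A * u powr (- 1) * A * u powr (- 2 * a))"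
      using pos unfolding mult.assoc[symmetric] w[OF st(1)] w[OF st(2)] I[OF st(1)] I[OF st(2)]
      by (simp add: form_scale_left[OF q] form_scale_right[OF q] b_def m_def c_def algebra_simps)
    then show ?thesis unfolding A2 by (simp add: algebra_simps)
  qed
  finally have "((\<lambda>v. inverse c * (v powr (- 2 * a) * q (I (v * s)) (I (v * t)))) has_real_derivative
     inverse c * (c * u powr (- 2 * \<beta> - 1) * (m - 2 * a * b))) (at u)"
    by (rule DERIV_cmult)
  also have "inverse c * (c * u powr (- 2 * \<beta> - 1) * (m - 2 * a * b)) =
     - (u powr (- 2 * \<beta> - 1)) * (q (Z (u * s)) (Z (u * t)) - q (X (u * s)) (X (u * t))) / (2 * a)"
    unfolding defect using c a_pos by (simp add: field_simps power2_eq_square)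
  finally have "((\<lambda>v. inverse c * (v powr (- 2 * a) * q (I (v * s)) (I (v * t)))) has_real_derivative
     - (u powr (- 2 * \<beta> - 1)) * (q (Z (u * s)) (Z (u * t)) - q (X (u * s)) (X (u * t))) / (2 * a)) (at u)" .
  then show ?thesis
    by (rule deriv_eq_on_pos[OF _ u]) (erule eq[symmetric])
qed

text \<open>For the inner product the scaling invariance is known from \<open>JJ_homogeneous\<close>, and the identity
  turns it into the isometry of the filter.\<close>

lemma Z_isometric:
  assumes st: "s > 0" "t > 0"
  shows "ip (Z s) (Z t) = ip (X s) (X t)"
proof -
  have "((\<lambda>u. ip (J s) (J t)) has_real_derivative 0) (at 1)" by simp
  then have "((\<lambda>u. u powr (- 2 * \<beta>) * ip (J (u * s)) (J (u * t))) has_real_derivative 0) (at 1)"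
    by (rule deriv_eq_on_pos) (use st in \<open>simp_all add: JJ_homogeneous powr_minus\<close>)
  from DERIV_unique[OF form_J_derivative[OF contraction_form_ip st, of 1] this]
  show ?thesis using a_pos by simp
qed

text \<open>The same identity in the other direction: if the form is invariant under the filter, then
\<open>u powr (- 2 * \<beta>) * q (J u) (J u)\<close> is constant in \<open>u\<close>. As \<open>J\<close> is controlled by \<open>X\<close> and \<open>Z\<close>, this constant
is \<open>0\<close> as soon as the corresponding quantity for \<open>X\<close> comes arbitrarily close to \<open>0\<close>. Then the form
annihilates the integrals \<open>I\<close>, hence also their derivative \<open>w t * X t\<close>.\<close>

theorem invariant_form_vanishes:
  assumes q: "contraction_form q"
    and invariant: "\<And>t. t > 0 \<Longrightarrow> q (Z t) (Z t) = q (X t) (X t)"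
    and small: "\<And>e. e > 0 \<Longrightarrow> \<exists>u>0. u powr (- 2 * \<beta>) * q (X u) (X u) < e"
    and t: "t > 0"
  shows "q (X t) (X t) = 0"
proof -
  have "((\<lambda>u. u powr (- 2 * \<beta>) * q (J u) (J u)) has_field_derivative 0) (at u within {0<..})" if "u \<in> {0<..}" for u
    using form_J_derivative[OF q, of 1 1 u] that invariant[of u] by (auto intro: DERIV_subset)
  then have "\<exists>c. \<forall>u\<in>{0<..}. u powr (- 2 * \<beta>) * q (J u) (J u) = c"
    by (intro has_field_derivative_zero_constant[OF convex_real_interval(3)])
  then obtain c where c: "\<And>u. u > 0 \<Longrightarrow> u powr (- 2 * \<beta>) * q (J u) (J u) = c" by auto
  have J_le: "a\<^sup>2 * q (J u) (J u) \<le> q (X u) (X u)" if u: "u > 0" for u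
  proof -
    have "(2 * a)\<^sup>2 * q (J u) (J u) = 2 * q (X u) (X u) - 2 * q (X u) (Z u)"
      using u invariant[OF u] form_commute[OF q, of "J u" "X u"]
      by (simp add: Z_def form_diff_left[OF q] form_diff_right[OF q]
        form_scale_left[OF q] form_scale_right[OF q] power2_eq_square algebra_simps)
    also have "\<dots> \<le> 4 * q (X u) (X u)"
      using form_Cauchy_Schwarz[OF q X_H[OF u] Z_H[OF u]] form_nonneg[OF q X_H[OF u]] invariant[OF u]
      by (simp add: abs_le_iff)
    finally show ?thesis by (simp add: power2_eq_square)
  qed
  have "c \<le> 0"
  proof (rule field_le_epsilon)
    fix e :: real assume "e > 0"
    then have "a\<^sup>2 * e > 0" using a_pos by simp
    then obtain u where u: "u > 0" "u powr (- 2 * \<beta>) * q (X u) (X u) < a\<^sup>2 * e" using small by blast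
    have "a\<^sup>2 * c = u powr (- 2 * \<beta>) * (a\<^sup>2 * q (J u) (J u))" using c[OF u(1)] by simp
    also have "\<dots> \<le> u powr (- 2 * \<beta>) * q (X u) (X u)" using J_le[OF u(1)] by (intro mult_left_mono) auto
    also have "\<dots> < a\<^sup>2 * e" by (fact u(2))
    finally show "c \<le> 0 + e" using a_pos by simp
  qed
  then have J0: "q (J u) (J u) = 0" if "u > 0" for u
    using c[OF that] form_nonneg[OF q J_H[OF that]] that
    by (smt (verit) mult_pos_pos powr_gt_zero)
  obtain y where y: "y \<in> H" "\<And>x. x \<in> H \<Longrightarrow> q x (X t) = ip x y"
    using form_represented[OF q X_H[OF t]] by blast
  have "ip (I u) y = 0" if "u > 0" for u
    using that y(2)[of "I u"] form_null(1)[OF q J_H X_H, of u t] J0 t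
    by (simp add: I_def form_scale_left[OF q])
  then have "((\<lambda>u. ip (I u) y) has_real_derivative 0) (at t)"
    by (intro deriv_eq_on_pos[OF DERIV_const t]) simp
  from DERIV_unique[OF I_derivative[OF y(1) t] this]
  have "ip (X t) y = 0" using t by (simp add: w_def)
  then show ?thesis using y(2)[OF X_H[OF t]] by simp
qed

text \<open>In logarithmic time the anticausal filter \<open>1 + 2 a / (D - a)\<close> inverts \<open>(D - a) / (D + a)\<close>: the future
average of \<open>Z\<close> can be integrated explicitly, with boundary terms built from \<open>J\<close>, and the one at
infinity vanishes.\<close>

lemma Z_future_integral:
  assumes y: "y \<in> H" and t: "0 < t" "t \<le> b"
  shows "((\<lambda>s. s powr (- \<beta> - a - 1) * ip (Z s) y) has_integral
     b powr (- a - \<beta>) * ip (J b) y - t powr (- a - \<beta>) * ip (J t) y) {t..b}"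
proof (rule fundamental_theorem_of_calculus[OF t(2)])
  fix s assume "s \<in> {t..b}"
  then have s: "s > 0" using t by auto
  have eq: "r powr (- a - \<beta>) * ip (J r) y = r powr (- 2 * a) * ip (I r) y" if "r > 0" for r
    using that y by (simp add: I_def ip_linear powr_add[symmetric] flip: mult.assoc)
  have "((\<lambda>r. r powr (- 2 * a) * ip (I r) y) has_real_derivative
      (- 2 * a * s powr (- 2 * a - 1)) * ip (I s) y + (w s * ip (X s) y) * s powr (- 2 * a)) (at s)"
    by (rule DERIV_mult'[THEN DERIV_cong, OF _ I_derivative[OF y s]])
      (use s in \<open>auto intro!: derivative_eq_intros\<close>)
  also have "(- 2 * a * s powr (- 2 * a - 1)) * ip (I s) y + (w s * ip (X s) y) * s powr (- 2 * a)
      = s powr (- \<beta> - a - 1) * ip (Z s) y"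
    using s y by (simp add: I_def w_def Z_def ip_linear powr_add[symmetric] algebra_simps)
      (smt (verit))
  finally have "((\<lambda>r. r powr (- 2 * a) * ip (I r) y) has_real_derivative
      s powr (- \<beta> - a - 1) * ip (Z s) y) (at s)" .
  then have "((\<lambda>r. r powr (- a - \<beta>) * ip (J r) y) has_real_derivative
      s powr (- \<beta> - a - 1) * ip (Z s) y) (at s)"
    by (rule deriv_eq_on_pos[OF _ s]) (simp add: eq)
  then show "((\<lambda>r. r powr (- a - \<beta>) * ip (J r) y) has_vector_derivative s powr (- \<beta> - a - 1) * ip (Z s) y)
      (at s within {t..b})"
    by (simp add: has_real_derivative_iff_has_vector_derivative has_vector_derivative_at_within)
qed

lemma J_decay:
  assumes y: "y \<in> H"
  shows "((\<lambda>b. b powr (- a - \<beta>) * ip (J b) y) \<longlongrightarrow> 0) at_top"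
proof (rule Lim_null_comparison)
  show "\<forall>\<^sub>F b in at_top. norm (b powr (- a - \<beta>) * ip (J b) y) \<le> b powr (- a) * (nrm (J 1) * nrm y)"
    using eventually_gt_at_top[of "0::real"]
  proof eventually_elim
    case (elim b)
    have "norm (b powr (- a - \<beta>) * ip (J b) y) \<le> b powr (- a - \<beta>) * ((b powr \<beta> * nrm (J 1)) * nrm y)"
      using Cauchy_Schwarz[OF J_H[OF elim] y] nrm_homogeneous(2)[OF elim]
      by (simp add: abs_mult mult_left_mono)
    also have "\<dots> = b powr (- a) * (nrm (J 1) * nrm y)"
      by (simp add: powr_add[symmetric] flip: mult.assoc)
    finally show ?case .
  qed
  have "((\<lambda>b. b powr (- a)) \<longlongrightarrow> 0) at_top"
    using a_pos by (intro tendsto_neg_powr filterlim_ident) auto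
  then show "((\<lambda>b. b powr (- a) * (nrm (J 1) * nrm y)) \<longlongrightarrow> 0) at_top"
    by (rule tendsto_mult_left_zero)
qed

end


section \<open>The space of square-integrable random variables\<close>

text \<open>With pointwise scalar multiplication, the library's notions of span and subspace apply to families of
random variables.\<close>

instantiation "fun" :: (type, real_vector) real_vector
begin

definition "scaleR c f = (\<lambda>x. c *\<^sub>R f x)" for f :: "'a \<Rightarrow> 'b"

instance
  by standard (simp_all add: scaleR_fun_def fun_eq_iff scaleR_add_left scaleR_add_right)

end

lemma scaleR_fun_apply [simp]: "(c *\<^sub>R f) x = c *\<^sub>R f x"
  by (simp add: scaleR_fun_def)

lemma sum_fun_apply: "(\<Sum>i\<in>S. f i) x = (\<Sum>i\<in>S. f i x)"
  for f :: "'i \<Rightarrow> 'a \<Rightarrow> 'b::comm_monoid_add"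
  by (induction S rule: infinite_finite_induct) auto

definition L2 :: "'a measure \<Rightarrow> ('a \<Rightarrow> real) set" where
  "L2 M = {f. square_integrable M f}"

definition L2_inner :: "'a measure \<Rightarrow> ('a \<Rightarrow> real) \<Rightarrow> ('a \<Rightarrow> real) \<Rightarrow> real" where
  "L2_inner M f g = (LINT x|M. f x * g x)"

lemma L2_measurable [measurable_dest]: "f \<in> L2 M \<Longrightarrow> f \<in> borel_measurable M"
  and L2_integrable_square: "f \<in> L2 M \<Longrightarrow> integrable M (\<lambda>x. (f x)\<^sup>2)"
  by (auto simp: L2_def square_integrable_def)

lemma L2I: "f \<in> borel_measurable M \<Longrightarrow> integrable M (\<lambda>x. (f x)\<^sup>2) \<Longrightarrow> f \<in> L2 M"
  by (auto simp: L2_def square_integrable_def)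

lemma L2_integrable_mult:
  assumes f: "f \<in> L2 M" and g: "g \<in> L2 M"
  shows "integrable M (\<lambda>x. f x * g x)"
proof (rule Bochner_Integration.integrable_bound)
  show "integrable M (\<lambda>x. (f x)\<^sup>2 + (g x)\<^sup>2)"
    using assms by (intro Bochner_Integration.integrable_add L2_integrable_square)
  show "(\<lambda>x. f x * g x) \<in> borel_measurable M"
    using assms[THEN L2_measurable] by measurable
  show "AE x in M. norm (f x * g x) \<le> norm ((f x)\<^sup>2 + (g x)\<^sup>2)"
  proof (rule AE_I2)
    fix x
    have "2 * (\<bar>f x\<bar> * \<bar>g x\<bar>) \<le> (f x)\<^sup>2 + (g x)\<^sup>2"
      using sum_squares_bound[of "\<bar>f x\<bar>" "\<bar>g x\<bar>"] by (simp add: mult.assoc)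
    moreover have "0 \<le> \<bar>f x\<bar> * \<bar>g x\<bar>" by simp
    ultimately have "\<bar>f x\<bar> * \<bar>g x\<bar> \<le> (f x)\<^sup>2 + (g x)\<^sup>2" by linarith
    then show "norm (f x * g x) \<le> norm ((f x)\<^sup>2 + (g x)\<^sup>2)"
      by (simp add: abs_mult)
  qed
qed

lemma L2_add:
  assumes f: "f \<in> L2 M" and g: "g \<in> L2 M"
  shows "f + g \<in> L2 M"
proof (rule L2I)
  show "f + g \<in> borel_measurable M"
    unfolding plus_fun_def using assms[THEN L2_measurable] by measurable
  have "integrable M (\<lambda>x. (f x)\<^sup>2 + (g x)\<^sup>2 + 2 * (f x * g x))"
    using assms by (intro Bochner_Integration.integrable_add L2_integrable_square integrable_mult_right L2_integrable_mult)
  then show "integrable M (\<lambda>x. ((f + g) x)\<^sup>2)"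
    by (simp add: power2_sum algebra_simps)
qed

lemma L2_scale:
  assumes f: "f \<in> L2 M"
  shows "c *\<^sub>R f \<in> L2 M"
proof (rule L2I)
  show "c *\<^sub>R f \<in> borel_measurable M"
    unfolding scaleR_fun_def using L2_measurable[OF f] by measurable
  show "integrable M (\<lambda>x. ((c *\<^sub>R f) x)\<^sup>2)"
    using L2_integrable_square[OF f] by (simp add: power_mult_distrib)
qed

lemma L2_subspace: "subspace (L2 M)"
proof (rule subspaceI)
  show "0 \<in> L2 M" by (rule L2I) (simp_all add: zero_fun_def)
qed (rule L2_add L2_scale; assumption)+

lemma semi_inner_L2: "semi_inner (L2 M) (L2_inner M)"
proof
  show "subspace (L2 M)" by (rule L2_subspace)
  fix f g h :: "'a \<Rightarrow> real" and c :: real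
  show "L2_inner M f g = L2_inner M g f" by (simp add: L2_inner_def mult.commute)
  show "0 \<le> L2_inner M f f" by (simp add: L2_inner_def)
  show "f \<in> L2 M \<Longrightarrow> g \<in> L2 M \<Longrightarrow> h \<in> L2 M \<Longrightarrow> L2_inner M (f + g) h = L2_inner M f h + L2_inner M g h"
    by (simp add: L2_inner_def distrib_right L2_integrable_mult)
  show "f \<in> L2 M \<Longrightarrow> h \<in> L2 M \<Longrightarrow> L2_inner M (c *\<^sub>R f) h = c * L2_inner M f h"
    by (simp add: L2_inner_def mult.assoc)
qed

lemma L2_integrable:
  assumes "finite_measure M" "f \<in> L2 M"
  shows "integrable M f"
  using assms finite_measure.square_integrable_imp_integrable
  by (metis L2_integrable_square L2_measurable)

lemma L2_cong_AE:
  assumes f: "f \<in> L2 M" and g: "g \<in> borel_measurable M" and eq: "AE x in M. f x = g x"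
  shows "g \<in> L2 M"
proof (rule L2I[OF g])
  have "(\<lambda>x. (g x)\<^sup>2) \<in> borel_measurable M" using g by measurable
  with L2_integrable_square[OF f] show "integrable M (\<lambda>x. (g x)\<^sup>2)"
    by (rule integrable_cong_AE_imp) (use eq in auto)
qed

lemma L2_mean_abs_le:
  assumes "prob_space M" "f \<in> L2 M"
  shows "(LINT x|M. \<bar>f x\<bar>) \<le> sqrt (L2_inner M f f)"
proof -
  interpret prob_space M by fact
  interpret L2: semi_inner "L2 M" "L2_inner M" by (rule semi_inner_L2)
  have 1: "(\<lambda>x. 1) \<in> L2 M" and f': "(\<lambda>x. \<bar>f x\<bar>) \<in> L2 M"
    using L2_measurable[OF assms(2)] L2_integrable_square[OF assms(2)] by (auto intro!: L2I)
  have "\<bar>L2_inner M (\<lambda>x. \<bar>f x\<bar>) (\<lambda>x. 1)\<bar> \<le> sqrt (L2_inner M f f)"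
    using L2.Cauchy_Schwarz[OF f' 1] by (simp add: L2.nrm_def L2_inner_def prob_space)
  then show ?thesis by (simp add: L2_inner_def)
qed

text \<open>Riesz--Fischer: along a rapidly converging subsequence the increments are summable almost
  everywhere, and Fatou's lemma turns the pointwise limit into a limit in mean square.\<close>

lemma L2_complete:
  fixes u :: "nat \<Rightarrow> 'a \<Rightarrow> real"
  assumes M: "prob_space M" and u: "\<And>n. u n \<in> L2 M"
    and Cauchy: "\<And>e. e > 0 \<Longrightarrow> \<exists>N. \<forall>m\<ge>N. \<forall>n\<ge>N. L2_inner M (u m - u n) (u m - u n) < e"
  shows "\<exists>f\<in>L2 M. (\<lambda>n. L2_inner M (u n - f) (u n - f)) \<longlonglongrightarrow> 0"
proof -
  interpret prob_space M by fact
  interpret L2: semi_inner "L2 M" "L2_inner M" by (rule semi_inner_L2)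
  have um [measurable]: "u n \<in> borel_measurable M" for n using u by (rule L2_measurable)
  have "\<exists>N. \<forall>m\<ge>N. \<forall>n\<ge>N. L2_inner M (u m - u n) (u m - u n) < (1/4)^k" for k :: nat
    by (rule Cauchy) simp
  then obtain N where N: "\<And>k m n. m \<ge> N k \<Longrightarrow> n \<ge> N k \<Longrightarrow> L2_inner M (u m - u n) (u m - u n) < (1/4)^k"
    by metis
  define r where "r k = (\<Sum>i\<le>k. N i)" for k
  have r: "N k \<le> r k" "r k \<le> r (Suc k)" for k
    by (auto simp: r_def intro: member_le_sum)
  define d where "d k x = \<bar>u (r (Suc k)) x - u (r k) x\<bar>" for k x
  have [measurable]: "d k \<in> borel_measurable M" for k unfolding d_def by measurable
  have d_int: "integrable M (d k)" for k
    unfolding d_def using u by (intro integrable_abs Bochner_Integration.integrable_diff L2_integrable) (auto simp: finite_measure_axioms)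
  have d_le: "(LINT x|M. d k x) \<le> (1/2)^k" for k
  proof -
    have "(LINT x|M. d k x) \<le> sqrt (L2_inner M (u (r (Suc k)) - u (r k)) (u (r (Suc k)) - u (r k)))"
      using L2_mean_abs_le[OF M L2.H_diff[OF u u], of "r (Suc k)" "r k"] by (simp add: d_def)
    also have "\<dots> \<le> sqrt ((1/4)^k)"
      using N[of k "r (Suc k)" "r k"] r[of k] by (intro real_sqrt_le_mono) auto
    also have "\<dots> = (1/2)^k" by (simp add: real_sqrt_power real_sqrt_divide)
    finally show ?thesis .
  qed
  have "(\<integral>\<^sup>+x. (\<Sum>k. ennreal (d k x)) \<partial>M) = (\<Sum>k. \<integral>\<^sup>+x. ennreal (d k x) \<partial>M)"
    by (rule nn_integral_suminf) measurable
  also have "\<dots> = (\<Sum>k. ennreal (LINT x|M. d k x))"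
    by (intro arg_cong[where f = suminf] ext nn_integral_eq_integral d_int) (simp add: d_def)
  also have "\<dots> \<le> (\<Sum>k. ennreal ((1/2)^k))"
    using d_le by (intro suminf_le ennreal_leI) auto
  also have "\<dots> = ennreal (\<Sum>k. (1/2)^k)"
    by (intro suminf_ennreal2) (auto simp: summable_geometric)
  also have "\<dots> < \<infinity>" by simp
  finally have "AE x in M. (\<Sum>k. ennreal (d k x)) \<noteq> \<infinity>"
    by (intro nn_integral_PInf_AE) auto
  then have conv: "AE x in M. convergent (\<lambda>k. u (r k) x)"
  proof eventually_elim
    case (elim x)
    then have "summable (\<lambda>k. d k x)"
      by (intro summable_suminf_not_top) (auto simp: d_def)
    then have "summable (\<lambda>k. u (r (Suc k)) x - u (r k) x)"
      unfolding d_def by (rule summable_rabs_cancel)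
    then have "(\<lambda>n. u (r 0) x + (\<Sum>k<n. u (r (Suc k)) x - u (r k) x)) \<longlonglongrightarrow>
        u (r 0) x + (\<Sum>k. u (r (Suc k)) x - u (r k) x)"
      by (intro tendsto_intros summable_LIMSEQ)
    then show ?case
      unfolding sum_lessThan_telescope[of "\<lambda>k. u (r k) x"] by (auto simp: convergent_def)
  qed
  define f where "f x = lim (\<lambda>k. u (r k) x)" for x
  have fm [measurable]: "f \<in> borel_measurable M" unfolding f_def by measurable
  have bound: "(\<integral>\<^sup>+x. ennreal ((u n x - f x)\<^sup>2) \<partial>M) \<le> ennreal ((1/4)^k)" if n: "n \<ge> N k" for n k
  proof -
    have "(\<integral>\<^sup>+x. ennreal ((u n x - f x)\<^sup>2) \<partial>M) = (\<integral>\<^sup>+x. liminf (\<lambda>j. ennreal ((u n x - u (r j) x)\<^sup>2)) \<partial>M)"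
    proof (rule nn_integral_cong_AE, use conv in eventually_elim)
      case (elim x)
      then have "(\<lambda>j. u (r j) x) \<longlonglongrightarrow> f x" by (simp add: f_def convergent_LIMSEQ_iff)
      then have "(\<lambda>j. ennreal ((u n x - u (r j) x)\<^sup>2)) \<longlonglongrightarrow> ennreal ((u n x - f x)\<^sup>2)"
        by (intro tendsto_ennrealI tendsto_intros)
      then show ?case by (intro lim_imp_Liminf[symmetric]) auto
    qed
    also have "\<dots> \<le> liminf (\<lambda>j. \<integral>\<^sup>+x. ennreal ((u n x - u (r j) x)\<^sup>2) \<partial>M)"
      by (rule nn_integral_liminf) measurable
    also have "\<dots> \<le> ennreal ((1/4)^k)"
    proof (rule Liminf_le)
      show "\<forall>\<^sub>F j in sequentially. (\<integral>\<^sup>+x. ennreal ((u n x - u (r j) x)\<^sup>2) \<partial>M) \<le> ennreal ((1/4)^k)"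
        unfolding eventually_sequentially
      proof (intro exI allI impI)
        fix j assume "k \<le> j"
        then have "N k \<le> r j" unfolding r_def by (intro member_le_sum) auto
        have "(\<integral>\<^sup>+x. ennreal ((u n x - u (r j) x)\<^sup>2) \<partial>M) = ennreal (L2_inner M (u n - u (r j)) (u n - u (r j)))"
          using L2_integrable_square[OF L2.H_diff[OF u u], of n "r j"]
          by (subst nn_integral_eq_integral) (auto simp: L2_inner_def power2_eq_square)
        also have "\<dots> \<le> ennreal ((1/4)^k)" using N[OF n \<open>N k \<le> r j\<close>] by (intro ennreal_leI) simp
        finally show "(\<integral>\<^sup>+x. ennreal ((u n x - u (r j) x)\<^sup>2) \<partial>M) \<le> ennreal ((1/4)^k)" .
      qed
    qed simp
    finally show ?thesis .
  qed
  have diff: "u n - f \<in> L2 M" if "n \<ge> N k" for n k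
  proof (rule L2I)
    show m: "u n - f \<in> borel_measurable M" unfolding fun_diff_def by measurable
    have "(\<integral>\<^sup>+x. ennreal (norm (((u n - f) x)\<^sup>2)) \<partial>M) < \<infinity>"
      using bound[OF that] by (simp add: le_less_trans[OF _ ennreal_less_top])
    then show "integrable M (\<lambda>x. ((u n - f) x)\<^sup>2)"
      using m by (intro integrableI_bounded) auto
  qed
  have "u (N 0) - (u (N 0) - f) \<in> L2 M" by (intro L2.H_diff u diff[of 0]) simp
  then have fL2: "f \<in> L2 M" by simp
  have "(\<lambda>n. L2_inner M (u n - f) (u n - f)) \<longlonglongrightarrow> 0"
  proof (rule LIMSEQ_I)
    fix e :: real assume "e > 0"
    then obtain k where k: "(1/4)^k < e" using real_arch_pow_inv[of e "1/4"] by auto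
    show "\<exists>n0. \<forall>n\<ge>n0. norm (L2_inner M (u n - f) (u n - f) - 0) < e"
    proof (intro exI allI impI)
      fix n assume n: "n \<ge> N k"
      have "ennreal (L2_inner M (u n - f) (u n - f)) = (\<integral>\<^sup>+x. ennreal ((u n x - f x)\<^sup>2) \<partial>M)"
        using L2_integrable_square[OF diff[OF n]]
        by (subst nn_integral_eq_integral) (auto simp: L2_inner_def power2_eq_square)
      then have "ennreal (L2_inner M (u n - f) (u n - f)) \<le> ennreal ((1/4)^k)"
        using bound[OF n] by (simp only:)
      then have "L2_inner M (u n - f) (u n - f) \<le> (1/4)^k" by (subst (asm) ennreal_le_iff) simp_all
      then show "norm (L2_inner M (u n - f) (u n - f) - 0) < e"
        using k L2.ip_nonneg[of "u n - f"] by simp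
    qed
  qed
  with fL2 show ?thesis by blast
qed

sublocale prob_space \<subseteq> L2: semi_hilbert "L2 M" "L2_inner M"
proof (intro semi_hilbert.intro semi_inner_L2 semi_hilbert_axioms.intro)
qed (rule L2_complete[OF prob_space_axioms])

context prob_space
begin

lemma l2_dist2_eq:
  assumes "f \<in> L2 M" "g \<in> L2 M"
  shows "l2_dist2 M f g = ennreal ((L2.nrm (f - g))\<^sup>2)"
  using L2_integrable_square[OF L2.H_diff[OF assms]]
  by (subst L2.nrm_square) (simp add: l2_dist2_def L2_inner_def nn_integral_eq_integral power2_eq_square)

lemma L2_if_l2_dist2_finite:
  assumes f: "f \<in> L2 M" and g: "g \<in> borel_measurable M" and fin: "l2_dist2 M f g < \<infinity>"
  shows "g \<in> L2 M"
proof -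
  note [measurable] = L2_measurable[OF f] g
  have "f - g \<in> L2 M"
  proof (rule L2I)
    show m: "f - g \<in> borel_measurable M" unfolding fun_diff_def by measurable
    show "integrable M (\<lambda>x. ((f - g) x)\<^sup>2)"
      using m fin by (intro integrableI_bounded) (auto simp: l2_dist2_def)
  qed
  from L2.H_diff[OF f this] show ?thesis by simp
qed

lemma L2_inner_cong_AE:
  assumes "AE x in M. f x = f' x" "AE x in M. g x = g' x"
    "f \<in> borel_measurable M" "f' \<in> borel_measurable M" "g \<in> borel_measurable M" "g' \<in> borel_measurable M"
  shows "L2_inner M f g = L2_inner M f' g'"
  unfolding L2_inner_def
  by (rule integral_cong_AE) (use assms in auto)

lemma L2_nrm_zero_iff:
  assumes "f \<in> L2 M"
  shows "L2.nrm f = 0 \<longleftrightarrow> (AE x in M. f x = 0)"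
  using integral_nonneg_eq_0_iff_AE[OF L2_integrable_square[OF assms]]
  by (simp add: L2.nrm_def L2_inner_def power2_eq_square)

text \<open>With the null sets among the generators, almost equal random variables generate the same
\<open>\<sigma>\<close>-algebra.\<close>

definition sigma_gen :: "('a \<Rightarrow> real) set \<Rightarrow> 'a set set" where
  "sigma_gen F = sigma_sets (space M) ({f -` B \<inter> space M | f B. f \<in> F \<and> B \<in> sets borel} \<union> null_sets M)"

lemma sigma_gen_subset:
  assumes "F \<subseteq> borel_measurable M"
  shows "sigma_gen F \<subseteq> sets M"
  unfolding sigma_gen_def
  using assms by (intro sets.sigma_sets_subset) (auto intro!: measurable_sets)

lemma sigma_algebra_sigma_gen:
  assumes "F \<subseteq> borel_measurable M"
  shows "sigma_algebra (space M) (sigma_gen F)"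
  unfolding sigma_gen_def
  using assms sets.sets_into_space by (intro sigma_algebra_sigma_sets) fastforce

lemma null_sets_sigma_gen: "null_sets M \<subseteq> sigma_gen F"
  unfolding sigma_gen_def by auto

lemma sigma_gen_least:
  assumes S: "sigma_algebra (space M) S" and null: "null_sets M \<subseteq> S"
    and F: "\<And>f B. f \<in> F \<Longrightarrow> B \<in> sets borel \<Longrightarrow> f -` B \<inter> space M \<in> S"
  shows "sigma_gen F \<subseteq> S"
  unfolding sigma_gen_def
  by (rule sigma_algebra.sigma_sets_subset[OF S]) (use null F in auto)

lemma measurable_of_AE_eq:
  fixes f g :: "'a \<Rightarrow> real"
  assumes S: "sigma_algebra (space M) S" and null: "null_sets M \<subseteq> S" and sub: "S \<subseteq> sets M"
    and f: "f \<in> borel_measurable M" and g: "g \<in> borel_measurable (sigma (space M) S)"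
    and eq: "AE x in M. f x = g x"
  shows "f \<in> borel_measurable (sigma (space M) S)"
proof -
  interpret S: sigma_algebra "space M" S by fact
  have sets: "sets (sigma (space M) S) = S" by (rule S.sets_measure_of_eq)
  have space: "space (sigma (space M) S) = space M" by (rule S.space_measure_of_eq)
  obtain N where N: "N \<in> null_sets M" "{x \<in> space M. f x \<noteq> g x} \<subseteq> N"
    using eq by (auto simp: eventually_ae_filter)
  show ?thesis
  proof (rule measurableI)
    fix B :: "real set" assume B: "B \<in> sets borel"
    have gB: "g -` B \<inter> space M \<in> S" using measurable_sets[OF g B] by (simp add: sets space)
    have "f -` B \<inter> space M \<in> sets M" using f B by (rule measurable_sets)
    then have "(f -` B \<inter> space M) \<inter> N \<in> null_sets M" using N(1) by (intro null_set_Int1) auto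
    then have "(f -` B \<inter> space M) \<inter> N \<in> S" "N \<in> S" using null N(1) by auto
    then have "((g -` B \<inter> space M) - N) \<union> ((f -` B \<inter> space M) \<inter> N) \<in> S" using gB by auto
    also have "((g -` B \<inter> space M) - N) \<union> ((f -` B \<inter> space M) \<inter> N) = f -` B \<inter> space M"
      using N(2) by auto
    finally show "f -` B \<inter> space (sigma (space M) S) \<in> sets (sigma (space M) S)"
      by (simp add: sets space)
  qed simp
qed

text \<open>A mean-square limit is an almost sure limit along a subsequence, so it stays measurable with respect
to a \<open>\<sigma>\<close>-algebra that contains the null sets.\<close>

lemma closed_sub_measurable:
  assumes S: "sigma_algebra (space M) S" and null: "null_sets M \<subseteq> S" and sub: "S \<subseteq> sets M"
  shows "L2.closed_sub (L2 M \<inter> borel_measurable (sigma (space M) S))"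
  unfolding L2.closed_sub_def
proof (intro conjI ballI impI)
  let ?S = "sigma (space M) S"
  interpret S: sigma_algebra "space M" S by fact
  have sets: "sets (sigma (space M) S) = S" by (rule S.sets_measure_of_eq)
  have space: "space (sigma (space M) S) = space M" by (rule S.space_measure_of_eq)
  show "subspace (L2 M \<inter> borel_measurable ?S)"
  proof (intro subspaceI IntI)
    show "0 \<in> borel_measurable ?S" by (simp add: zero_fun_def)
    fix f g :: "'a \<Rightarrow> real" and c :: real
    assume f: "f \<in> L2 M \<inter> borel_measurable ?S"
    then have fS: "f \<in> borel_measurable ?S" by blast
    then show "c *\<^sub>R f \<in> borel_measurable ?S" unfolding scaleR_fun_def by measurable
    assume "g \<in> L2 M \<inter> borel_measurable ?S"
    then have "g \<in> borel_measurable ?S" by blast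
    with fS show "f + g \<in> borel_measurable ?S" unfolding plus_fun_def by measurable
  qed auto
  fix f assume f: "f \<in> L2 M" and lim: "\<forall>e>0. \<exists>g\<in>L2 M \<inter> borel_measurable ?S. L2.nrm (f - g) < e"
  have "\<exists>g\<in>L2 M \<inter> borel_measurable ?S. L2.nrm (f - g) < inverse (real (Suc n))" for n
    using lim by simp
  then obtain g where g: "\<And>n. g n \<in> L2 M" "\<And>n. g n \<in> borel_measurable ?S"
    "\<And>n. L2.nrm (f - g n) < inverse (real (Suc n))" by (metis IntE)
  have "(\<lambda>n. LINT x|M. norm (g n x - f x)) \<longlonglongrightarrow> 0"
  proof (rule tendsto_sandwich[OF _ _ tendsto_const LIMSEQ_inverse_real_of_nat])
    show "\<forall>\<^sub>F n in sequentially. (LINT x|M. norm (g n x - f x)) \<le> inverse (real (Suc n))"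
    proof (intro always_eventually allI)
      fix n
      show "(LINT x|M. norm (g n x - f x)) \<le> inverse (real (Suc n))"
        using L2_mean_abs_le[OF prob_space_axioms L2.H_diff[OF f g(1)], of n] g(3)[of n]
        by (simp add: L2.nrm_def abs_minus_commute)
    qed
  qed simp
  then have "\<exists>r. strict_mono r \<and> (AE x in M. (\<lambda>n. g (r n) x - f x) \<longlonglongrightarrow> 0)"
    using f g(1) by (intro tendsto_L1_AE_subseq) (intro Bochner_Integration.integrable_diff L2_integrable finite_measure_axioms)
  then obtain r where AE: "AE x in M. (\<lambda>n. g (r n) x - f x) \<longlonglongrightarrow> 0" by blast
  define h where "h x = lim (\<lambda>n. g (r n) x)" for x
  have "h \<in> borel_measurable ?S" unfolding h_def using g(2) by measurable
  moreover have "AE x in M. f x = h x"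
    using AE
  proof eventually_elim
    case (elim x)
    then have "(\<lambda>n. g (r n) x) \<longlonglongrightarrow> f x" by (simp add: LIM_zero_iff)
    then show ?case unfolding h_def by (simp add: limI)
  qed
  ultimately have "f \<in> borel_measurable ?S"
    by (rule measurable_of_AE_eq[OF S null sub L2_measurable[OF f]])
  with f show "f \<in> L2 M \<inter> borel_measurable ?S" by blast
qed auto

text \<open>Through this lemma, statements on generated \<open>\<sigma>\<close>-algebras reduce to statements on closed spans.\<close>

lemma cspan_measurable:
  assumes F: "F \<subseteq> L2 M" and f: "f \<in> L2.cspan F" and B: "B \<in> sets borel"
  shows "f -` B \<inter> space M \<in> sigma_gen F"
proof -
  have Fm: "F \<subseteq> borel_measurable M" using F L2_measurable by auto
  note S = sigma_algebra_sigma_gen[OF Fm]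
  interpret S: sigma_algebra "space M" "sigma_gen F" by (fact S)
  have "F \<subseteq> L2 M \<inter> borel_measurable (sigma (space M) (sigma_gen F))"
  proof
    fix f assume f: "f \<in> F"
    have "f \<in> borel_measurable (sigma (space M) (sigma_gen F))"
    proof (rule measurableI)
      fix B :: "real set" assume "B \<in> sets borel"
      then have "f -` B \<inter> space M \<in> sigma_gen F"
        using f unfolding sigma_gen_def by (intro sigma_sets.Basic) blast
      then show "f -` B \<inter> space (sigma (space M) (sigma_gen F)) \<in> sets (sigma (space M) (sigma_gen F))"
        by (simp add: S.sets_measure_of_eq S.space_measure_of_eq)
    qed simp
    with f F show "f \<in> L2 M \<inter> borel_measurable (sigma (space M) (sigma_gen F))" by auto
  qed
  from L2.cspan_minimal[OF this closed_sub_measurable[OF S null_sets_sigma_gen sigma_gen_subset[OF Fm]]]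
  have "f \<in> borel_measurable (sigma (space M) (sigma_gen F))" using f by auto
  from measurable_sets[OF this B] show ?thesis by (simp add: S.sets_measure_of_eq S.space_measure_of_eq)
qed

end


section \<open>Uniqueness by characteristic functions\<close>

lemma (in finite_measure) integrable_bounded_real:
  fixes f :: "'a \<Rightarrow> real"
  assumes "f \<in> borel_measurable M" "\<And>x. x \<in> space M \<Longrightarrow> \<bar>f x\<bar> \<le> C"
  shows "integrable M f"
  by (rule integrable_const_bound[of _ C]) (use assms in auto)

text \<open>Characteristic functions are used in their real form, as the integrals of \<open>cos (t * x + \<theta>)\<close> for all
  phases \<open>\<theta>\<close>. Stated for finite measures instead of probabilities, the theorem applies to
  measures with a density.\<close>

lemma cosine_uniqueness_real_line:
  fixes \<mu>1 \<mu>2 :: "real measure"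
  assumes fin: "finite_measure \<mu>1" "finite_measure \<mu>2"
    and sets: "sets \<mu>1 = sets borel" "sets \<mu>2 = sets borel"
    and eq: "\<And>t \<theta>. (LINT x|\<mu>1. cos (t * x + \<theta>)) = (LINT x|\<mu>2. cos (t * x + \<theta>))"
  shows "\<mu>1 = \<mu>2"
proof -
  interpret m1: finite_measure \<mu>1 by fact
  interpret m2: finite_measure \<mu>2 by fact
  have space: "space \<mu>1 = UNIV" "space \<mu>2 = UNIV" using sets[THEN sets_eq_imp_space_eq] by auto
  define c where "c = measure \<mu>1 UNIV"
  have c: "measure \<mu>1 UNIV = c" "measure \<mu>2 UNIV = c"
    using eq[of 0 0] by (auto simp: c_def space)
  show ?thesis
  proof (cases "c = 0")
    case True
    show ?thesis
    proof (rule measure_eqI)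
      fix A assume "A \<in> sets \<mu>1"
      have "measure \<mu>1 A = 0" "measure \<mu>2 A = 0"
        using m1.bounded_measure[of A] m2.bounded_measure[of A] c True
        by (simp_all add: space measure_le_0_iff)
      then show "emeasure \<mu>1 A = emeasure \<mu>2 A"
        by (simp add: m1.emeasure_eq_measure m2.emeasure_eq_measure)
    qed (simp add: sets)
  next
    case False
    then have c0: "c > 0" using measure_nonneg[of \<mu>1 UNIV] by (simp add: c_def less_le)
    have combine: "complex_of_real (1/c) * (complex_of_real A + \<i> * complex_of_real B) = A / c + \<i> * (B / c)" for A B
      by (simp add: complex_eq_iff)
    define N where "N \<mu> = density \<mu> (\<lambda>x. ennreal (1 / c))" for \<mu> :: "real measure"
    have N: "real_distribution (N \<mu>)" "char (N \<mu>) t = (LINT x|\<mu>. cos (t * x)) / c + \<i> * ((LINT x|\<mu>. cos (t * x + (- pi/2))) / c)"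
      if "finite_measure \<mu>" "sets \<mu> = sets borel" "measure \<mu> UNIV = c" for \<mu> t
    proof -
      interpret finite_measure \<mu> by fact
      note [measurable_cong] = that(2)
      have sp: "space \<mu> = UNIV" using sets_eq_imp_space_eq[OF that(2)] by simp
      show "real_distribution (N \<mu>)"
      proof (intro real_distribution.intro prob_spaceI real_distribution_axioms.intro)
        have "emeasure (N \<mu>) (space (N \<mu>)) = ennreal (1 / c) * emeasure \<mu> UNIV"
          by (simp add: N_def emeasure_density sp nn_integral_cmult)
        also have "\<dots> = ennreal (1 / c * c)"
          using c0 that(3) by (simp add: emeasure_eq_measure ennreal_mult[symmetric] del: ennreal_1)
        finally show "emeasure (N \<mu>) (space (N \<mu>)) = 1" using c0 by simp
      qed (simp add: N_def that(2))
      have int: "integrable \<mu> (\<lambda>x. cos (t * x))" "integrable \<mu> (\<lambda>x. sin (t * x))"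
        by (rule integrable_bounded_real[of _ 1]; simp)+
      have "char (N \<mu>) t = (CLINT x|\<mu>. complex_of_real (1 / c) * iexp (t * x))"
        using c0 by (simp add: char_def N_def integral_density scaleR_conv_of_real)
      also have "\<dots> = complex_of_real (1/c) * (CLINT x|\<mu>. complex_of_real (cos (t * x)) + \<i> * complex_of_real (sin (t * x)))"
        by (subst integral_mult_right_zero)
          (simp add: exp_Euler cos_of_real[symmetric] sin_of_real[symmetric])
      also have "\<dots> = complex_of_real (1/c) * (complex_of_real (LINT x|\<mu>. cos (t * x)) + \<i> * complex_of_real (LINT x|\<mu>. sin (t * x)))"
        using int by (subst Bochner_Integration.integral_add) (auto simp: integral_complex_of_real)
      also have "(\<lambda>x. sin (t * x)) = (\<lambda>x. cos (t * x + (- pi/2)))"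
        by (simp add: cos_diff)
      finally show "char (N \<mu>) t = (LINT x|\<mu>. cos (t * x)) / c + \<i> * ((LINT x|\<mu>. cos (t * x + (- pi/2))) / c)"
        by (subst (asm) combine)
    qed
    have "N \<mu>1 = N \<mu>2"
    proof (rule Levy_uniqueness)
      show "char (N \<mu>1) = char (N \<mu>2)"
        using eq[of _ 0] eq[of _ "- pi/2"]
        by (intro ext) (simp only: N(2)[OF fin(1) sets(1) c(1)] N(2)[OF fin(2) sets(2) c(2)] add_0_right)
    qed (auto intro!: N(1) fin sets c)
    then have "density (N \<mu>1) (\<lambda>x. ennreal c) = density (N \<mu>2) (\<lambda>x. ennreal c)" by simp
    then show ?thesis
      using c0 by (simp add: N_def density_density_eq ennreal_mult[symmetric] density_1)
  qed
qed

lemma cosine_uniqueness_weighted: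
  fixes f w :: "'a \<Rightarrow> real"
  assumes fin: "finite_measure \<nu>1" "finite_measure \<nu>2" and sets: "sets \<nu>1 = sets \<nu>2"
    and f: "f \<in> borel_measurable \<nu>1" and w: "w \<in> borel_measurable \<nu>1"
    and w_bounds: "\<And>x. 0 \<le> w x" "\<And>x. w x \<le> C"
    and eq: "\<And>t \<theta>. (LINT x|\<nu>1. w x * cos (t * f x + \<theta>)) = (LINT x|\<nu>2. w x * cos (t * f x + \<theta>))"
    and B: "B \<in> sets borel"
  shows "(LINT x|\<nu>1. w x * indicat_real B (f x)) = (LINT x|\<nu>2. w x * indicat_real B (f x))"
proof -
  define \<mu> where "\<mu> \<nu> = distr (density \<nu> (\<lambda>x. ennreal (w x))) borel f" for \<nu>
  have \<mu>: "finite_measure (\<mu> \<nu>)" "sets (\<mu> \<nu>) = sets borel"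
    "\<And>g :: real \<Rightarrow> real. g \<in> borel_measurable borel \<Longrightarrow> (LINT x|\<mu> \<nu>. g x) = (LINT x|\<nu>. w x * g (f x))"
    if "finite_measure \<nu>" "f \<in> borel_measurable \<nu>" "w \<in> borel_measurable \<nu>" for \<nu>
  proof -
    interpret finite_measure \<nu> by fact
    note [measurable] = that(2,3)
    show "sets (\<mu> \<nu>) = sets borel" by (simp add: \<mu>_def)
    have "integrable \<nu> w" using w_bounds by (intro integrable_bounded_real[of _ C]) (auto simp: that)
    then have "emeasure (density \<nu> (\<lambda>x. ennreal (w x))) (space \<nu>) \<noteq> \<infinity>"
      using w_bounds by (simp add: emeasure_density nn_integral_eq_integral)
    then have "finite_measure (density \<nu> (\<lambda>x. ennreal (w x)))" by (intro finite_measureI) simp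
    then show "finite_measure (\<mu> \<nu>)"
      unfolding \<mu>_def by (rule finite_measure.finite_measure_distr) simp
    show "(LINT x|\<mu> \<nu>. g x) = (LINT x|\<nu>. w x * g (f x))" if "g \<in> borel_measurable borel" for g :: "real \<Rightarrow> real"
      using that w_bounds by (simp add: \<mu>_def integral_distr integral_density)
  qed
  have f2: "f \<in> borel_measurable \<nu>2" and w2: "w \<in> borel_measurable \<nu>2"
    using f w measurable_cong_sets[OF sets refl] by auto
  note 1 = \<mu>[OF fin(1) f w] and 2 = \<mu>[OF fin(2) f2 w2]
  have "\<mu> \<nu>1 = \<mu> \<nu>2"
    by (rule cosine_uniqueness_real_line[OF 1(1) 2(1) 1(2) 2(2)]) (simp add: 1(3) 2(3) eq)
  then show ?thesis using B by (simp add: 1(3)[symmetric] 2(3)[symmetric])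
qed

lemma cosine_product: "cos A * cos B = (cos (A + B) + cos (A - B)) / 2" for A B :: real
  by (simp add: cos_add cos_diff)

text \<open>Uniqueness in several variables from uniqueness in one. The indicators of a cylinder set are
  inserted one at a time: with the weight \<open>1 + cos (\<zeta> + \<phi>)\<close> times the indicators already present, the
  induction hypothesis and \<open>cosine_product\<close> show that the next variable has the same weighted law under
  both measures. The added \<open>1\<close> makes the weight nonnegative.\<close>

lemma cosine_uniqueness_cylinders:
  fixes F :: "('a \<Rightarrow> real) set"
  assumes fin: "finite_measure \<nu>1" "finite_measure \<nu>2" and sets: "sets \<nu>1 = sets \<nu>2"
    and F: "F \<subseteq> borel_measurable \<nu>1"
    and eq: "\<And>\<xi> \<theta>. \<xi> \<in> span F \<Longrightarrow> (LINT x|\<nu>1. cos (\<xi> x + \<theta>)) = (LINT x|\<nu>2. cos (\<xi> x + \<theta>))"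
    and ps: "\<And>f B. (f, B) \<in> set ps \<Longrightarrow> f \<in> F \<and> B \<in> sets borel" and \<xi>: "\<xi> \<in> span F"
  shows "(LINT x|\<nu>1. (\<Prod>(f, B)\<leftarrow>ps. indicat_real B (f x)) * cos (\<xi> x + \<theta>)) =
    (LINT x|\<nu>2. (\<Prod>(f, B)\<leftarrow>ps. indicat_real B (f x)) * cos (\<xi> x + \<theta>))"
  using ps \<xi>
proof (induction ps arbitrary: \<xi> \<theta>)
  case Nil
  then show ?case by (simp add: eq)
next
  case (Cons p ps)
  obtain f B where p: "p = (f, B)" by fastforce
  define w where "w x = (\<Prod>(f, B)\<leftarrow>ps. indicat_real B (f x))" for x
  have f: "f \<in> F" and B [measurable]: "B \<in> sets borel" using Cons.prems(1)[of f B] p by auto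
  have F_span: "g \<in> borel_measurable \<nu>1" if "g \<in> span F" for g
    using that
  proof (induction rule: span_induct_alt)
    case base then show ?case by (simp add: zero_fun_def)
  next
    case (step c g h)
    then have [measurable]: "g \<in> borel_measurable \<nu>1" "h \<in> borel_measurable \<nu>1" using F by auto
    show ?case unfolding plus_fun_def scaleR_fun_def by measurable
  qed
  have [measurable]: "f \<in> borel_measurable \<nu>1" "\<xi> \<in> borel_measurable \<nu>1"
    using f F F_span[OF Cons.prems(2)] by auto
  have ps_F: "g \<in> F \<and> C \<in> sets borel" if "(g, C) \<in> set ps" for g C
    by (rule Cons.prems(1)) (use that in simp)
  have w01: "0 \<le> w x" "w x \<le> 1" for x
    unfolding w_def by (induction ps) (auto simp: indicator_def split: prod.splits)
  have wm [measurable]: "w \<in> borel_measurable \<nu>1"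
    unfolding w_def using ps_F
  proof (induction ps)
    case (Cons q ps)
    obtain g C where q: "q = (g, C)" by fastforce
    have [measurable]: "g \<in> borel_measurable \<nu>1" "C \<in> sets borel" using Cons.prems[of g C] F q by auto
    have [measurable]: "(\<lambda>x. \<Prod>(f, B)\<leftarrow>ps. indicat_real B (f x)) \<in> borel_measurable \<nu>1"
      using Cons by simp
    show ?case unfolding q by simp
  qed simp
  note IH = Cons.IH[OF ps_F, folded w_def]
  have *: "(LINT x|\<nu>1. (w x * (1 + cos (\<zeta> x + \<phi>))) * indicat_real B (f x)) =
      (LINT x|\<nu>2. (w x * (1 + cos (\<zeta> x + \<phi>))) * indicat_real B (f x))" if \<zeta>: "\<zeta> \<in> span F" for \<zeta> \<phi>
  proof (rule cosine_uniqueness_weighted[OF fin sets, where C = 2])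
    have [measurable]: "\<zeta> \<in> borel_measurable \<nu>1" by (rule F_span[OF \<zeta>])
    show "(\<lambda>x. w x * (1 + cos (\<zeta> x + \<phi>))) \<in> borel_measurable \<nu>1" by measurable
    show "0 \<le> w x * (1 + cos (\<zeta> x + \<phi>))" for x
      using w01[of x] cos_ge_minus_one[of "\<zeta> x + \<phi>"] by (intro mult_nonneg_nonneg) linarith+
    show "w x * (1 + cos (\<zeta> x + \<phi>)) \<le> 2" for x
      using w01[of x] mult_mono[of "w x" 1 "1 + cos (\<zeta> x + \<phi>)" 2] cos_ge_minus_one[of "\<zeta> x + \<phi>"]
        cos_le_one[of "\<zeta> x + \<phi>"] by linarith
    fix t \<psi>
    have "(LINT x|\<nu>. (w x * (1 + cos (\<zeta> x + \<phi>))) * cos (t * f x + \<psi>)) =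
        (LINT x|\<nu>. w x * cos ((t *\<^sub>R f) x + \<psi>)) +
        ((LINT x|\<nu>. w x * cos ((\<zeta> + t *\<^sub>R f) x + (\<phi> + \<psi>))) + (LINT x|\<nu>. w x * cos ((\<zeta> - t *\<^sub>R f) x + (\<phi> - \<psi>)))) / 2"
      if "finite_measure \<nu>" "sets \<nu> = sets \<nu>1" for \<nu>
    proof -
      interpret finite_measure \<nu> by fact
      note [measurable_cong] = that(2)
      have int: "integrable \<nu> (\<lambda>x. w x * cos (h x))" if [measurable]: "h \<in> borel_measurable \<nu>" for h
        using w01 by (intro integrable_bounded_real[of _ 1]) (auto simp: abs_mult intro!: mult_le_one)
      have "(LINT x|\<nu>. (w x * (1 + cos (\<zeta> x + \<phi>))) * cos (t * f x + \<psi>)) =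
        (LINT x|\<nu>. w x * cos (t * f x + \<psi>) + (w x * cos (\<zeta> x + t * f x + (\<phi> + \<psi>)) + w x * cos (\<zeta> x - t * f x + (\<phi> - \<psi>))) / 2)"
        using cosine_product[of "\<zeta> _ + \<phi>" "t * f _ + \<psi>"]
        by (intro Bochner_Integration.integral_cong refl) (simp add: algebra_simps add_divide_distrib)
      then show ?thesis
        using int by (simp add: integral_add)
    qed
    from this[OF fin(1) refl] this[OF fin(2) sets[symmetric]]
    show "(LINT x|\<nu>1. (w x * (1 + cos (\<zeta> x + \<phi>))) * cos (t * f x + \<psi>)) =
        (LINT x|\<nu>2. (w x * (1 + cos (\<zeta> x + \<phi>))) * cos (t * f x + \<psi>))"
      using IH f \<zeta> by (simp only: span_add span_diff span_scale span_base)
  qed (auto simp: B)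
  have split: "(LINT x|\<nu>. (w x * (1 + cos (\<xi> x + \<theta>))) * indicat_real B (f x)) =
      (LINT x|\<nu>. w x * indicat_real B (f x)) + (LINT x|\<nu>. (indicat_real B (f x) * w x) * cos (\<xi> x + \<theta>))"
    if "finite_measure \<nu>" "sets \<nu> = sets \<nu>1" for \<nu>
  proof -
    interpret finite_measure \<nu> by fact
    note [measurable_cong] = that(2)
    have "integrable \<nu> (\<lambda>x. w x * indicat_real B (f x))"
      "integrable \<nu> (\<lambda>x. (indicat_real B (f x) * w x) * cos (\<xi> x + \<theta>))"
      using w01 by (auto intro!: integrable_bounded_real[of _ 1] mult_le_one simp: abs_mult indicator_def)
    then show ?thesis
      by (subst Bochner_Integration.integral_add[symmetric]) (auto simp: algebra_simps)
  qed
  have half: "(LINT x|\<nu>. (w x * (1 + cos ((0 :: 'a \<Rightarrow> real) x + 0))) * indicat_real B (f x)) =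
      2 * (LINT x|\<nu>. w x * indicat_real B (f x))" for \<nu> :: "'a measure"
    by (subst integral_mult_right_zero[symmetric]) (simp add: algebra_simps)
  have "(LINT x|\<nu>1. (indicat_real B (f x) * w x) * cos (\<xi> x + \<theta>)) = (LINT x|\<nu>2. (indicat_real B (f x) * w x) * cos (\<xi> x + \<theta>))"
    using *[OF Cons.prems(2), of \<theta>] *[OF span_zero, of 0]
    unfolding split[OF fin(1) refl] split[OF fin(2) sets[symmetric]] half by simp
  then show ?case by (simp add: p w_def)
qed

text \<open>Null sets are admitted as generators so that the theorem applies to completed \<open>\<sigma>\<close>-algebras.\<close>

theorem cosine_uniqueness:
  fixes F :: "('a \<Rightarrow> real) set"
  assumes fin: "finite_measure \<nu>1" "finite_measure \<nu>2" and sets: "sets \<nu>1 = sets \<nu>2"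
    and F: "F \<subseteq> borel_measurable \<nu>1"
    and eq: "\<And>\<xi> \<theta>. \<xi> \<in> span F \<Longrightarrow> (LINT x|\<nu>1. cos (\<xi> x + \<theta>)) = (LINT x|\<nu>2. cos (\<xi> x + \<theta>))"
    and A: "A \<in> sigma_sets (space \<nu>1)
      ({f -` B \<inter> space \<nu>1 | f B. f \<in> F \<and> B \<in> sets borel} \<union> (null_sets \<nu>1 \<inter> null_sets \<nu>2))"
  shows "measure \<nu>1 A = measure \<nu>2 A"
proof -
  interpret n1: finite_measure \<nu>1 by fact
  interpret n2: finite_measure \<nu>2 by fact
  have space: "space \<nu>2 = space \<nu>1" using sets_eq_imp_space_eq[OF sets] by simp
  define cyl where "cyl ps = {x \<in> space \<nu>1. \<forall>(f, B)\<in>set ps. f x \<in> B}" for ps :: "(('a \<Rightarrow> real) \<times> real set) list"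
  define E where "E = {cyl ps | ps. \<forall>(f, B)\<in>set ps. f \<in> F \<and> B \<in> sets borel} \<union> (null_sets \<nu>1 \<inter> null_sets \<nu>2)"
  have cyl_sets: "cyl ps \<in> sets \<nu>1" if "\<forall>(f, B)\<in>set ps. f \<in> F \<and> B \<in> sets borel" for ps
    using that
  proof (induction ps)
    case (Cons p ps)
    obtain f B where p: "p = (f, B)" by fastforce
    have "cyl (p # ps) = (f -` B \<inter> space \<nu>1) \<inter> cyl ps" by (auto simp: cyl_def p)
    moreover have "f -` B \<inter> space \<nu>1 \<in> sets \<nu>1" using Cons.prems F p by (auto intro!: measurable_sets)
    ultimately show ?case using Cons by auto
  qed (simp add: cyl_def)
  have E_sets: "E \<subseteq> sets \<nu>1" unfolding E_def using cyl_sets by auto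
  have "Int_stable E"
  proof (rule Int_stableI)
    fix a b assume ab: "a \<in> E" "b \<in> E"
    show "a \<inter> b \<in> E"
    proof (cases "a \<in> null_sets \<nu>1 \<inter> null_sets \<nu>2 \<or> b \<in> null_sets \<nu>1 \<inter> null_sets \<nu>2")
      case True
      have "a \<in> sets \<nu>1" "b \<in> sets \<nu>1" "a \<in> sets \<nu>2" "b \<in> sets \<nu>2" using ab E_sets sets by auto
      then have "a \<inter> b \<in> null_sets \<nu>1 \<inter> null_sets \<nu>2"
        using True by (auto intro: null_set_Int1 null_set_Int2)
      then show ?thesis unfolding E_def by blast
    next
      case False
      then obtain ps qs where *: "a = cyl ps" "\<forall>(f, B)\<in>set ps. f \<in> F \<and> B \<in> sets borel"
        "b = cyl qs" "\<forall>(f, B)\<in>set qs. f \<in> F \<and> B \<in> sets borel"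
        using ab unfolding E_def by auto
      have "a \<inter> b = cyl (ps @ qs)" using * by (auto simp: cyl_def)
      moreover have "\<forall>(f, B)\<in>set (ps @ qs). f \<in> F \<and> B \<in> sets borel" using * by auto
      ultimately show ?thesis unfolding E_def by blast
    qed
  qed
  moreover have "E \<subseteq> Pow (space \<nu>1)" using E_sets sets.sets_into_space by blast
  moreover have "A \<in> sigma_sets (space \<nu>1) E"
  proof -
    have "f -` B \<inter> space \<nu>1 \<in> E" if "f \<in> F" "B \<in> sets borel" for f B
    proof -
      have "f -` B \<inter> space \<nu>1 = cyl [(f, B)]" by (auto simp: cyl_def)
      then show ?thesis using that unfolding E_def by (intro UnI1 CollectI exI[of _ "[(f, B)]"]) auto
    qed
    then have "{f -` B \<inter> space \<nu>1 | f B. f \<in> F \<and> B \<in> sets borel} \<union> (null_sets \<nu>1 \<inter> null_sets \<nu>2) \<subseteq> E"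
      unfolding E_def by auto
    from sigma_sets_mono'[OF this] A show ?thesis by blast
  qed
  ultimately show ?thesis
  proof (induction rule: sigma_sets_induct_disjoint)
    case (basic A)
    show ?case
    proof (cases "A \<in> null_sets \<nu>1 \<inter> null_sets \<nu>2")
      case True
      then show ?thesis by (auto simp: measure_eq_0_null_sets)
    next
      case False
      then obtain ps where ps: "A = cyl ps" "\<forall>(f, B)\<in>set ps. f \<in> F \<and> B \<in> sets borel"
        using basic unfolding E_def by auto
      have ind: "(\<Prod>(f, B)\<leftarrow>ps. indicat_real B (f x)) = indicat_real (cyl ps) x" if "x \<in> space \<nu>1" for x
      proof (induction ps)
        case Nil then show ?case using that by (simp add: cyl_def)
      next
        case (Cons p ps)
        then show ?case using that by (auto simp: cyl_def indicator_def split: prod.splits)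
      qed
      have "(LINT x|\<nu>1. (\<Prod>(f, B)\<leftarrow>ps. indicat_real B (f x)) * cos ((0 :: 'a \<Rightarrow> real) x + 0)) =
         (LINT x|\<nu>2. (\<Prod>(f, B)\<leftarrow>ps. indicat_real B (f x)) * cos ((0 :: 'a \<Rightarrow> real) x + 0))"
        by (rule cosine_uniqueness_cylinders[OF fin sets F eq _ span_zero]) (use ps(2) in auto)
      moreover have "(LINT x|\<nu>. (\<Prod>(f, B)\<leftarrow>ps. indicat_real B (f x)) * cos ((0 :: 'a \<Rightarrow> real) x + 0)) = measure \<nu> A"
        if "space \<nu> = space \<nu>1" "sets \<nu> = sets \<nu>1" for \<nu>
      proof -
        have "(LINT x|\<nu>. (\<Prod>(f, B)\<leftarrow>ps. indicat_real B (f x)) * cos ((0 :: 'a \<Rightarrow> real) x + 0)) = (LINT x|\<nu>. indicat_real (cyl ps) x)"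
          by (intro Bochner_Integration.integral_cong refl) (simp add: ind that)
        also have "\<dots> = measure \<nu> A"
          using cyl_sets[OF ps(2)] sets.sets_into_space[OF cyl_sets[OF ps(2)]] that ps(1)
          by (simp add: Int_absorb2)
        finally show ?thesis .
      qed
      ultimately show ?thesis using space sets by simp
    qed
  next
    case (compl A)
    have A: "A \<in> sets \<nu>1" "A \<in> sets \<nu>2"
      using compl(1) sets.sigma_sets_subset[OF E_sets] sets by auto
    have "measure \<nu>1 (cyl []) = measure \<nu>2 (cyl [])"
    proof -
      have "(LINT x|\<nu>1. cos ((0 :: 'a \<Rightarrow> real) x + 0)) = (LINT x|\<nu>2. cos ((0 :: 'a \<Rightarrow> real) x + 0))"
        by (rule eq) (rule span_zero)
      then show ?thesis by (simp add: cyl_def space)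
    qed
    then have "measure \<nu>1 (space \<nu>1) = measure \<nu>2 (space \<nu>1)" by (simp add: cyl_def)
    then show ?case
      using A compl n1.finite_measure_compl[of A] n2.finite_measure_compl[of A] by (simp add: space)
  next
    case (union A)
    have A: "range A \<subseteq> sets \<nu>1" "range A \<subseteq> sets \<nu>2"
      using union(2) sets.sigma_sets_subset[OF E_sets] sets by auto
    from n1.finite_measure_UNION[OF A(1) union(1)] n2.finite_measure_UNION[OF A(2) union(1)]
    show ?case using union(3) sums_unique by (metis (mono_tags, lifting) sums_cong)
  qed simp
qed


section \<open>Gaussian variables and a zero-one law\<close>

lemma abs_cos_diff_le: "\<bar>cos a - cos b\<bar> \<le> \<bar>a - b\<bar>" for a b :: real
proof -
  have "\<bar>cos a - cos b\<bar> = 2 * \<bar>sin ((a + b) / 2)\<bar> * \<bar>sin ((b - a) / 2)\<bar>"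
    by (simp add: cos_diff_cos abs_mult)
  also have "\<dots> \<le> 2 * 1 * \<bar>(b - a) / 2\<bar>"
    by (intro mult_mono abs_sin_x_le_abs_x) auto
  finally show ?thesis by simp
qed

context prob_space
begin

text \<open>Centered Gaussian random variables, degenerate ones included, described by their characteristic
function at \<open>1\<close>. As the definition is applied to all elements of a linear space, this determines their
laws, and it visibly passes to mean-square limits.\<close>

definition gaussian :: "('a \<Rightarrow> real) \<Rightarrow> bool" where
  "gaussian f \<longleftrightarrow> f \<in> L2 M \<and>
     (\<forall>\<theta>. expectation (\<lambda>x. cos (f x + \<theta>)) = cos \<theta> * exp (- L2_inner M f f / 2))"

lemma gaussian_L2: "gaussian f \<Longrightarrow> f \<in> L2 M"
  by (simp add: gaussian_def)

lemma gaussian_cos: "gaussian f \<Longrightarrow> expectation (\<lambda>x. cos (f x + \<theta>)) = cos \<theta> * exp (- L2_inner M f f / 2)"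
  by (simp add: gaussian_def)

lemma integrable_cos [simp]: "f \<in> borel_measurable M \<Longrightarrow> integrable M (\<lambda>x. cos (f x + \<theta>))"
  for f :: "'a \<Rightarrow> real"
  by (rule integrable_bounded_real[of _ 1]) auto

lemma std_normal_cos_sin:
  "(LINT x|std_normal_distribution. cos (t * x)) = exp (- t\<^sup>2 / 2)"
  "(LINT x|std_normal_distribution. sin (t * x)) = 0"
proof -
  interpret N: real_distribution std_normal_distribution by (rule real_dist_normal_dist)
  have int: "integrable std_normal_distribution (\<lambda>x. cos (t * x))" "integrable std_normal_distribution (\<lambda>x. sin (t * x))"
    by (rule N.integrable_bounded_real[of _ 1]; simp)+
  have "char std_normal_distribution t =
      (CLINT x|std_normal_distribution. complex_of_real (cos (t * x)) + \<i> * complex_of_real (sin (t * x)))"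
    by (simp add: char_def exp_Euler cos_of_real[symmetric] sin_of_real[symmetric])
  also have "\<dots> = complex_of_real (LINT x|std_normal_distribution. cos (t * x)) + \<i> * complex_of_real (LINT x|std_normal_distribution. sin (t * x))"
    using int by (subst Bochner_Integration.integral_add) (auto simp: integral_complex_of_real)
  finally have "complex_of_real (exp (- t\<^sup>2 / 2)) = \<dots>"
    by (simp add: char_std_normal_distribution)
  from arg_cong[OF this, of Re] arg_cong[OF this, of Im]
  show "(LINT x|std_normal_distribution. cos (t * x)) = exp (- t\<^sup>2 / 2)"
    "(LINT x|std_normal_distribution. sin (t * x)) = 0" by simp_all
qed

lemma gaussian_of_centered_gaussian:
  assumes Y: "centered_gaussian M Y"
  shows "gaussian Y"
proof -
  have Ym [measurable]: "Y \<in> borel_measurable M" using Y by (simp add: centered_gaussian_def)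
  consider "AE \<omega> in M. Y \<omega> = 0" | \<sigma> where "\<sigma> > 0" "distributed M lborel Y (normal_density 0 \<sigma>)"
    using Y unfolding centered_gaussian_def by blast
  then show ?thesis
  proof cases
    case 1
    have L2: "Y \<in> L2 M"
      by (rule L2_cong_AE[of "\<lambda>_. 0"]) (use 1 in \<open>auto intro!: L2I\<close>)
    have "L2_inner M Y Y = 0"
      using 1 L2_nrm_zero_iff[OF L2] by (simp add: L2.nrm_def)
    moreover have "expectation (\<lambda>x. cos (Y x + \<theta>)) = expectation (\<lambda>x. cos \<theta>)" for \<theta>
      by (rule integral_cong_AE) (use 1 in auto)
    ultimately show ?thesis using L2 by (simp add: gaussian_def prob_space)
  next
    case (2 \<sigma>)
    define U where "U x = Y x / \<sigma>" for x
    have [measurable]: "U \<in> borel_measurable M" unfolding U_def by measurable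
    have "distributed M lborel (\<lambda>x. (Y x - 0) / \<sigma>) (\<lambda>x. ennreal (std_normal_density x))"
      using 2 normal_standard_normal_convert[OF 2(1), of Y 0] by simp
    then have "distr M lborel U = std_normal_distribution"
      by (simp add: U_def[abs_def] distributed_distr_eq_density)
    then have int: "(LINT x|M. g (U x)) = (LINT x|std_normal_distribution. g x)"
      and integrable: "integrable M (\<lambda>x. g (U x)) \<longleftrightarrow> integrable std_normal_distribution g"
      if "g \<in> borel_measurable borel" for g :: "real \<Rightarrow> real"
      using integral_distr[of U M lborel g] integrable_distr_eq[of U M lborel g] that by auto
    have YU: "Y x = \<sigma> * U x" for x using 2(1) by (simp add: U_def)
    have "integrable M (\<lambda>x. (U x)\<^sup>2)"
      using integrable[of "\<lambda>x. x\<^sup>2"] integrable_std_normal_distribution_moment[of 2] by simp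
    then have L2: "Y \<in> L2 M" by (intro L2I) (auto simp: YU power_mult_distrib)
    have "expectation (\<lambda>x. (U x)\<^sup>2) = 1"
      using int[of "\<lambda>x. x\<^sup>2"] std_normal_distribution_even_moments(1)[of 1] by (simp add: fact_numeral)
    then have var: "L2_inner M Y Y = \<sigma>\<^sup>2"
      by (simp add: L2_inner_def YU power2_eq_square mult_ac)
    have "expectation (\<lambda>x. cos (Y x + \<theta>)) = cos \<theta> * exp (- \<sigma>\<^sup>2 / 2)" for \<theta>
    proof -
      have "expectation (\<lambda>x. cos (Y x + \<theta>)) = (LINT x|M. cos (\<sigma> * U x) * cos \<theta> - sin (\<sigma> * U x) * sin \<theta>)"
        by (simp add: YU cos_add)
      also have "\<dots> = (LINT x|M. cos (\<sigma> * U x)) * cos \<theta> - (LINT x|M. sin (\<sigma> * U x)) * sin \<theta>"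
        by (subst Bochner_Integration.integral_diff)
          (auto intro!: integrable_bounded_real[of _ 1] mult_le_one simp: abs_mult)
      also have "\<dots> = cos \<theta> * exp (- \<sigma>\<^sup>2 / 2)"
        using int[of "\<lambda>x. cos (\<sigma> * x)"] int[of "\<lambda>x. sin (\<sigma> * x)"] std_normal_cos_sin[of \<sigma>] by simp
      finally show ?thesis .
    qed
    with L2 var show ?thesis by (simp add: gaussian_def)
  qed
qed

lemma expectation_cos_diff_le:
  assumes f: "f \<in> L2 M" and g: "g \<in> L2 M"
  shows "\<bar>expectation (\<lambda>x. cos (f x + \<theta>)) - expectation (\<lambda>x. cos (g x + \<theta>))\<bar> \<le> L2.nrm (f - g)"
proof -
  have [measurable]: "f \<in> borel_measurable M" "g \<in> borel_measurable M" using f g L2_measurable by auto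
  have int: "integrable M (\<lambda>x. f x - g x)"
    by (intro Bochner_Integration.integrable_diff L2_integrable finite_measure_axioms f g)
  have "\<bar>expectation (\<lambda>x. cos (f x + \<theta>)) - expectation (\<lambda>x. cos (g x + \<theta>))\<bar>
      = \<bar>expectation (\<lambda>x. cos (f x + \<theta>) - cos (g x + \<theta>))\<bar>" by simp
  also have "\<dots> \<le> expectation (\<lambda>x. \<bar>cos (f x + \<theta>) - cos (g x + \<theta>)\<bar>)" by (rule integral_abs_bound)
  also have "\<dots> \<le> expectation (\<lambda>x. \<bar>f x - g x\<bar>)"
    using abs_cos_diff_le[of "f _ + \<theta>" "g _ + \<theta>"] int
    by (intro integral_mono integrable_abs) auto
  also have "\<dots> \<le> L2.nrm (f - g)"
    using L2_mean_abs_le[OF prob_space_axioms L2.H_diff[OF f g]] by (simp add: L2.nrm_def)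
  finally show ?thesis .
qed

lemma gaussian_limit:
  assumes f: "f \<in> L2 M" and lim: "\<And>e. e > 0 \<Longrightarrow> \<exists>g. gaussian g \<and> L2.nrm (f - g) < e"
  shows "gaussian f"
  unfolding gaussian_def
proof (intro conjI allI f)
  fix \<theta>
  have "\<exists>g. gaussian g \<and> L2.nrm (f - g) < inverse (real (Suc n))" for n
    by (rule lim) simp
  then obtain g where g: "\<And>n. gaussian (g n)" "\<And>n. L2.nrm (f - g n) < inverse (real (Suc n))" by metis
  note gL2 = g(1)[THEN gaussian_L2]
  have null: "(\<lambda>n. L2.nrm (f - g n)) \<longlonglongrightarrow> 0"
    by (rule tendsto_sandwich[OF _ _ tendsto_const LIMSEQ_inverse_real_of_nat])
      (intro always_eventually allI less_imp_le[OF g(2)] L2.nrm_nonneg)+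
  have "(\<lambda>n. L2.nrm (g n) - L2.nrm f) \<longlonglongrightarrow> 0"
    by (rule Lim_null_comparison[OF _ null])
      (use L2.nrm_diff_bound[OF f gL2] in \<open>auto intro!: always_eventually simp: abs_minus_commute\<close>)
  then have "(\<lambda>n. L2.nrm (g n)) \<longlonglongrightarrow> L2.nrm f" by (simp add: LIM_zero_iff)
  then have "(\<lambda>n. cos \<theta> * exp (- (L2.nrm (g n))\<^sup>2 / 2)) \<longlonglongrightarrow> cos \<theta> * exp (- (L2.nrm f)\<^sup>2 / 2)"
    by (intro tendsto_intros) auto
  moreover have "cos \<theta> * exp (- (L2.nrm (g n))\<^sup>2 / 2) = expectation (\<lambda>x. cos (g n x + \<theta>))" for n
    using gaussian_cos[OF g(1)] by (simp add: L2.nrm_square)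
  moreover have "(\<lambda>n. expectation (\<lambda>x. cos (g n x + \<theta>)) - expectation (\<lambda>x. cos (f x + \<theta>))) \<longlonglongrightarrow> 0"
    by (rule Lim_null_comparison[OF _ null])
      (use expectation_cos_diff_le[OF f gL2] in \<open>auto intro!: always_eventually simp: abs_minus_commute\<close>)
  ultimately show "expectation (\<lambda>x. cos (f x + \<theta>)) = cos \<theta> * exp (- L2_inner M f f / 2)"
    by (simp add: LIM_zero_iff L2.nrm_square LIMSEQ_unique)
qed

lemma gaussian_cspan:
  assumes "\<And>g. g \<in> span F \<Longrightarrow> gaussian g" "f \<in> L2.cspan F"
  shows "gaussian f"
proof (rule gaussian_limit)
  show "f \<in> L2 M" using assms(2) by (simp add: L2.cspan_def)
  fix e :: real assume "e > 0"
  with assms show "\<exists>g. gaussian g \<and> L2.nrm (f - g) < e" unfolding L2.cspan_def by blast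
qed

lemma finite_measure_weight:
  fixes w g :: "'a \<Rightarrow> real"
  assumes [measurable]: "w \<in> borel_measurable M" and w: "\<And>x. 0 \<le> w x" "\<And>x. w x \<le> C"
  shows "finite_measure (density M (\<lambda>x. ennreal (w x)))"
    and "g \<in> borel_measurable M \<Longrightarrow> (LINT x|density M (\<lambda>x. ennreal (w x)). g x) = (LINT x|M. w x * g x)"
    and "A \<in> sets M \<Longrightarrow> measure (density M (\<lambda>x. ennreal (w x))) A = (LINT x|M. w x * indicat_real A x)"
proof -
  have int: "integrable M w" using w by (intro integrable_bounded_real[of _ C]) auto
  then have "emeasure (density M (\<lambda>x. ennreal (w x))) (space M) \<noteq> \<infinity>"
    using w by (simp add: emeasure_density nn_integral_eq_integral)
  then show "finite_measure (density M (\<lambda>x. ennreal (w x)))" by (intro finite_measureI) simp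
  show *: "(LINT x|density M (\<lambda>x. ennreal (w x)). g x) = (LINT x|M. w x * g x)" if "g \<in> borel_measurable M" for g :: "'a \<Rightarrow> real"
    using that w by (simp add: integral_density)
  show "measure (density M (\<lambda>x. ennreal (w x))) A = (LINT x|M. w x * indicat_real A x)" if "A \<in> sets M"
    using *[of "indicat_real A"] that sets.sets_into_space[OF that] by (simp add: Int_absorb2)
qed

lemma null_sets_weight: "w \<in> borel_measurable M \<Longrightarrow> null_sets M \<subseteq> null_sets (density M (\<lambda>x. ennreal (w x)))"
  using absolutely_continuousI_density[of "\<lambda>x. ennreal (w x)" M] by (simp add: absolutely_continuous_def)

text \<open>The weight and its mean are the densities of two finite measures with equal characteristic functions
  on the span, which \<open>cosine_uniqueness\<close> identifies on the generated \<open>\<sigma>\<close>-algebra.\<close>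

lemma weighted_uniqueness:
  assumes F: "F \<subseteq> L2 M"
    and w [measurable]: "w \<in> borel_measurable M" and w': "\<And>x. 0 \<le> w x" "\<And>x. w x \<le> C"
    and eq: "\<And>\<xi> \<theta>. \<xi> \<in> span F \<Longrightarrow>
      expectation (\<lambda>x. w x * cos (\<xi> x + \<theta>)) = expectation w * expectation (\<lambda>x. cos (\<xi> x + \<theta>))"
    and A: "A \<in> sigma_gen F"
  shows "expectation (\<lambda>x. w x * indicat_real A x) = expectation w * prob A"
proof -
  define c where "c = expectation w"
  have c: "0 \<le> c" using w' by (simp add: c_def)
  let ?m1 = "density M (\<lambda>x. ennreal (w x))" and ?m2 = "density M (\<lambda>x. ennreal c)"
  note m1 = finite_measure_weight[of w C, OF w w']
  have m2: "finite_measure ?m2" "\<And>g :: 'a \<Rightarrow> real. g \<in> borel_measurable M \<Longrightarrow> (LINT x|?m2. g x) = (LINT x|M. c * g x)"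
    "A \<in> sets M \<Longrightarrow> measure ?m2 A = (LINT x|M. c * indicat_real A x)"
    using finite_measure_weight[of "\<lambda>_. c" c] c by auto
  have Fm: "F \<subseteq> borel_measurable M" using F L2_measurable by auto
  have AM: "A \<in> sets M" using A sigma_gen_subset[OF Fm] by auto
  have "measure ?m1 A = measure ?m2 A"
  proof (rule cosine_uniqueness[OF m1(1) m2(1), where F = F])
    fix \<xi> \<theta> assume \<xi>: "\<xi> \<in> span F"
    then have [measurable]: "\<xi> \<in> borel_measurable M" using L2.span_subset_H[OF F] L2_measurable by auto
    show "(LINT x|?m1. cos (\<xi> x + \<theta>)) = (LINT x|?m2. cos (\<xi> x + \<theta>))"
      using eq[OF \<xi>, of \<theta>] by (simp add: m1(2) m2(2)) (simp add: c_def)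
  next
    have "{f -` B \<inter> space M | f B. f \<in> F \<and> B \<in> sets borel} \<union> null_sets M \<subseteq>
        {f -` B \<inter> space ?m1 | f B. f \<in> F \<and> B \<in> sets borel} \<union> (null_sets ?m1 \<inter> null_sets ?m2)"
      using null_sets_weight[OF w] null_sets_weight[of "\<lambda>_. c"] by auto
    from sigma_sets_mono'[OF this, of "space M"] A
    show "A \<in> sigma_sets (space ?m1) ({f -` B \<inter> space ?m1 | f B. f \<in> F \<and> B \<in> sets borel} \<union> (null_sets ?m1 \<inter> null_sets ?m2))"
      by (auto simp: sigma_gen_def)
  qed (use Fm in auto)
  then show ?thesis
    using AM sets.sets_into_space[OF AM] unfolding c_def[symmetric] by (simp add: m1(3) m2(3) Int_absorb2)
qed

text \<open>For jointly Gaussian variables orthogonality is independence: the characteristic function of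
  \<open>k + c \<eta>\<close> factorises. The previous lemma is applied with the weight \<open>1 + cos (\<eta> + \<theta>)\<close>.\<close>

lemma orthogonal_imp_independent:
  assumes K: "subspace K" "K \<subseteq> L2 M" and \<eta>: "\<eta> \<in> L2 M"
    and gauss: "\<And>k c. k \<in> K \<Longrightarrow> gaussian (k + c *\<^sub>R \<eta>)"
    and orth: "\<And>k. k \<in> K \<Longrightarrow> L2_inner M \<eta> k = 0"
    and A: "A \<in> sigma_gen K"
  shows "expectation (\<lambda>x. indicat_real A x * cos (\<eta> x + \<theta>)) = prob A * expectation (\<lambda>x. cos (\<eta> x + \<theta>))"
proof -
  define w where "w x = 1 + cos (\<eta> x + \<theta>)" for x
  have [measurable]: "\<eta> \<in> borel_measurable M" using L2_measurable[OF \<eta>] .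
  have w [measurable]: "w \<in> borel_measurable M" unfolding w_def by measurable
  have w_bd: "0 \<le> w x" "w x \<le> 2" for x
    using cos_ge_minus_one[of "\<eta> x + \<theta>"] cos_le_one[of "\<eta> x + \<theta>"] unfolding w_def by linarith+
  define c where "c = exp (- L2_inner M \<eta> \<eta> / 2)"
  have "gaussian (0 + 1 *\<^sub>R \<eta>)" by (rule gauss) (use K subspace_0 in blast)
  then have E\<eta>: "expectation (\<lambda>x. cos (\<eta> x + \<theta>)) = cos \<theta> * c"
    using gaussian_cos by (simp add: c_def)
  have Ew: "expectation w = 1 + cos \<theta> * c"
    using E\<eta> by (simp add: w_def[abs_def] prob_space)
  have "expectation (\<lambda>x. w x * indicat_real A x) = expectation w * prob A"
  proof (rule weighted_uniqueness[OF K(2) w w_bd _ A])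
    fix k \<phi> assume "k \<in> span K"
    then have k: "k \<in> K" using K(1) by (simp add: span_eq_iff[THEN iffD2])
    then have kL: "k \<in> L2 M" using K by auto
    have [measurable]: "k \<in> borel_measurable M" using L2_measurable[OF kL] .
    define b where "b = exp (- L2_inner M k k / 2)"
    have inner: "L2_inner M (k + c *\<^sub>R \<eta>) (k + c *\<^sub>R \<eta>) = L2_inner M k k + c\<^sup>2 * L2_inner M \<eta> \<eta>" for c
      using kL \<eta> orth[OF k] by (simp add: L2.ip_linear L2.ip_commute[of k \<eta>] power2_eq_square)
    have Ek: "expectation (\<lambda>x. cos (k x + \<phi>)) = cos \<phi> * b"
      using gauss[OF k, of 0] gaussian_cos by (simp add: b_def)
    have Ep: "expectation (\<lambda>x. cos ((k + \<eta>) x + \<psi>)) = cos \<psi> * (b * c)" for \<psi>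
      using gaussian_cos[OF gauss[OF k, of 1]] inner[of 1]
      by (simp add: b_def c_def exp_add[symmetric] add_divide_distrib)
    have Em: "expectation (\<lambda>x. cos ((k - \<eta>) x + \<psi>)) = cos \<psi> * (b * c)" for \<psi>
      using gaussian_cos[OF gauss[OF k, of "-1"]] inner[of "-1"]
      by (simp add: b_def c_def exp_add[symmetric] add_divide_distrib)
    have "expectation (\<lambda>x. w x * cos (k x + \<phi>)) =
      expectation (\<lambda>x. cos (k x + \<phi>) + (cos ((k + \<eta>) x + (\<phi> + \<theta>)) + cos ((k - \<eta>) x + (\<phi> - \<theta>))) / 2)"
      using cosine_product[of "k _ + \<phi>" "\<eta> _ + \<theta>"]
      by (intro Bochner_Integration.integral_cong refl) (simp add: w_def algebra_simps)
    also have "\<dots> = expectation (\<lambda>x. cos (k x + \<phi>)) +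
        (expectation (\<lambda>x. cos ((k + \<eta>) x + (\<phi> + \<theta>))) + expectation (\<lambda>x. cos ((k - \<eta>) x + (\<phi> - \<theta>)))) / 2"
      by (simp add: plus_fun_def fun_diff_def)
    also have "\<dots> = cos \<phi> * b + (cos (\<phi> + \<theta>) + cos (\<phi> - \<theta>)) / 2 * (b * c)"
      by (simp only: Ek Ep Em) (simp add: field_simps)
    also have "(cos (\<phi> + \<theta>) + cos (\<phi> - \<theta>)) / 2 = cos \<phi> * cos \<theta>" by (simp add: cosine_product)
    finally show "expectation (\<lambda>x. w x * cos (k x + \<phi>)) = expectation w * expectation (\<lambda>x. cos (k x + \<phi>))"
      unfolding Ew Ek by (simp add: algebra_simps)
  qed
  moreover have "A \<in> sets M" using A sigma_gen_subset[of K] K L2_measurable by blast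
  then have "expectation (\<lambda>x. w x * indicat_real A x) =
      prob A + expectation (\<lambda>x. indicat_real A x * cos (\<eta> x + \<theta>))"
  proof -
    have "expectation (\<lambda>x. w x * indicat_real A x) = expectation (\<lambda>x. indicat_real A x + indicat_real A x * cos (\<eta> x + \<theta>))"
      by (intro Bochner_Integration.integral_cong refl) (simp add: w_def algebra_simps)
    also have "\<dots> = expectation (indicat_real A) + expectation (\<lambda>x. indicat_real A x * cos (\<eta> x + \<theta>))"
      using \<open>A \<in> sets M\<close> by (intro Bochner_Integration.integral_add integrable_bounded_real[of _ 1]) (auto simp: indicator_def)
    finally show ?thesis
      using \<open>A \<in> sets M\<close> sets.sets_into_space[of A M] by (simp add: Int_absorb2)
  qed
  ultimately show ?thesis unfolding Ew E\<eta> by (simp add: algebra_simps)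
qed

text \<open>A zero-one law for decreasing Gaussian spaces. If the intersection \<open>N\<close> of the \<open>K m\<close> is orthogonal to a
Gaussian variable \<open>\<xi>\<close>, then the projection \<open>p m\<close> of \<open>\<xi>\<close> onto \<open>K m\<close> tends to \<open>0\<close>, while \<open>\<xi> - p m\<close> is independent
of the events of \<open>K m\<close>. In the limit a tail event is independent of \<open>\<xi>\<close>, so it is independent of
everything that such variables generate, in particular of itself.\<close>

theorem tail_zero_one:
  assumes F: "F \<subseteq> L2 M" and gauss: "\<And>g. g \<in> span F \<Longrightarrow> gaussian g"
    and K: "\<And>m. L2.closed_sub (K m)" "\<And>m. K (Suc m) \<subseteq> K m" "K 0 \<subseteq> L2.cspan F"
    and trivial: "\<And>f k. f \<in> F \<Longrightarrow> k \<in> (\<Inter>m. K m) \<Longrightarrow> L2_inner M f k = 0"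
    and A: "\<And>m. A \<in> sigma_gen (K m)" "A \<in> sigma_gen F"
  shows "prob A = 0 \<or> prob A = 1"
proof -
  note G = L2.closed_sub_cspan[OF F]
  have KG: "K m \<subseteq> L2.cspan F" for m
    using lift_Suc_antimono_le[of K, OF K(2), of 0 m] K(3) by auto
  have Fm: "F \<subseteq> borel_measurable M" using F L2_measurable by auto
  have AM [measurable]: "A \<in> sets M" using A(2) sigma_gen_subset[OF Fm] by auto
  have N: "L2.closed_sub (\<Inter>m. K m)" using L2.closed_sub_Inter[of UNIV K] K(1) by simp
  have "expectation (\<lambda>x. indicat_real A x * cos (\<xi> x + \<theta>)) = prob A * expectation (\<lambda>x. cos (\<xi> x + \<theta>))"
    if \<xi>: "\<xi> \<in> span F" for \<xi> \<theta>
  proof -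
    have \<xi>L: "\<xi> \<in> L2 M" using \<xi> L2.span_subset_H[OF F] by auto
    have orthN: "L2_inner M \<xi> k = 0" if k: "k \<in> (\<Inter>m. K m)" for k
    proof -
      have kL: "k \<in> L2 M" using L2.closed_subD(3)[OF N k] .
      have "span F \<subseteq> {x \<in> L2 M. L2_inner M x k = 0}"
        by (rule span_minimal) (use F kL trivial[OF _ k] in \<open>auto intro!: subspaceI simp: L2.ip_linear\<close>)
      then show ?thesis using \<xi> by blast
    qed
    define p where "p m = L2.proj (K m) \<xi>" for m
    have pK: "p m \<in> K m" and pL: "p m \<in> L2 M" for m
      using L2.proj_in[OF K(1) \<xi>L] L2.proj_in_H[OF K(1) \<xi>L] by (auto simp: p_def)
    have "L2.nrm (L2.proj (\<Inter>m. K m) \<xi>) = 0"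
      using orthN[OF L2.proj_in[OF N \<xi>L]] L2.ip_proj[OF N \<xi>L L2.proj_in[OF N \<xi>L]]
      by (simp add: L2.nrm_def)
    from L2.proj_decreasing_tendsto_zero[OF K(1,2) \<xi>L this]
    have lim: "(\<lambda>m. L2.nrm (p m)) \<longlonglongrightarrow> 0" by (simp add: p_def)
    have \<xi>m [measurable]: "\<xi> \<in> borel_measurable M" using L2_measurable[OF \<xi>L] .
    have le: "\<bar>expectation (\<lambda>x. indicat_real A x * cos (\<xi> x + \<theta>)) - prob A * expectation (\<lambda>x. cos (\<xi> x + \<theta>))\<bar> \<le> 2 * L2.nrm (p m)" for m
    proof -
      define \<eta> where "\<eta> = \<xi> - p m"
      have \<eta>L: "\<eta> \<in> L2 M" using \<xi>L pL by (simp add: \<eta>_def L2.H_diff)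
      have \<eta>m [measurable]: "\<eta> \<in> borel_measurable M" using L2_measurable[OF \<eta>L] .
      have \<eta>G: "\<eta> \<in> L2.cspan F"
        using L2.span_subset_cspan[OF F] \<xi> pK KG L2.closed_subD(1)[OF G] unfolding \<eta>_def
        by (intro subspace_diff) auto
      have "expectation (\<lambda>x. indicat_real A x * cos (\<eta> x + \<theta>)) = prob A * expectation (\<lambda>x. cos (\<eta> x + \<theta>))"
      proof (rule orthogonal_imp_independent[OF _ _ \<eta>L _ _ A(1)[of m]])
        show "subspace (K m)" "K m \<subseteq> L2 M" using L2.closed_subD[OF K(1)] by auto
        show "gaussian (k + c *\<^sub>R \<eta>)" if "k \<in> K m" for k c
          by (rule gaussian_cspan[OF gauss])
            (use that KG \<eta>G L2.closed_subD(1)[OF G] in \<open>auto intro!: subspace_add subspace_scale\<close>)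
        show "L2_inner M \<eta> k = 0" if "k \<in> K m" for k
          using L2.proj_orth[OF K(1) \<xi>L that] by (simp add: \<eta>_def p_def)
      qed
      moreover have "\<bar>expectation (\<lambda>x. cos (\<xi> x + \<theta>)) - expectation (\<lambda>x. cos (\<eta> x + \<theta>))\<bar> \<le> L2.nrm (p m)"
        using expectation_cos_diff_le[OF \<xi>L \<eta>L, of \<theta>] by (simp add: \<eta>_def)
      then have "prob A * \<bar>expectation (\<lambda>x. cos (\<xi> x + \<theta>)) - expectation (\<lambda>x. cos (\<eta> x + \<theta>))\<bar> \<le> 1 * L2.nrm (p m)"
        by (intro mult_mono) auto
      moreover have "\<bar>expectation (\<lambda>x. indicat_real A x * cos (\<xi> x + \<theta>)) - expectation (\<lambda>x. indicat_real A x * cos (\<eta> x + \<theta>))\<bar> \<le> L2.nrm (p m)"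
      proof -
        have int: "integrable M (\<lambda>x. indicat_real A x * cos (h x + \<theta>))" if [measurable]: "h \<in> borel_measurable M" for h
          by (rule integrable_bounded_real[of _ 1]) (auto simp: indicator_def)
        have "\<bar>expectation (\<lambda>x. indicat_real A x * cos (\<xi> x + \<theta>)) - expectation (\<lambda>x. indicat_real A x * cos (\<eta> x + \<theta>))\<bar>
          = \<bar>expectation (\<lambda>x. indicat_real A x * cos (\<xi> x + \<theta>) - indicat_real A x * cos (\<eta> x + \<theta>))\<bar>"
          by (simp add: int)
        also have "\<dots> \<le> expectation (\<lambda>x. \<bar>indicat_real A x * cos (\<xi> x + \<theta>) - indicat_real A x * cos (\<eta> x + \<theta>)\<bar>)"
          by (rule integral_abs_bound)
        also have "\<dots> \<le> expectation (\<lambda>x. \<bar>p m x\<bar>)"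
        proof (rule integral_mono)
          show "integrable M (\<lambda>x. \<bar>p m x\<bar>)"
            by (intro integrable_abs L2_integrable finite_measure_axioms pL)
          show "integrable M (\<lambda>x. \<bar>indicat_real A x * cos (\<xi> x + \<theta>) - indicat_real A x * cos (\<eta> x + \<theta>)\<bar>)"
            by (intro integrable_abs Bochner_Integration.integrable_diff int) auto
          fix x
          show "\<bar>indicat_real A x * cos (\<xi> x + \<theta>) - indicat_real A x * cos (\<eta> x + \<theta>)\<bar> \<le> \<bar>p m x\<bar>"
            using abs_cos_diff_le[of "\<xi> x + \<theta>" "\<eta> x + \<theta>"] by (auto simp: indicator_def \<eta>_def)
        qed
        also have "\<dots> \<le> L2.nrm (p m)" using L2_mean_abs_le[OF prob_space_axioms pL] by (simp add: L2.nrm_def)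
        finally show ?thesis .
      qed
      moreover have "\<bar>a - P * x\<bar> \<le> 2 * n"
        if "b = P * y" "P * \<bar>x - y\<bar> \<le> 1 * n" "\<bar>a - b\<bar> \<le> n" "0 \<le> P" for a b x y P n :: real
      proof -
        have "a - P * x = (a - b) - P * (x - y)" using that(1) by (simp add: algebra_simps)
        moreover have "\<bar>P * (x - y)\<bar> \<le> n" using that(2,4) by (simp add: abs_mult)
        ultimately show ?thesis using that(3) by linarith
      qed
      ultimately show ?thesis using measure_nonneg by blast
    qed
    have "(\<lambda>m. 2 * L2.nrm (p m)) \<longlonglongrightarrow> 0" using tendsto_mult_right_zero[OF lim] .
    from LIMSEQ_le_const[OF this] le show ?thesis by fastforce
  qed
  then have "expectation (\<lambda>x. indicat_real A x * indicat_real A x) = expectation (indicat_real A) * prob A"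
    using sets.sets_into_space[OF AM]
    by (intro weighted_uniqueness[OF F, where C = 1] A) (auto simp: Int_absorb2)
  moreover have "expectation (\<lambda>x. indicat_real A x * indicat_real A x) = expectation (indicat_real A)"
    by (intro Bochner_Integration.integral_cong refl) (simp add: indicator_def)
  ultimately have "prob A = prob A * prob A"
    using sets.sets_into_space[OF AM] by (simp add: Int_absorb2)
  then show ?thesis by auto
qed

end


section \<open>Koopman operators and the Kolmogorov property\<close>

context prob_space
begin

lemma sigma_gen_mono_cspan:
  assumes "G \<subseteq> L2 M" "F \<subseteq> L2.cspan G"
  shows "sigma_gen F \<subseteq> sigma_gen G"
proof (rule sigma_gen_least)
  show "sigma_algebra (space M) (sigma_gen G)"
    using assms(1) L2_measurable by (intro sigma_algebra_sigma_gen) auto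
qed (use assms null_sets_sigma_gen cspan_measurable in blast)+

lemma sigma_gen_mono: "F \<subseteq> G \<Longrightarrow> sigma_gen F \<subseteq> sigma_gen G"
  unfolding sigma_gen_def by (intro sigma_sets_mono') blast

lemma null_completion_sigma_gen:
  assumes "F \<subseteq> L2 M"
  shows "null_completion M (sigma_gen F) = sigma_gen F"
proof -
  have "sigma_algebra (space M) (sigma_gen F)"
    using assms L2_measurable by (intro sigma_algebra_sigma_gen) auto
  moreover have "sigma_gen F \<union> null_sets M = sigma_gen F" using null_sets_sigma_gen by blast
  ultimately show ?thesis
    unfolding null_completion_def by (simp add: sigma_algebra.sigma_sets_eq)
qed

lemma sigma_rv_eq_sigma_gen: "sigma_rv M f = sigma_gen {f}"
  unfolding sigma_rv_def null_completion_def sigma_gen_def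
  by (rule arg_cong2[where f = sigma_sets]) auto

lemma sigma_join_sigma_gen:
  assumes "\<And>i. i \<in> I \<Longrightarrow> F i \<subseteq> L2 M"
  shows "sigma_join M I (\<lambda>i. sigma_gen (F i)) = sigma_gen (\<Union>i\<in>I. F i)"
proof
  have S: "sigma_algebra (space M) (sigma_gen (\<Union>i\<in>I. F i))"
    using assms L2_measurable by (intro sigma_algebra_sigma_gen) blast
  have "sigma_gen (F i) \<subseteq> sigma_gen (\<Union>i\<in>I. F i)" if "i \<in> I" for i
    using that by (intro sigma_gen_mono) auto
  then show "sigma_join M I (\<lambda>i. sigma_gen (F i)) \<subseteq> sigma_gen (\<Union>i\<in>I. F i)"
    unfolding sigma_join_def null_completion_def
    using null_sets_sigma_gen by (intro sigma_algebra.sigma_sets_subset[OF S]) blast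
  show "sigma_gen (\<Union>i\<in>I. F i) \<subseteq> sigma_join M I (\<lambda>i. sigma_gen (F i))"
    unfolding sigma_join_def null_completion_def
    by (subst sigma_gen_def, rule sigma_sets_mono') (auto simp: sigma_gen_def)
qed

definition measure_preserving :: "('a \<Rightarrow> 'a) \<Rightarrow> bool" where
  "measure_preserving \<phi> \<longleftrightarrow> \<phi> \<in> M \<rightarrow>\<^sub>M M \<and> distr M M \<phi> = M"

lemma measure_preserving_measurable [measurable_dest]: "measure_preserving \<phi> \<Longrightarrow> \<phi> \<in> M \<rightarrow>\<^sub>M M"
  by (simp add: measure_preserving_def)

lemma measure_preserving_AE:
  assumes "measure_preserving \<phi>" "AE x in M. Q x"
  shows "AE x in M. Q (\<phi> x)"
proof -
  have eq: "distr M M \<phi> = M" using assms(1) by (simp add: measure_preserving_def)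
  have "AE x in distr M M \<phi>. Q x" unfolding eq by (rule assms(2))
  from AE_distrD[OF measure_preserving_measurable[OF assms(1)] this] show ?thesis .
qed

lemma measure_preserving_integral:
  fixes f :: "'a \<Rightarrow> real"
  assumes "measure_preserving \<phi>" "f \<in> borel_measurable M"
  shows "(LINT x|M. f (\<phi> x)) = (LINT x|M. f x)"
  using assms integral_distr[of \<phi> M M f] by (simp add: measure_preserving_def)

lemma measure_preserving_L2:
  assumes "measure_preserving \<phi>" "f \<in> L2 M"
  shows "f \<circ> \<phi> \<in> L2 M"
proof (rule L2I)
  note [measurable] = L2_measurable[OF assms(2)] measure_preserving_measurable[OF assms(1)]
  show "f \<circ> \<phi> \<in> borel_measurable M" by measurable
  show "integrable M (\<lambda>x. ((f \<circ> \<phi>) x)\<^sup>2)"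
    using integrable_distr_eq[of \<phi> M M "\<lambda>x. (f x)\<^sup>2"] L2_integrable_square[OF assms(2)] assms(1)
    by (simp add: measure_preserving_def)
qed

lemma measure_preserving_inner:
  assumes "measure_preserving \<phi>" "f \<in> L2 M" "g \<in> L2 M"
  shows "L2_inner M (f \<circ> \<phi>) (g \<circ> \<phi>) = L2_inner M f g"
proof -
  note [measurable] = assms(2,3)[THEN L2_measurable]
  show ?thesis
    using measure_preserving_integral[OF assms(1), of "\<lambda>x. f x * g x"] by (simp add: L2_inner_def)
qed

lemma measure_preserving_id: "measure_preserving (\<lambda>x. x)"
  by (simp add: measure_preserving_def distr_id)

lemma measure_preserving_comp:
  assumes "measure_preserving \<phi>" "measure_preserving \<psi>"
  shows "measure_preserving (\<phi> \<circ> \<psi>)"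
  using assms distr_distr[of \<phi> M M \<psi> M] by (auto simp: measure_preserving_def)

lemma measure_preserving_funpow: "measure_preserving \<phi> \<Longrightarrow> measure_preserving (\<phi> ^^ n)"
  by (induction n) (auto simp: measure_preserving_comp measure_preserving_id[folded id_def])

lemma comp_span:
  fixes F :: "('a \<Rightarrow> real) set"
  assumes "f \<in> span F"
  shows "f \<circ> \<phi> \<in> span ((\<lambda>g. g \<circ> \<phi>) ` F)"
proof -
  have "linear (\<lambda>g :: 'a \<Rightarrow> real. g \<circ> \<phi>)"
    by (rule linearI) (simp_all add: fun_eq_iff)
  from linear_span_image[OF this, of F] assms show ?thesis by blast
qed

lemma comp_cspan:
  assumes \<phi>: "measure_preserving \<phi>" and F: "F \<subseteq> L2 M" and f: "f \<in> L2.cspan F"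
  shows "f \<circ> \<phi> \<in> L2.cspan ((\<lambda>g. g \<circ> \<phi>) ` F)"
  unfolding L2.cspan_def
proof (intro CollectI conjI allI impI)
  have fL: "f \<in> L2 M" using f by (simp add: L2.cspan_def)
  then show "f \<circ> \<phi> \<in> L2 M" by (rule measure_preserving_L2[OF \<phi>])
  fix e :: real assume "e > 0"
  then obtain g where g: "g \<in> span F" "L2.nrm (f - g) < e" using f by (auto simp: L2.cspan_def)
  have gL: "g \<in> L2 M" using g(1) L2.span_subset_H[OF F] by auto
  have "(f \<circ> \<phi>) - (g \<circ> \<phi>) = (f - g) \<circ> \<phi>" by (simp add: fun_eq_iff)
  then have "L2.nrm ((f \<circ> \<phi>) - (g \<circ> \<phi>)) = L2.nrm (f - g)"
    using measure_preserving_inner[OF \<phi> L2.H_diff[OF fL gL] L2.H_diff[OF fL gL]] by (simp add: L2.nrm_def)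
  then show "\<exists>y\<in>span ((\<lambda>g. g \<circ> \<phi>) ` F). L2.nrm ((f \<circ> \<phi>) - y) < e"
    using g(2) comp_span[OF g(1), of \<phi>] by (intro bexI[of _ "g \<circ> \<phi>"]) (simp_all only:)
qed

lemma L2_closed_sub_cong_AE:
  assumes "L2.closed_sub S" "f \<in> S" "g \<in> borel_measurable M" "AE x in M. f x = g x"
  shows "g \<in> S"
proof (rule L2.closed_sub_congruent[OF assms(1,2)])
  have f: "f \<in> L2 M" using L2.closed_subD(3)[OF assms(1,2)] .
  show g: "g \<in> L2 M" by (rule L2_cong_AE[OF f assms(3,4)])
  show "L2.nrm (g - f) = 0"
    using L2_nrm_zero_iff[OF L2.H_diff[OF g f]] assms(4) by auto
qed

lemma sigma_action_sigma_gen: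
  assumes \<phi>: "measure_preserving (iterate Z Zi m)" and F: "F \<subseteq> L2 M"
  shows "sigma_action M Z Zi m (sigma_gen F) = sigma_gen ((\<lambda>f. f \<circ> iterate Z Zi m) ` F)"
proof -
  define \<phi> where "\<phi> = iterate Z Zi m"
  have mp: "measure_preserving \<phi>" using \<phi> by (simp add: \<phi>_def)
  note [measurable] = measure_preserving_measurable[OF mp]
  have sp: "\<phi> x \<in> space M" if "x \<in> space M" for x using measurable_space[OF measure_preserving_measurable[OF mp] that] .
  have FL: "(\<lambda>f. f \<circ> \<phi>) ` F \<subseteq> L2 M" using F measure_preserving_L2[OF mp] by auto
  interpret S: sigma_algebra "space M" "sigma_gen ((\<lambda>f. f \<circ> \<phi>) ` F)"
    using FL L2_measurable by (intro sigma_algebra_sigma_gen) auto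
  have pre: "\<phi> -` B \<inter> space M \<in> sigma_gen ((\<lambda>f. f \<circ> \<phi>) ` F)" if "B \<in> sigma_gen F" for B
    using that unfolding sigma_gen_def[of F]
  proof (induction rule: sigma_sets.induct)
    case (Basic B)
    then show ?case
    proof
      assume "B \<in> null_sets M"
      then have "\<phi> -` B \<inter> space M \<in> null_sets M"
        using mp null_sets_distr_iff[of \<phi> M M B] by (simp add: measure_preserving_def)
      then show ?thesis using null_sets_sigma_gen by blast
    next
      assume "B \<in> {f -` B \<inter> space M |f B. f \<in> F \<and> B \<in> sets borel}"
      then obtain f C where fC: "B = f -` C \<inter> space M" "f \<in> F" "C \<in> sets borel" by blast
      then have "\<phi> -` B \<inter> space M = (f \<circ> \<phi>) -` C \<inter> space M" using sp by auto
      then show ?thesis using fC unfolding sigma_gen_def by (intro sigma_sets.Basic) blast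
    qed
  next
    case (Compl B)
    have "\<phi> -` (space M - B) \<inter> space M = space M - (\<phi> -` B \<inter> space M)" using sp by auto
    then show ?case using S.compl_sets[OF Compl.IH] by (simp only:)
  next
    case (Union B)
    have "\<phi> -` (\<Union>i. B i) \<inter> space M = (\<Union>i. \<phi> -` B i \<inter> space M)" by auto
    moreover have "(\<Union>i. \<phi> -` B i \<inter> space M) \<in> sigma_gen ((\<lambda>f. f \<circ> \<phi>) ` F)"
      by (rule S.countable_nat_UN) (use Union.IH in blast)
    ultimately show ?case by (simp only:)
  qed (simp only: vimage_empty Int_empty_left S.empty_sets)
  have "sigma_action M Z Zi m (sigma_gen F) \<subseteq> sigma_gen ((\<lambda>f. f \<circ> \<phi>) ` F)"
    unfolding sigma_action_def null_completion_def \<phi>_def[symmetric]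
    using pre null_sets_sigma_gen by (intro S.sigma_sets_subset) blast
  moreover have "sigma_gen ((\<lambda>f. f \<circ> \<phi>) ` F) \<subseteq> sigma_action M Z Zi m (sigma_gen F)"
    unfolding sigma_action_def null_completion_def \<phi>_def[symmetric]
    apply (subst sigma_gen_def)
  proof (rule sigma_sets_mono', safe)
    fix f and C :: "real set" assume f: "f \<in> F" and C: "C \<in> sets borel"
      and no: "(f \<circ> \<phi>) -` C \<inter> space M \<notin> null_sets M"
    have "(f \<circ> \<phi>) -` C \<inter> space M = \<phi> -` (f -` C \<inter> space M) \<inter> space M" using sp by auto
    moreover have "f -` C \<inter> space M \<in> sigma_gen F"
      using f C unfolding sigma_gen_def by (intro sigma_sets.Basic) blast
    ultimately show "\<exists>B. (f \<circ> \<phi>) -` C \<inter> space M = \<phi> -` B \<inter> space M \<and> B \<in> sigma_gen F" by blast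
  qed
  ultimately show ?thesis by (simp add: \<phi>_def)
qed

end

locale measure_automorphism = prob_space M for M :: "'a measure" +
  fixes Z Zi :: "'a \<Rightarrow> 'a"
  assumes aut: "automorphism M Z Zi"
begin

lemma Z_mp: "measure_preserving Z" and Zi_mp: "measure_preserving Zi"
  using aut by (auto simp: automorphism_def measure_preserving_def)

lemma Zi_Z: "AE \<omega> in M. Zi (Z \<omega>) = \<omega>" and Z_Zi: "AE \<omega> in M. Z (Zi \<omega>) = \<omega>"
  using aut by (auto simp: automorphism_def)

lemma iterate_mp: "measure_preserving (iterate Z Zi n)"
  by (simp add: iterate_def measure_preserving_funpow Z_mp Zi_mp)

lemma inner_shift:
  assumes f: "f \<in> L2 M" and g: "g \<in> L2 M"
  shows "L2_inner M (f \<circ> Z) g = L2_inner M f (g \<circ> Zi)"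
proof -
  note [measurable] = f[THEN L2_measurable] g[THEN L2_measurable]
    measure_preserving_measurable[OF Z_mp] measure_preserving_measurable[OF Zi_mp]
  have "L2_inner M f (g \<circ> Zi) = L2_inner M (f \<circ> Z) ((g \<circ> Zi) \<circ> Z)"
    by (rule measure_preserving_inner[OF Z_mp f measure_preserving_L2[OF Zi_mp g], symmetric])
  also have "\<dots> = L2_inner M (f \<circ> Z) g"
    by (rule L2_inner_cong_AE) (use Zi_Z in auto)
  finally show ?thesis ..
qed

lemma inner_shift_funpow:
  assumes f: "f \<in> L2 M" and g: "g \<in> L2 M"
  shows "L2_inner M (f \<circ> (Z ^^ n)) g = L2_inner M f (g \<circ> (Zi ^^ n))"
  using g
proof (induction n arbitrary: g)
  case (Suc n)
  have 1: "f \<circ> (Z ^^ Suc n) = (f \<circ> (Z ^^ n)) \<circ> Z" and 2: "g \<circ> (Zi ^^ Suc n) = (g \<circ> Zi) \<circ> (Zi ^^ n)"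
    by (auto simp: fun_eq_iff funpow_swap1)
  show ?case
    unfolding 1 2
    by (rule trans[OF inner_shift[OF measure_preserving_L2[OF measure_preserving_funpow[OF Z_mp] f] Suc.prems]
      Suc.IH[OF measure_preserving_L2[OF Zi_mp Suc.prems]]])
qed simp

lemma iterate_Z_AE: "AE \<omega> in M. iterate Z Zi n (Z \<omega>) = iterate Z Zi (n + 1) \<omega>"
proof (cases "n \<ge> 0")
  case True
  then have "iterate Z Zi n (Z \<omega>) = iterate Z Zi (n + 1) \<omega>" for \<omega>
    by (simp add: iterate_def nat_add_distrib funpow_swap1)
  then show ?thesis by simp
next
  case False
  define k where "k = nat (- n - 1)"
  have n: "n = - int (Suc k)" "n + 1 = - int k" using False by (simp_all add: k_def)
  have "iterate Z Zi n (Z \<omega>) = (Zi ^^ k) (Zi (Z \<omega>))" for \<omega>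
    unfolding n(1) by (simp add: iterate_def funpow_swap1 del: of_nat_Suc)
  moreover have "iterate Z Zi (n + 1) \<omega> = (Zi ^^ k) \<omega>" for \<omega>
    unfolding n(2) by (cases "k = 0") (simp_all add: iterate_def)
  ultimately show ?thesis using Zi_Z by auto
qed

lemma iterate_Zi_AE: "AE \<omega> in M. iterate Z Zi n (Zi \<omega>) = iterate Z Zi (n - 1) \<omega>"
proof -
  have "AE \<omega> in M. iterate Z Zi (n - 1) (Z (Zi \<omega>)) = iterate Z Zi n (Zi \<omega>)"
    using measure_preserving_AE[OF Zi_mp iterate_Z_AE[of "n - 1"]] by simp
  with Z_Zi show ?thesis by eventually_elim simp
qed

lemma swapped: "measure_automorphism M Zi Z"
  by unfold_locales (use aut in \<open>auto simp: automorphism_def\<close>)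

text \<open>Composition with \<open>Z\<close> undoes one of the \<open>Suc m\<close> compositions with \<open>Zi\<close>.
The composition \<open>Zi \<circ> Z\<close> is the identity only almost everywhere, so this uses that closed
subspaces do not distinguish almost equal functions.\<close>

lemma cspan_shift_back:
  assumes F: "F \<subseteq> L2 M" and h: "h \<in> L2.cspan ((\<lambda>f. f \<circ> (Zi ^^ Suc m)) ` F)"
  shows "h \<circ> Z \<in> L2.cspan ((\<lambda>f. f \<circ> (Zi ^^ m)) ` F)"
proof -
  have mpm: "measure_preserving (Zi ^^ m)" for m by (rule measure_preserving_funpow[OF Zi_mp])
  have L: "(\<lambda>f. f \<circ> (Zi ^^ m)) ` F \<subseteq> L2 M" for m
    using F measure_preserving_L2[OF mpm] by auto
  have "h \<circ> Z \<in> L2.cspan ((\<lambda>f. f \<circ> Z) ` ((\<lambda>f. f \<circ> (Zi ^^ Suc m)) ` F))"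
    by (rule comp_cspan[OF Z_mp L h])
  moreover have "(\<lambda>f. f \<circ> Z) ` ((\<lambda>f. f \<circ> (Zi ^^ Suc m)) ` F) \<subseteq> L2.cspan ((\<lambda>f. f \<circ> (Zi ^^ m)) ` F)"
  proof safe
    fix f assume f: "f \<in> F"
    show "f \<circ> (Zi ^^ Suc m) \<circ> Z \<in> L2.cspan ((\<lambda>f. f \<circ> (Zi ^^ m)) ` F)"
    proof (rule L2_closed_sub_cong_AE[OF L2.closed_sub_cspan[OF L]])
      show "f \<circ> (Zi ^^ m) \<in> L2.cspan ((\<lambda>f. f \<circ> (Zi ^^ m)) ` F)"
        using f L2.cspan_superset[OF L, of m] by auto
      show "f \<circ> (Zi ^^ Suc m) \<circ> Z \<in> borel_measurable M"
        using f F measure_preserving_L2[OF Z_mp measure_preserving_L2[OF mpm, of f "Suc m"]] L2_measurable by auto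
      show "AE x in M. (f \<circ> (Zi ^^ m)) x = (f \<circ> (Zi ^^ Suc m) \<circ> Z) x"
        using Zi_Z by eventually_elim (simp add: funpow_swap1[of Zi m, symmetric] funpow_swap1)
    qed
  qed
  ultimately show ?thesis using L2.cspan_minimal[OF _ L2.closed_sub_cspan[OF L]] by blast
qed

text \<open>A closed subspace that is invariant under \<open>Z\<close> and under its inverse reduces the unitary operator
  \<open>f \<mapsto> f \<circ> Z\<close>; so its projection commutes with the operator, and the quadratic form of
  the projection is invariant.\<close>

lemma proj_invariant:
  assumes N: "L2.closed_sub N" and inv: "\<And>h. h \<in> N \<Longrightarrow> h \<circ> Z \<in> N" "\<And>h. h \<in> N \<Longrightarrow> h \<circ> Zi \<in> N"
    and x: "x \<in> L2 M"
  shows "L2_inner M (L2.proj N (x \<circ> Z)) (x \<circ> Z) = L2_inner M (L2.proj N x) x"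
proof -
  define p where "p = L2.proj N x"
  have p: "p \<in> N" "p \<in> L2 M" using L2.proj_in[OF N x] L2.proj_in_H[OF N x] by (auto simp: p_def)
  have xZ: "x \<circ> Z \<in> L2 M" by (rule measure_preserving_L2[OF Z_mp x])
  define p' where "p' = L2.proj N (x \<circ> Z)"
  have p': "p' \<in> N" "p' \<in> L2 M" using L2.proj_in[OF N xZ] L2.proj_in_H[OF N xZ] by (auto simp: p'_def)
  have pZ: "p \<circ> Z \<in> N" "p \<circ> Z \<in> L2 M" using inv(1)[OF p(1)] measure_preserving_L2[OF Z_mp p(2)] by auto
  have "L2_inner M p' (x \<circ> Z) = L2_inner M (x \<circ> Z) p'" by (rule L2.ip_commute)
  also have "\<dots> = L2_inner M x (p' \<circ> Zi)" by (rule inner_shift[OF x p'(2)])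
  also have "\<dots> = L2_inner M p (p' \<circ> Zi)"
    using L2.ip_proj[OF N x inv(2)[OF p'(1)]] by (simp add: p_def)
  also have "\<dots> = L2_inner M (p \<circ> Z) p'" by (rule inner_shift[OF p(2) p'(2), symmetric])
  also have "\<dots> = L2_inner M (p \<circ> Z) (x \<circ> Z)"
    using L2.ip_proj[OF N xZ pZ(1)] L2.ip_commute by (simp add: p'_def)
  also have "\<dots> = L2_inner M p x" by (rule measure_preserving_inner[OF Z_mp p(2) x])
  finally show ?thesis by (simp add: p_def p'_def)
qed

lemma prob_zero_one_null_completion:
  assumes "A \<in> sets M" "prob A = 0 \<or> prob A = 1"
  shows "A \<in> null_completion M {{}, space M}"
  using assms(2)
proof
  assume "prob A = 0"
  then have "A \<in> null_sets M" using assms(1) by (intro null_setsI) (simp_all add: emeasure_eq_measure)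
  then show ?thesis unfolding null_completion_def by auto
next
  assume "prob A = 1"
  then have "space M - A \<in> null_sets M"
    using assms(1) prob_compl[of A] by (intro null_setsI) (simp_all add: emeasure_eq_measure)
  then have "space M - A \<in> null_completion M {{}, space M}" unfolding null_completion_def by auto
  then have "space M - (space M - A) \<in> null_completion M {{}, space M}"
    unfolding null_completion_def by (rule sigma_sets.Compl)
  then show ?thesis using sets.sets_into_space[OF assms(1)] by (simp add: Diff_Diff_Int Int_absorb1)
qed

text \<open>For a Gaussian coordinate family \<open>G\<close> and a generating family \<open>F\<close> of the \<open>\<sigma>\<close>-algebra, the three parts of the
Kolmogorov property become Hilbert space statements: invariance of the closed span of \<open>F\<close>, totality of
the orbit of \<open>F\<close>, and orthogonality of \<open>G\<close> to the intersection of the shifted closed spans.\<close>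

theorem kolmogorov_if_gaussian:
  assumes F: "F \<subseteq> L2 M" and G: "G \<subseteq> L2 M" and sets_G: "sets M \<subseteq> sigma_gen G"
    and gauss: "\<And>g. g \<in> span G \<Longrightarrow> gaussian g" and FG: "F \<subseteq> L2.cspan G"
    and shift: "\<And>f. f \<in> F \<Longrightarrow> f \<circ> Zi \<in> L2.cspan F"
    and total: "G \<subseteq> L2.cspan (\<Union>n. (\<lambda>f. f \<circ> iterate Z Zi n) ` F)"
    and tail: "\<And>g k. g \<in> G \<Longrightarrow> k \<in> (\<Inter>m. L2.cspan ((\<lambda>f. f \<circ> (Zi ^^ m)) ` F)) \<Longrightarrow> L2_inner M g k = 0"
  shows "kolmogorov_automorphism M Z Zi (sigma_gen F)"
  unfolding kolmogorov_automorphism_def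
proof (intro conjI)
  have Fm: "F \<subseteq> borel_measurable M" using F L2_measurable by auto
  have FZ: "(\<lambda>f. f \<circ> iterate Z Zi n) ` F \<subseteq> L2 M" for n
    using F measure_preserving_L2[OF iterate_mp] by auto
  note act = sigma_action_sigma_gen[OF iterate_mp F]
  show "automorphism M Z Zi" by (fact aut)
  show "sigma_algebra (space M) (sigma_gen F)" by (rule sigma_algebra_sigma_gen[OF Fm])
  show "sigma_gen F \<subseteq> sets M" by (rule sigma_gen_subset[OF Fm])
  have iter1: "iterate Z Zi (- 1) = Zi" by (simp add: iterate_def fun_eq_iff)
  show "sigma_action M Z Zi (- 1) (sigma_gen F) \<subseteq> null_completion M (sigma_gen F)"
    unfolding act null_completion_sigma_gen[OF F] iter1
    using shift by (intro sigma_gen_mono_cspan[OF F]) auto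
  show "sigma_join M UNIV (\<lambda>m. sigma_action M Z Zi m (sigma_gen F)) = sets M"
    unfolding act
  proof (subst sigma_join_sigma_gen)
    have UL: "(\<Union>n. (\<lambda>f. f \<circ> iterate Z Zi n) ` F) \<subseteq> L2 M" using FZ by blast
    then have "sigma_gen (\<Union>n. (\<lambda>f. f \<circ> iterate Z Zi n) ` F) \<subseteq> sets M"
      using L2_measurable by (intro sigma_gen_subset) blast
    moreover have "sets M \<subseteq> sigma_gen (\<Union>n. (\<lambda>f. f \<circ> iterate Z Zi n) ` F)"
      using sets_G sigma_gen_mono_cspan[OF UL total] by blast
    ultimately show "sigma_gen (\<Union>n. (\<lambda>f. f \<circ> iterate Z Zi n) ` F) = sets M" by blast
  qed (use FZ in auto)
  have iterm: "iterate Z Zi (- int m) = Zi ^^ m" for m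
    by (cases "m = 0") (simp_all add: iterate_def fun_eq_iff)
  define K where "K m = L2.cspan ((\<lambda>f. f \<circ> (Zi ^^ m)) ` F)" for m
  have L: "(\<lambda>f. f \<circ> (Zi ^^ m)) ` F \<subseteq> L2 M" for m
    using FZ[of "- int m"] by (simp add: iterm)
  have K: "L2.closed_sub (K m)" for m unfolding K_def by (rule L2.closed_sub_cspan[OF L])
  have K_sub: "(\<lambda>f. f \<circ> (Zi ^^ m)) ` F \<subseteq> K m" for m unfolding K_def by (rule L2.cspan_superset[OF L])
  have dec: "K (Suc m) \<subseteq> K m" for m
    unfolding K_def[of "Suc m"]
  proof (rule L2.cspan_minimal[OF _ K], safe)
    fix f assume "f \<in> F"
    from comp_cspan[OF measure_preserving_funpow[OF Zi_mp] F shift[OF this], of m]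
    show "f \<circ> (Zi ^^ Suc m) \<in> K m" unfolding K_def by (simp add: comp_assoc)
  qed
  show "(\<Inter>m. sigma_action M Z Zi (- int m) (sigma_gen F)) = null_completion M {{}, space M}"
  proof
    show "(\<Inter>m. sigma_action M Z Zi (- int m) (sigma_gen F)) \<subseteq> null_completion M {{}, space M}"
    proof
      fix A assume A: "A \<in> (\<Inter>m. sigma_action M Z Zi (- int m) (sigma_gen F))"
      then have A': "A \<in> sigma_gen ((\<lambda>f. f \<circ> (Zi ^^ m)) ` F)" for m
        unfolding act iterm by blast
      then have AM: "A \<in> sets M"
        using sigma_gen_subset[of "(\<lambda>f. f \<circ> (Zi ^^ 0)) ` F"] L[of 0] L2_measurable by blast
      have "prob A = 0 \<or> prob A = 1"
      proof (rule tail_zero_one[OF G gauss, where K = K])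
        show "K 0 \<subseteq> L2.cspan G"
          unfolding K_def using FG by (intro L2.cspan_minimal L2.closed_sub_cspan[OF G]) auto
        show "L2_inner M f k = 0" if "f \<in> G" "k \<in> (\<Inter>m. K m)" for f k
          using tail[OF that(1)] that(2) by (simp add: K_def)
        show "A \<in> sigma_gen (K m)" for m using A' sigma_gen_mono[OF K_sub] by blast
        show "A \<in> sigma_gen G" using AM sets_G by blast
        show "L2.closed_sub (K m)" "K (Suc m) \<subseteq> K m" for m by (fact K dec)+
      qed
      then show "A \<in> null_completion M {{}, space M}" by (rule prob_zero_one_null_completion[OF AM])
    qed
    show "null_completion M {{}, space M} \<subseteq> (\<Inter>m. sigma_action M Z Zi (- int m) (sigma_gen F))"
    proof
      fix A assume A: "A \<in> null_completion M {{}, space M}"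
      have "A \<in> sigma_gen ((\<lambda>f. f \<circ> (Zi ^^ m)) ` F)" for m
      proof -
        interpret S: sigma_algebra "space M" "sigma_gen ((\<lambda>f. f \<circ> (Zi ^^ m)) ` F)"
          using L L2_measurable by (intro sigma_algebra_sigma_gen) blast
        have "null_completion M {{}, space M} \<subseteq> sigma_gen ((\<lambda>f. f \<circ> (Zi ^^ m)) ` F)"
          unfolding null_completion_def using null_sets_sigma_gen
          by (intro S.sigma_sets_subset) auto
        with A show ?thesis by blast
      qed
      then show "A \<in> (\<Inter>m. sigma_action M Z Zi (- int m) (sigma_gen F))"
        unfolding act iterm by blast
    qed
  qed
qed

lemma tail_subspace_invariant:
  assumes F: "F \<subseteq> L2 M" and shift: "\<And>f. f \<in> F \<Longrightarrow> f \<circ> Zi \<in> L2.cspan F"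
    and h: "h \<in> (\<Inter>m. L2.cspan ((\<lambda>f. f \<circ> (Zi ^^ m)) ` F))"
  shows "h \<circ> Z \<in> (\<Inter>m. L2.cspan ((\<lambda>f. f \<circ> (Zi ^^ m)) ` F))"
    and "h \<circ> Zi \<in> (\<Inter>m. L2.cspan ((\<lambda>f. f \<circ> (Zi ^^ m)) ` F))"
proof -
  have L: "(\<lambda>f. f \<circ> (Zi ^^ m)) ` F \<subseteq> L2 M" for m
    using F measure_preserving_L2[OF measure_preserving_funpow[OF Zi_mp]] by auto
  show "h \<circ> Z \<in> (\<Inter>m. L2.cspan ((\<lambda>f. f \<circ> (Zi ^^ m)) ` F))"
    using h cspan_shift_back[OF F] by blast
  show "h \<circ> Zi \<in> (\<Inter>m. L2.cspan ((\<lambda>f. f \<circ> (Zi ^^ m)) ` F))"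
  proof
    fix m
    have "h \<circ> Zi \<in> L2.cspan ((\<lambda>f. f \<circ> Zi) ` (\<lambda>f. f \<circ> (Zi ^^ m)) ` F)"
      using h by (intro comp_cspan[OF Zi_mp L]) auto
    moreover have "(\<lambda>f. f \<circ> Zi) ` (\<lambda>f. f \<circ> (Zi ^^ m)) ` F \<subseteq> L2.cspan ((\<lambda>f. f \<circ> (Zi ^^ m)) ` F)"
    proof safe
      fix f assume "f \<in> F"
      have "f \<circ> (Zi ^^ m) \<circ> Zi = (f \<circ> Zi) \<circ> (Zi ^^ m)" by (simp add: fun_eq_iff funpow_swap1)
      then show "f \<circ> (Zi ^^ m) \<circ> Zi \<in> L2.cspan ((\<lambda>f. f \<circ> (Zi ^^ m)) ` F)"
        using comp_cspan[OF measure_preserving_funpow[OF Zi_mp] F shift[OF \<open>f \<in> F\<close>]] by simp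
    qed
    ultimately show "h \<circ> Zi \<in> L2.cspan ((\<lambda>f. f \<circ> (Zi ^^ m)) ` F)"
      using L2.cspan_minimal[OF _ L2.closed_sub_cspan[OF L]] by blast
  qed
qed

end


section \<open>The coordinate process and its transformations\<close>

lemma span_image_sum:
  fixes f :: "'i \<Rightarrow> 'v::real_vector"
  assumes "x \<in> span (f ` A)"
  obtains F c where "finite F" "F \<subseteq> A" "x = (\<Sum>t\<in>F. c t *\<^sub>R f t)"
proof -
  obtain S r where S: "finite S" "S \<subseteq> f ` A" "x = (\<Sum>v\<in>S. r v *\<^sub>R v)"
    using assms by (auto simp: span_explicit)
  then obtain F where F: "F \<subseteq> A" "inj_on f F" "S = f ` F" by (auto simp: subset_image_inj)
  have "finite F" using S(1) F by (simp add: finite_image_iff)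
  moreover have "x = (\<Sum>t\<in>F. r (f t) *\<^sub>R f t)" using S(3) F by (simp add: sum.reindex)
  ultimately show ?thesis using F(1) that[of F "\<lambda>t. r (f t)"] by blast
qed

lemma (in semi_inner) ip_sum_sum:
  assumes "\<And>s. s \<in> F \<Longrightarrow> X s \<in> H" "\<And>t. t \<in> G \<Longrightarrow> Y t \<in> H"
  shows "ip (\<Sum>s\<in>F. c s *\<^sub>R X s) (\<Sum>t\<in>G. d t *\<^sub>R Y t) = (\<Sum>s\<in>F. \<Sum>t\<in>G. c s * d t * ip (X s) (Y t))"
proof -
  have Y: "(\<Sum>t\<in>G. d t *\<^sub>R Y t) \<in> H" using assms(2) by (intro subspace_sum[OF subspace_H]) auto
  have "ip (\<Sum>s\<in>F. c s *\<^sub>R X s) (\<Sum>t\<in>G. d t *\<^sub>R Y t) = (\<Sum>s\<in>F. c s * ip (\<Sum>t\<in>G. d t *\<^sub>R Y t) (X s))"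
    using assms(1) Y by (subst ip_sum_left) (auto simp: ip_scale_left ip_commute[of "X _"] intro!: sum.cong)
  also have "\<dots> = (\<Sum>s\<in>F. \<Sum>t\<in>G. c s * d t * ip (X s) (Y t))"
  proof (rule sum.cong[OF refl])
    fix s assume s: "s \<in> F"
    have "ip (\<Sum>t\<in>G. d t *\<^sub>R Y t) (X s) = (\<Sum>t\<in>G. d t * ip (Y t) (X s))"
      using assms s by (subst ip_sum_left) (auto simp: ip_scale_left intro!: sum.cong)
    then show "c s * ip (\<Sum>t\<in>G. d t *\<^sub>R Y t) (X s) = (\<Sum>t\<in>G. c s * d t * ip (X s) (Y t))"
      by (simp add: sum_distrib_left mult_ac ip_commute[of "X s"])
  qed
  finally show ?thesis .
qed

context prob_space
begin

lemma L2_limit: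
  assumes lim: "((\<lambda>b. l2_dist2 M (J b) Y) \<longlongrightarrow> 0) F" and ev: "\<forall>\<^sub>F b in F. J b \<in> L2 M"
    and F: "F \<noteq> bot" and Y: "Y \<in> borel_measurable M"
  shows "Y \<in> L2 M" "((\<lambda>b. L2.nrm (J b - Y)) \<longlongrightarrow> 0) F"
    "y \<in> L2 M \<Longrightarrow> ((\<lambda>b. L2_inner M (J b) y) \<longlongrightarrow> L2_inner M Y y) F"
    "L2.closed_sub S \<Longrightarrow> (\<forall>\<^sub>F b in F. J b \<in> S) \<Longrightarrow> Y \<in> S"
proof -
  have "\<forall>\<^sub>F b in F. l2_dist2 M (J b) Y < 1" using lim by (rule order_tendstoD) simp
  with ev have "\<forall>\<^sub>F b in F. J b \<in> L2 M \<and> l2_dist2 M (J b) Y < 1" by eventually_elim simp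
  then obtain b where b: "J b \<in> L2 M" "l2_dist2 M (J b) Y < 1" using eventually_happens[of _ F] F by blast
  then show YL: "Y \<in> L2 M"
    using L2_if_l2_dist2_finite[OF b(1) Y] order.strict_trans[OF b(2) ennreal_one_less_top] by simp
  show *: "((\<lambda>b. L2.nrm (J b - Y)) \<longlongrightarrow> 0) F"
  proof (rule tendstoI)
    fix e :: real assume e: "e > 0"
    then have "\<forall>\<^sub>F b in F. l2_dist2 M (J b) Y < ennreal (e\<^sup>2)" using lim by (intro order_tendstoD) auto
    with ev show "\<forall>\<^sub>F b in F. dist (L2.nrm (J b - Y)) 0 < e"
    proof eventually_elim
      case (elim b)
      then have "(L2.nrm (J b - Y))\<^sup>2 < e\<^sup>2" using YL by (simp add: l2_dist2_eq ennreal_less_iff)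
      then show ?case using e by (simp add: power_less_imp_less_base)
    qed
  qed
  show "((\<lambda>b. L2_inner M (J b) y) \<longlongrightarrow> L2_inner M Y y) F" if y: "y \<in> L2 M"
  proof -
    have "((\<lambda>b. L2_inner M (J b) y - L2_inner M Y y) \<longlongrightarrow> 0) F"
    proof (rule Lim_null_comparison[where g = "\<lambda>b. L2.nrm (J b - Y) * L2.nrm y"])
      show "\<forall>\<^sub>F b in F. norm (L2_inner M (J b) y - L2_inner M Y y) \<le> L2.nrm (J b - Y) * L2.nrm y"
        using ev
      proof eventually_elim
        case (elim b)
        then show ?case
          using L2.Cauchy_Schwarz[OF L2.H_diff[OF elim YL] y] YL y by (simp add: L2.ip_linear)
      qed
      show "((\<lambda>b. L2.nrm (J b - Y) * L2.nrm y) \<longlongrightarrow> 0) F" by (rule tendsto_mult_left_zero[OF *])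
    qed
    then show ?thesis by (simp add: LIM_zero_iff)
  qed
  show "Y \<in> S" if S: "L2.closed_sub S" and evS: "\<forall>\<^sub>F b in F. J b \<in> S"
  proof (rule L2.closed_subD(4)[OF S YL])
    fix e :: real assume "e > 0"
    then have "\<forall>\<^sub>F b in F. L2.nrm (J b - Y) < e" using * by (intro order_tendstoD)
    with evS have "\<forall>\<^sub>F b in F. J b \<in> S \<and> L2.nrm (J b - Y) < e" by eventually_elim simp
    then obtain b where "J b \<in> S" "L2.nrm (J b - Y) < e" using eventually_happens[of _ F] F by blast
    then show "\<exists>y\<in>S. L2.nrm (Y - y) < e"
      using L2.nrm_diff_commute[OF YL L2.closed_subD(3)[OF S]] by (intro bexI[of _ "J b"]) simp_all
  qed
qed

text \<open>The gauge formulation of the mean-square Riemann integral turns, by testing against \<open>y\<close>, directly into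
the gauge definition of the integral of a real function.\<close>

lemma ms_riemann_integral_L2:
  assumes int: "ms_riemann_integral M f a b Y" and f: "\<And>s. s \<in> {a..b} \<Longrightarrow> f s \<in> L2 M"
  shows "Y \<in> L2 M" "Y \<in> L2.cspan (f ` {a..b})"
    "y \<in> L2 M \<Longrightarrow> ((\<lambda>s. L2_inner M (f s) y) has_integral L2_inner M Y y) {a..b}"
proof -
  define S where "S p = (\<Sum>(s, K)\<in>p. measure lborel K *\<^sub>R f s)" for p :: "(real \<times> real set) set"
  have S_eq: "(\<lambda>\<omega>. \<Sum>(s, K)\<in>p. measure lborel K * f s \<omega>) = S p" for p
    unfolding S_def by (auto simp: fun_eq_iff sum_fun_apply case_prod_unfold)
  have Ym: "Y \<in> borel_measurable M" using int by (simp add: ms_riemann_integral_def)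
  have tag: "s \<in> {a..b}" if "p tagged_division_of {a..b}" "(s, K) \<in> p" for p s K
    using tagged_division_ofD(2,3)[OF that(1,2)] by auto
  have S_span: "S p \<in> span (f ` {a..b})" if p: "p tagged_division_of {a..b}" for p
    unfolding S_def using tag[OF p]
    by (intro span_sum) (auto intro!: span_scale intro: span_base)
  have fL: "f ` {a..b} \<subseteq> L2 M" using f by auto
  have S_L2: "S p \<in> L2 M" if "p tagged_division_of {a..b}" for p
    using S_span[OF that] L2.span_subset_H[OF fL] by auto
  have ex: "\<exists>d>0. \<forall>p. p tagged_division_of {a..b} \<and> (\<lambda>x. ball x d) fine p \<longrightarrow> l2_dist2 M (S p) Y < e"
    if "e > 0" for e
    using int that unfolding ms_riemann_integral_def S_eq by blast
  have p_ex: "\<exists>p. p tagged_division_of {a..b} \<and> (\<lambda>x. ball x d) fine p" if "d > 0" for d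
    by (rule fine_division_exists_real[OF gauge_ball[OF that], of a b]) auto
  obtain d where d: "d > 0" "\<And>p. p tagged_division_of {a..b} \<and> (\<lambda>x. ball x d) fine p \<Longrightarrow> l2_dist2 M (S p) Y < 1"
    using ex[of 1] by auto
  then obtain p where p: "p tagged_division_of {a..b}" "l2_dist2 M (S p) Y < 1"
    using p_ex[OF d(1)] by blast
  have "l2_dist2 M (S p) Y < \<infinity>" using order.strict_trans[OF p(2) ennreal_one_less_top] by simp
  then show YL: "Y \<in> L2 M" by (rule L2_if_l2_dist2_finite[OF S_L2[OF p(1)] Ym])
  have ex': "\<exists>d>0. \<forall>p. p tagged_division_of {a..b} \<and> (\<lambda>x. ball x d) fine p \<longrightarrow> L2.nrm (S p - Y) < e"
    if e: "e > 0" for e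
  proof -
    obtain d where d: "d > 0" "\<And>p. p tagged_division_of {a..b} \<Longrightarrow> (\<lambda>x. ball x d) fine p \<Longrightarrow> l2_dist2 M (S p) Y < ennreal (e\<^sup>2)"
      using ex[of "ennreal (e\<^sup>2)"] e by auto
    have "L2.nrm (S p - Y) < e" if "p tagged_division_of {a..b}" "(\<lambda>x. ball x d) fine p" for p
    proof -
      have "(L2.nrm (S p - Y))\<^sup>2 < e\<^sup>2"
        using d(2)[OF that] S_L2[OF that(1)] YL by (simp add: l2_dist2_eq ennreal_less_iff)
      then show ?thesis using e by (simp add: power_less_imp_less_base)
    qed
    with d(1) show ?thesis by blast
  qed
  show "Y \<in> L2.cspan (f ` {a..b})"
    unfolding L2.cspan_def
  proof (intro CollectI conjI allI impI YL)
    fix e :: real assume "e > 0"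
    then obtain d where d: "d > 0" "\<And>p. p tagged_division_of {a..b} \<and> (\<lambda>x. ball x d) fine p \<Longrightarrow> L2.nrm (S p - Y) < e"
      using ex' by blast
    then obtain p where "p tagged_division_of {a..b}" "L2.nrm (S p - Y) < e" using p_ex[OF d(1)] by blast
    then show "\<exists>y\<in>span (f ` {a..b}). L2.nrm (Y - y) < e"
      using S_span L2.nrm_diff_commute[OF YL S_L2] by (intro bexI[of _ "S p"]) simp_all
  qed
  show "((\<lambda>s. L2_inner M (f s) y) has_integral L2_inner M Y y) {a..b}" if y: "y \<in> L2 M"
    unfolding has_integral_real
  proof (intro allI impI)
    fix e :: real assume e: "e > 0"
    have pos: "L2.nrm y + 1 > 0" using L2.nrm_nonneg[of y] by linarith
    with e have e': "e / (L2.nrm y + 1) > 0" by simp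
    obtain d where d: "d > 0" "\<And>p. p tagged_division_of {a..b} \<Longrightarrow> (\<lambda>x. ball x d) fine p \<Longrightarrow> L2.nrm (S p - Y) < e / (L2.nrm y + 1)"
      using ex'[OF e'] by blast
    show "\<exists>\<gamma>. gauge \<gamma> \<and> (\<forall>\<D>. \<D> tagged_division_of {a..b} \<and> \<gamma> fine \<D> \<longrightarrow>
        norm ((\<Sum>(x, k)\<in>\<D>. measure lborel k *\<^sub>R L2_inner M (f x) y) - L2_inner M Y y) < e)"
    proof (intro exI[of _ "\<lambda>x. ball x d"] conjI gauge_ball d allI impI)
      fix p assume p: "p tagged_division_of {a..b} \<and> (\<lambda>x. ball x d) fine p"
      have "(\<Sum>(x, k)\<in>p. measure lborel k *\<^sub>R L2_inner M (f x) y) = (\<Sum>xk\<in>p. L2_inner M (measure lborel (snd xk) *\<^sub>R f (fst xk)) y)"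
        using tag[OF conjunct1[OF p]] f y by (intro sum.cong) (auto simp: L2.ip_scale_left)
      also have "\<dots> = L2_inner M (S p) y"
        unfolding S_def case_prod_unfold using tag[OF conjunct1[OF p]] f y
        by (subst L2.ip_sum_left) (auto intro!: L2.H_scale)
      finally have "norm ((\<Sum>(x, k)\<in>p. measure lborel k *\<^sub>R L2_inner M (f x) y) - L2_inner M Y y) = \<bar>L2_inner M (S p - Y) y\<bar>"
        using S_L2[of p] p YL y by (simp add: L2.ip_linear)
      also have "\<dots> \<le> L2.nrm (S p - Y) * L2.nrm y"
        using S_L2[of p] p YL y by (intro L2.Cauchy_Schwarz) auto
      also have "\<dots> \<le> e / (L2.nrm y + 1) * L2.nrm y"
        using d(2)[of p] p by (intro mult_right_mono) auto
      also have "\<dots> < e" using e pos by (simp add: field_simps)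
      finally show "norm ((\<Sum>(x, k)\<in>p. measure lborel k *\<^sub>R L2_inner M (f x) y) - L2_inner M Y y) < e" .
    qed
  qed
qed

lemma l2_dist2_comp:
  assumes \<phi>: "measure_preserving \<phi>" and f: "f \<in> borel_measurable M" and g: "g \<in> borel_measurable M"
  shows "l2_dist2 M (f \<circ> \<phi>) (g \<circ> \<phi>) = l2_dist2 M f g"
proof -
  note [measurable] = f g measure_preserving_measurable[OF \<phi>]
  have eq: "distr M M \<phi> = M" using \<phi> by (simp add: measure_preserving_def)
  have "(\<integral>\<^sup>+x. ennreal ((f x - g x)\<^sup>2) \<partial>distr M M \<phi>) = (\<integral>\<^sup>+x. ennreal ((f (\<phi> x) - g (\<phi> x))\<^sup>2) \<partial>M)"
    by (rule nn_integral_distr) measurable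
  then show ?thesis unfolding eq by (simp add: l2_dist2_def)
qed

lemma ms_riemann_integral_comp:
  assumes \<phi>: "measure_preserving \<phi>" and int: "ms_riemann_integral M f a b Y"
    and f: "\<And>s. s \<in> {a..b} \<Longrightarrow> f s \<in> borel_measurable M"
  shows "ms_riemann_integral M (\<lambda>s. f s \<circ> \<phi>) a b (Y \<circ> \<phi>)"
  unfolding ms_riemann_integral_def
proof (intro conjI allI impI)
  have Y: "Y \<in> borel_measurable M" using int by (simp add: ms_riemann_integral_def)
  show "Y \<circ> \<phi> \<in> borel_measurable M"
    by (rule measurable_comp[OF measure_preserving_measurable[OF \<phi>] Y])
  fix e :: ennreal assume "e > 0"
  then obtain d where d: "d > 0" "\<And>p. p tagged_division_of {a..b} \<Longrightarrow> (\<lambda>x. ball x d) fine p \<Longrightarrow>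
      l2_dist2 M (\<lambda>\<omega>. \<Sum>(s, K)\<in>p. measure lborel K * f s \<omega>) Y < e"
    using int unfolding ms_riemann_integral_def by blast
  have "l2_dist2 M (\<lambda>\<omega>. \<Sum>(s, K)\<in>p. measure lborel K * (f s \<circ> \<phi>) \<omega>) (Y \<circ> \<phi>) < e"
    if p: "p tagged_division_of {a..b}" "(\<lambda>x. ball x d) fine p" for p
  proof -
    have tag: "s \<in> {a..b}" if "(s, K) \<in> p" for s K
      using tagged_division_ofD(2,3)[OF p(1) that] by auto
    have "(\<lambda>\<omega>. \<Sum>(s, K)\<in>p. measure lborel K * f s \<omega>) \<in> borel_measurable M"
      unfolding case_prod_unfold using tag f
      by (intro borel_measurable_sum borel_measurable_times borel_measurable_const) auto
    from l2_dist2_comp[OF \<phi> this Y] d(2)[OF p] show ?thesis by (simp add: comp_def)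
  qed
  then show "\<exists>d>0. \<forall>p. p tagged_division_of {a..b} \<and> (\<lambda>x. ball x d) fine p \<longrightarrow>
      l2_dist2 M (\<lambda>\<omega>. \<Sum>(s, K)\<in>p. measure lborel K * (f s \<circ> \<phi>) \<omega>) (Y \<circ> \<phi>) < e"
    using d(1) by blast
qed

end

lemma space_path_space: "space path_space = {\<omega> \<in> extensional {0..}. continuous_on {0..} \<omega>}"
  by (auto simp: path_space_def space_restrict_space space_PiM PiE_def)

lemma coord_measurable_path_space [measurable]: "t \<ge> 0 \<Longrightarrow> coord t \<in> borel_measurable path_space"
  unfolding path_space_def coord_def[abs_def]
  by (intro measurable_restrict_space1 measurable_component_singleton) auto

lemma sets_path_space:
  "sets path_space \<subseteq> sigma_sets (space path_space)
    {f -` B \<inter> space path_space | f B. f \<in> coord ` {0..} \<and> B \<in> sets borel}"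
proof
  let ?G = "{f -` B \<inter> space path_space | f B. f \<in> coord ` {0..} \<and> B \<in> sets borel}"
  let ?N = "sigma (space path_space) ?G"
  have G: "?G \<subseteq> Pow (space path_space)" by auto
  have sets: "sets ?N = sigma_sets (space path_space) ?G" by (rule sets_measure_of[OF G])
  have space: "space ?N = space path_space" by (rule space_measure_of[OF G])
  \<comment> \<open>The inclusion amounts to the measurability of the identity map, which can be checked coordinatewise.\<close>
  have "(\<lambda>\<omega>. \<omega>) \<in> ?N \<rightarrow>\<^sub>M restrict_space (PiM {0..} (\<lambda>_. borel)) {\<omega>. continuous_on {0..} \<omega>}"
  proof (rule measurable_restrict_space2)
    show "(\<lambda>\<omega>. \<omega>) \<in> space ?N \<rightarrow> {\<omega>. continuous_on {0..} \<omega>}"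
      unfolding space by (auto simp: space_path_space)
    show "(\<lambda>\<omega>. \<omega>) \<in> ?N \<rightarrow>\<^sub>M PiM {0..} (\<lambda>_. borel)"
    proof (rule measurable_PiM_single')
      show "(\<lambda>\<omega>. \<omega>) \<in> space ?N \<rightarrow> (\<Pi>\<^sub>E i\<in>{0..}. space borel)"
        unfolding space by (auto simp: space_path_space extensional_def)
      fix t :: real assume t: "t \<in> {0..}"
      have "coord t \<in> borel_measurable ?N"
      proof (rule measurableI)
        fix B :: "real set" assume "B \<in> sets borel"
        then have "coord t -` B \<inter> space path_space \<in> ?G" using t by blast
        then show "coord t -` B \<inter> space ?N \<in> sets ?N"
          unfolding sets space by (rule sigma_sets.Basic)
      qed simp
      moreover have "coord t = (\<lambda>\<omega>. \<omega> t)" by (simp add: coord_def fun_eq_iff)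
      ultimately show "(\<lambda>\<omega>. \<omega> t) \<in> borel_measurable ?N" by (simp only:)
    qed
  qed
  from this[folded path_space_def]
  have id: "(\<lambda>\<omega>. \<omega>) -` A \<inter> space ?N \<in> sets ?N" if "A \<in> sets path_space" for A
    by (rule measurable_sets[OF _ that])
  fix A assume A: "A \<in> sets path_space"
  have "(\<lambda>\<omega>. \<omega>) -` A \<inter> space path_space = A" using sets.sets_into_space[OF A] by auto
  with id[OF A] show "A \<in> sigma_sets (space path_space) ?G" unfolding sets space by simp
qed

text \<open>Almost sure equality at each single time yields almost sure equality of paths by way of this
lemma, since the rational times are countable.\<close>

lemma path_eqI:
  assumes \<omega>: "\<omega> \<in> space path_space" "\<omega>' \<in> space path_space"
    and eq: "\<And>t. t \<in> \<rat> \<Longrightarrow> t \<ge> 0 \<Longrightarrow> coord t \<omega> = coord t \<omega>'"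
  shows "\<omega> = \<omega>'"
proof
  fix t
  show "\<omega> t = \<omega>' t"
  proof (cases "t \<ge> 0")
    case True
    obtain q where q: "\<And>n. q n \<in> \<rat>" "\<And>n. t < q n" "\<And>n. q n < t + inverse (real (Suc n))"
    proof -
      have "\<exists>q\<in>\<rat>. t < q \<and> q < t + inverse (real (Suc n))" for n by (rule Rats_dense_in_real) simp
      then show ?thesis using that by metis
    qed
    have "q \<longlonglongrightarrow> t"
    proof (rule tendsto_sandwich[OF _ _ tendsto_const])
      show "(\<lambda>n. t + inverse (real (Suc n))) \<longlonglongrightarrow> t" by (rule LIMSEQ_inverse_real_of_nat_add)
    qed (use q in \<open>auto intro!: always_eventually less_imp_le simp del: of_nat_Suc\<close>)
    moreover have "q n \<in> {0..}" for n using q(2)[of n] True by simp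
    ultimately have "(\<lambda>n. \<omega> (q n)) \<longlonglongrightarrow> \<omega> t" "(\<lambda>n. \<omega>' (q n)) \<longlonglongrightarrow> \<omega>' t"
      using \<omega> True unfolding space_path_space continuous_on_sequentially by (auto simp: comp_def)
    moreover have "\<omega> (q n) = \<omega>' (q n)" for n
      using eq[OF q(1)[of n]] q(2)[of n] True by (simp add: coord_def)
    ultimately show ?thesis by (simp add: LIMSEQ_unique)
  next
    case False
    then show ?thesis using \<omega> by (simp add: space_path_space extensional_def)
  qed
qed

text \<open>A self-similar Gaussian law on the path space, whose covariance comes from a Volterra kernel, with
versions of both transformations.\<close>

locale coordinate_process =
  fixes z :: "real \<Rightarrow> real \<Rightarrow> real" and \<alpha> \<beta> :: real and P M :: "(real \<Rightarrow> real) measure"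
    and Z Zi :: "(real \<Rightarrow> real) \<Rightarrow> (real \<Rightarrow> real)"
  assumes \<alpha>: "\<alpha> > - (1/2)" and law: "coordinate_law z P" and M: "M = completion P"
    and kernel: "volterra_kernel z" and self_similar: "self_similar M \<beta> coord"
    and Z: "is_Z_transform M \<alpha> \<beta> Z" and Zi: "is_Z_inverse_transform M \<alpha> \<beta> Zi"
begin

text \<open>The damping rate of the filter in logarithmic time, positive because of \<open>\<alpha> > - 1/2\<close>.\<close>

definition a :: real where "a = \<alpha> + 1/2"

lemma a_pos: "a > 0" using \<alpha> by (simp add: a_def)

lemma prob_space_M: "prob_space M"
  using law prob_space.prob_space_completion by (auto simp: M coordinate_law_def)

sublocale prob_space M by (rule prob_space_M)

lemma sets_P: "sets P = sets path_space" using law by (simp add: coordinate_law_def)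

lemma space_M: "space M = space path_space"
  using sets_eq_imp_space_eq[OF sets_P] by (simp add: M)

lemma sets_path_space_subset: "sets path_space \<subseteq> sets M" using sets_P by (auto simp: M)

lemma id_measurable: "(\<lambda>\<omega>. \<omega>) \<in> M \<rightarrow>\<^sub>M path_space"
  using sets_path_space_subset by (intro measurableI) (auto simp: space_M Int_absorb2 sets.sets_into_space)

lemma coord_measurable [measurable]: "t \<ge> 0 \<Longrightarrow> coord t \<in> borel_measurable M"
  using measurable_compose[OF id_measurable coord_measurable_path_space] by simp

abbreviation coords :: "((real \<Rightarrow> real) \<Rightarrow> real) set" where "coords \<equiv> coord ` {0..}"

lemma centered_gaussian_completion:
  assumes "centered_gaussian P Y"
  shows "centered_gaussian M Y"
proof -
  have Y: "Y \<in> borel_measurable P" using assms by (simp add: centered_gaussian_def)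
  have "distr M lborel Y = distr P lborel Y" unfolding M using Y by (intro distr_completion) simp
  then show ?thesis
    using assms Y AE_completion[of "\<lambda>\<omega>. Y \<omega> = 0" P] unfolding centered_gaussian_def M
    by (auto simp: distributed_def measurable_completion)
qed

lemma gaussian_coords:
  assumes "\<xi> \<in> span coords"
  shows "gaussian \<xi>"
proof -
  obtain F c where F: "finite F" "F \<subseteq> {0..}" "\<xi> = (\<Sum>t\<in>F. c t *\<^sub>R coord t)" using span_image_sum[OF assms] .
  have "\<xi> = (\<lambda>\<omega>. \<Sum>t\<in>F. c t * coord t \<omega>)" by (simp add: F(3) fun_eq_iff sum_fun_apply)
  moreover have "centered_gaussian P (\<lambda>\<omega>. \<Sum>t\<in>F. c t * coord t \<omega>)"
    using law F by (auto simp: coordinate_law_def centered_gaussian_process_def)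
  ultimately show ?thesis using gaussian_of_centered_gaussian centered_gaussian_completion by simp
qed

lemma coord_L2 [simp, intro]: "t \<ge> 0 \<Longrightarrow> coord t \<in> L2 M"
  by (rule gaussian_L2[OF gaussian_coords]) (auto intro: span_base)

lemma coords_L2: "coords \<subseteq> L2 M" by auto

lemma coord_in_cspan: "s \<in> A \<Longrightarrow> A \<subseteq> {0..} \<Longrightarrow> coord s \<in> L2.cspan (coord ` A)"
  using L2.cspan_superset[of "coord ` A"] by (auto simp: image_subset_iff subset_iff)

lemma covariance:
  assumes "s \<ge> 0" "t \<ge> 0"
  shows "L2_inner M (coord s) (coord t) = volterra_covariance z s t"
proof -
  have "coord s \<in> borel_measurable P" "coord t \<in> borel_measurable P"
    using assms by (simp_all add: measurable_cong_sets[OF sets_P refl] coord_measurable_path_space)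
  then have "(\<lambda>\<omega>. coord s \<omega> * coord t \<omega>) \<in> borel_measurable P" by measurable
  then show ?thesis
    using law assms by (simp add: L2_inner_def M integral_completion coordinate_law_def)
qed

lemma coord_homogeneous:
  assumes s: "s \<ge> 0" and t: "t \<ge> 0" and u: "u > 0"
  shows "L2_inner M (coord (u * s)) (coord (u * t)) = u powr (2 * \<beta>) * L2_inner M (coord s) (coord t)"
proof -
  let ?J = "{s, t}" and ?p = "PiM {s, t} (\<lambda>_. borel :: real measure)"
  have [measurable]: "coord s \<in> borel_measurable M" "coord t \<in> borel_measurable M"
    "coord (u * s) \<in> borel_measurable M" "coord (u * t) \<in> borel_measurable M"
    using s t u by auto
  have eq: "distr M ?p (\<lambda>\<omega>. \<lambda>r\<in>?J. coord (u * r) \<omega>) = distr M ?p (\<lambda>\<omega>. \<lambda>r\<in>?J. u powr \<beta> * coord r \<omega>)"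
    using self_similar u s t unfolding self_similar_def by simp
  have m1: "(\<lambda>\<omega>. \<lambda>r\<in>?J. coord (u * r) \<omega>) \<in> M \<rightarrow>\<^sub>M ?p"
  proof (rule measurable_restrict)
    show "coord (u * r) \<in> borel_measurable M" if "r \<in> ?J" for r
      using that s t u by auto
  qed
  have m2: "(\<lambda>\<omega>. \<lambda>r\<in>?J. u powr \<beta> * coord r \<omega>) \<in> M \<rightarrow>\<^sub>M ?p"
  proof (rule measurable_restrict)
    show "(\<lambda>\<omega>. u powr \<beta> * coord r \<omega>) \<in> borel_measurable M" if "r \<in> ?J" for r
      using that s t u by (intro borel_measurable_times borel_measurable_const coord_measurable) auto
  qed
  have g: "(\<lambda>x. x s * x t) \<in> borel_measurable ?p" by measurable
  have "L2_inner M (coord (u * s)) (coord (u * t)) = (LINT x|distr M ?p (\<lambda>\<omega>. \<lambda>r\<in>?J. coord (u * r) \<omega>). x s * x t)"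
    using integral_distr[OF m1 g] by (simp add: L2_inner_def)
  also have "\<dots> = (LINT \<omega>|M. (u powr \<beta> * coord s \<omega>) * (u powr \<beta> * coord t \<omega>))"
    unfolding eq using integral_distr[OF m2 g] by simp
  also have "\<dots> = (LINT \<omega>|M. u powr (2 * \<beta>) * (coord s \<omega> * coord t \<omega>))"
  proof -
    have "u powr (2 * \<beta>) = u powr \<beta> * u powr \<beta>" by (simp add: powr_add[symmetric])
    then show ?thesis by (intro Bochner_Integration.integral_cong refl) (simp only: mult_ac)
  qed
  finally show ?thesis by (simp add: L2_inner_def)
qed

lemma coord_0: "L2.nrm (coord 0) = 0" "AE \<omega> in M. coord 0 \<omega> = 0"
proof -
  have "z 0 u = 0" if "u \<ge> 0" for u using kernel that by (simp add: volterra_kernel_def)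
  then have "volterra_covariance z 0 0 = (LINT u|lebesgue_on {0..min 0 (0::real)}. 0)"
    unfolding volterra_covariance_def by (intro Bochner_Integration.integral_cong refl) auto
  then show 0: "L2.nrm (coord 0) = 0" using covariance[of 0 0] by (simp add: L2.nrm_def)
  then show "AE \<omega> in M. coord 0 \<omega> = 0" using L2_nrm_zero_iff[of "coord 0"] by simp
qed

text \<open>Path continuity becomes mean-square continuity: the Gaussian characteristic function at one
  is a strictly monotone function of the variance.\<close>

lemma coord_L2_continuous:
  assumes x: "\<And>n. x n \<ge> 0" "t \<ge> 0" "x \<longlonglongrightarrow> t"
  shows "(\<lambda>n. L2.nrm (coord (x n) - coord t)) \<longlonglongrightarrow> 0"
proof -
  have g: "gaussian (coord (x n) - coord t)" for n
    by (rule gaussian_coords) (use x in \<open>auto intro!: span_diff intro: span_base\<close>)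
  have "(\<lambda>n. expectation (\<lambda>\<omega>. cos ((coord (x n) - coord t) \<omega> + 0))) \<longlonglongrightarrow> expectation (\<lambda>\<omega>. 1)"
  proof (rule integral_dominated_convergence[where w = "\<lambda>_. 1"])
    show "AE \<omega> in M. (\<lambda>n. cos ((coord (x n) - coord t) \<omega> + 0)) \<longlonglongrightarrow> 1"
    proof (rule AE_I2)
      fix \<omega> assume "\<omega> \<in> space M"
      then have "continuous_on {0..} \<omega>" by (simp add: space_M space_path_space)
      then have "(\<lambda>n. \<omega> (x n)) \<longlonglongrightarrow> \<omega> t"
        using x unfolding continuous_on_sequentially by (auto simp: comp_def)
      then have "(\<lambda>n. cos (\<omega> (x n) - \<omega> t)) \<longlonglongrightarrow> cos (\<omega> t - \<omega> t)" by (intro tendsto_intros)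
      then show "(\<lambda>n. cos ((coord (x n) - coord t) \<omega> + 0)) \<longlonglongrightarrow> 1" by (simp add: coord_def)
    qed
    show "(\<lambda>\<omega>. cos ((coord (x n) - coord t) \<omega> + 0)) \<in> borel_measurable M" for n
      using L2_measurable[OF gaussian_L2[OF g[of n]]] by measurable
  qed auto
  then have "(\<lambda>n. exp (- (L2.nrm (coord (x n) - coord t))\<^sup>2 / 2)) \<longlonglongrightarrow> 1"
    using gaussian_cos[OF g, of _ 0] by (simp add: prob_space L2.nrm_square)
  then have "(\<lambda>n. - 2 * ln (exp (- (L2.nrm (coord (x n) - coord t))\<^sup>2 / 2))) \<longlonglongrightarrow> - 2 * ln 1"
    by (intro tendsto_intros) auto
  then have "(\<lambda>n. sqrt ((L2.nrm (coord (x n) - coord t))\<^sup>2)) \<longlonglongrightarrow> sqrt 0"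
    by (intro tendsto_real_sqrt) simp
  then show ?thesis by simp
qed

lemma coord_weakly_continuous:
  assumes y: "y \<in> L2 M"
  shows "continuous_on {0<..} (\<lambda>t. L2_inner M (coord t) y)"
  unfolding continuous_on_sequentially
proof (intro ballI allI impI)
  fix t and x :: "nat \<Rightarrow> real" assume t: "t \<in> {0<..}" and x: "(\<forall>n. x n \<in> {0<..}) \<and> x \<longlonglongrightarrow> t"
  then have pos: "x n \<ge> 0" "t \<ge> 0" for n by (auto intro: less_imp_le)
  have "(\<lambda>n. L2_inner M (coord (x n)) y - L2_inner M (coord t) y) \<longlonglongrightarrow> 0"
  proof (rule Lim_null_comparison)
    show "\<forall>\<^sub>F n in sequentially. norm (L2_inner M (coord (x n)) y - L2_inner M (coord t) y)
        \<le> L2.nrm (coord (x n) - coord t) * L2.nrm y"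
      using L2.Cauchy_Schwarz[of "coord (x _) - coord t" y] pos y
      by (intro always_eventually allI) (simp add: L2.ip_linear[symmetric] L2.H_diff)
    show "(\<lambda>n. L2.nrm (coord (x n) - coord t) * L2.nrm y) \<longlonglongrightarrow> 0"
      using x pos by (intro tendsto_mult_left_zero coord_L2_continuous) auto
  qed
  then show "((\<lambda>t. L2_inner M (coord t) y) \<circ> x) \<longlonglongrightarrow> L2_inner M (coord t) y"
    by (simp add: LIM_zero_iff comp_def)
qed

text \<open>Defining \<open>J\<close> as a multiple of \<open>coord t - coord t \<circ> Z\<close> makes the filter formula exact; the
averaging property of \<open>J\<close> then follows from the almost sure formula for \<open>Z\<close>.\<close>

definition J :: "real \<Rightarrow> (real \<Rightarrow> real) \<Rightarrow> real" where
  "J t = (1 / (2 * a)) *\<^sub>R (coord t - (coord t \<circ> Z))"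

lemma coord_Z: "coord t \<circ> Z = coord t - (2 * a) *\<^sub>R J t"
  using a_pos by (simp add: J_def fun_eq_iff)

lemma Z_measurable: "Z \<in> M \<rightarrow>\<^sub>M path_space" using Z by (simp add: is_Z_transform_def)

lemma coord_Z_measurable: "t \<ge> 0 \<Longrightarrow> coord t \<circ> Z \<in> borel_measurable M"
  by (rule measurable_comp[OF Z_measurable coord_measurable_path_space])

lemma
  assumes t: "t > 0"
  shows coord_Z_L2: "coord t \<circ> Z \<in> L2 M" and J_L2: "J t \<in> L2 M"
    and J_cspan: "J t \<in> L2.cspan (coord ` {0..t})"
    and J_average: "y \<in> L2 M \<Longrightarrow>
      ((\<lambda>e. integral {e..t} (\<lambda>u. u powr (a - 1 - \<beta>) * L2_inner M (coord u) y))
         \<longlongrightarrow> t powr (a - \<beta>) * L2_inner M (J t) y) (at_right 0)"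
proof -
  define f where "f s = s powr (a - 1 - \<beta>) *\<^sub>R coord s" for s
  define c where "c = t powr (\<beta> - a)"
  have c: "c > 0" "t powr (a - \<beta>) * c = 1" using t by (simp_all add: c_def powr_add[symmetric])
  have e1: "\<alpha> - \<beta> - 1/2 = a - 1 - \<beta>" "2 * \<alpha> + 1 = 2 * a" "\<beta> - \<alpha> - 1/2 = \<beta> - a" by (simp_all add: a_def)
  obtain Y where Y0: "ms_integral_from_0 M (\<lambda>s \<omega>. s powr (\<alpha> - \<beta> - 1/2) * coord s \<omega>) t Y"
    and Y: "AE \<omega> in M. coord t (Z \<omega>) = coord t \<omega> - (2 * \<alpha> + 1) * t powr (\<beta> - \<alpha> - 1/2) * Y \<omega>"
    using Z t unfolding is_Z_transform_def by blast
  have feq: "(\<lambda>s \<omega>. s powr (\<alpha> - \<beta> - 1/2) * coord s \<omega>) = f"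
    unfolding e1 by (simp add: f_def fun_eq_iff)
  obtain I where I: "\<And>e. 0 < e \<Longrightarrow> e < t \<Longrightarrow> ms_riemann_integral M f e t (I e)"
    and Ilim: "((\<lambda>e. l2_dist2 M (I e) Y) \<longlongrightarrow> 0) (at_right 0)" and Ym: "Y \<in> borel_measurable M"
    using Y0 unfolding ms_integral_from_0_def feq by blast
  have fL: "f s \<in> L2 M" if "s \<in> {e..t}" "0 < e" for s e using that by (auto simp: f_def)
  have R: "I e \<in> L2 M" "I e \<in> L2.cspan (f ` {e..t})"
    "y \<in> L2 M \<Longrightarrow> ((\<lambda>s. L2_inner M (f s) y) has_integral L2_inner M (I e) y) {e..t}"
    if e: "0 < e" "e < t" for e y
    using ms_riemann_integral_L2[OF I[OF e] fL[OF _ e(1)]] by auto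
  have ev: "\<forall>\<^sub>F e in at_right 0. 0 < e \<and> e < t"
    unfolding eventually_at_right_field using t by blast
  then have evL: "\<forall>\<^sub>F e in at_right 0. I e \<in> L2 M" by eventually_elim (simp add: R(1))
  note lim = L2_limit[OF Ilim evL trivial_limit_at_right_real Ym]
  note YL = lim(1)
  have cl: "L2.closed_sub (L2.cspan (coord ` {0..t}))" by (rule L2.closed_sub_cspan) auto
  have "\<forall>\<^sub>F e in at_right 0. I e \<in> L2.cspan (coord ` {0..t})"
    using ev
  proof eventually_elim
    case (elim e)
    have "f ` {e..t} \<subseteq> L2.cspan (coord ` {0..t})"
    proof
      fix g assume "g \<in> f ` {e..t}"
      then obtain s where s: "s \<in> {e..t}" "g = f s" by blast
      have "coord s \<in> L2.cspan (coord ` {0..t})"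
        using s elim by (intro coord_in_cspan) auto
      then show "g \<in> L2.cspan (coord ` {0..t})"
        using L2.closed_subD(1)[OF cl] unfolding s f_def by (rule subspace_scale[rotated])
    qed
    then show ?case using R(2)[of e] elim L2.cspan_minimal[OF _ cl] by blast
  qed
  note Ycs = lim(4)[OF cl this]
  have cY: "c *\<^sub>R Y \<in> L2.cspan (coord ` {0..t})"
    by (rule subspace_scale[OF L2.closed_subD(1)[OF cl] Ycs])
  have AEZ: "AE \<omega> in M. (coord t - (2 * a * c) *\<^sub>R Y) \<omega> = (coord t \<circ> Z) \<omega>"
    using Y unfolding e1 c_def by eventually_elim simp
  show ZL: "coord t \<circ> Z \<in> L2 M"
  proof (rule L2_cong_AE)
    show "coord t - (2 * a * c) *\<^sub>R Y \<in> L2 M" using t YL by auto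
    show "coord t \<circ> Z \<in> borel_measurable M" using t coord_Z_measurable by simp
  qed (fact AEZ)
  show JL: "J t \<in> L2 M" unfolding J_def using t ZL by auto
  have AEJ: "AE \<omega> in M. (c *\<^sub>R Y) \<omega> = J t \<omega>"
    using AEZ by eventually_elim (use a_pos in \<open>simp add: J_def field_simps\<close>)
  show "J t \<in> L2.cspan (coord ` {0..t})"
    by (rule L2_closed_sub_cong_AE[OF cl cY L2_measurable[OF JL] AEJ])
  assume y: "y \<in> L2 M"
  have "L2_inner M (J t) y = L2_inner M (c *\<^sub>R Y) y"
    by (rule L2_inner_cong_AE) (use AEJ L2_measurable[OF JL] L2_measurable[OF L2.H_scale[OF YL]] L2_measurable[OF y] in auto)
  then have eq: "t powr (a - \<beta>) * L2_inner M (J t) y = L2_inner M Y y"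
    using c YL y by (simp add: L2.ip_linear flip: mult.assoc)
  have "\<forall>\<^sub>F e in at_right 0. L2_inner M (I e) y = integral {e..t} (\<lambda>u. u powr (a - 1 - \<beta>) * L2_inner M (coord u) y)"
    using ev
  proof eventually_elim
    case (elim e)
    have "((\<lambda>u. L2_inner M (f u) y) has_integral L2_inner M (I e) y) {e..t}"
      using R(3)[of e y] elim y by blast
    then have "integral {e..t} (\<lambda>u. L2_inner M (f u) y) = L2_inner M (I e) y" by (rule integral_unique)
    moreover have "integral {e..t} (\<lambda>u. L2_inner M (f u) y) = integral {e..t} (\<lambda>u. u powr (a - 1 - \<beta>) * L2_inner M (coord u) y)"
      using elim y by (intro Henstock_Kurzweil_Integration.integral_cong) (auto simp: f_def L2.ip_scale_left)
    ultimately show ?case by simp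
  qed
  from Lim_transform_eventually[OF lim(3)[OF y] this]
  show "((\<lambda>e. integral {e..t} (\<lambda>u. u powr (a - 1 - \<beta>) * L2_inner M (coord u) y))
         \<longlongrightarrow> t powr (a - \<beta>) * L2_inner M (J t) y) (at_right 0)"
    unfolding eq .
qed

sublocale flt: selfsimilar_filter "L2 M" "L2_inner M" coord J a \<beta>
  by unfold_locales (auto simp: a_pos J_L2 coord_homogeneous coord_weakly_continuous J_average)

lemma flt_Z: "flt.Z t = coord t \<circ> Z"
  by (simp add: flt.Z_def coord_Z)

end


section \<open>The Kolmogorov property of the transformations\<close>

context coordinate_process
begin

lemma span_coords_measurable:
  assumes "\<xi> \<in> span coords"
  shows "\<xi> \<in> borel_measurable path_space"
proof -
  obtain F c where F: "finite F" "F \<subseteq> {0..}" "\<xi> = (\<Sum>t\<in>F. c t *\<^sub>R coord t)" using span_image_sum[OF assms] .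
  have "\<xi> = (\<lambda>\<omega>. \<Sum>t\<in>F. c t * coord t \<omega>)" by (simp add: F(3) fun_eq_iff sum_fun_apply)
  moreover have "(\<lambda>\<omega>. \<Sum>t\<in>F. c t * coord t \<omega>) \<in> borel_measurable path_space"
    using F(2) by (intro borel_measurable_sum borel_measurable_times coord_measurable_path_space) auto
  ultimately show ?thesis by simp
qed

text \<open>Measurability into the completed space is part of the conclusion: a map that preserves the law on the
uncompleted \<open>\<sigma>\<close>-algebra pulls null sets back to null sets.\<close>

lemma measure_preserving_if_distr:
  assumes \<phi>: "\<phi> \<in> M \<rightarrow>\<^sub>M path_space"
    and eq: "\<And>A. A \<in> sets path_space \<Longrightarrow> measure M (\<phi> -` A \<inter> space M) = measure M A"
  shows "measure_preserving \<phi>"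
proof -
  have \<phi>P: "\<phi> \<in> M \<rightarrow>\<^sub>M P" using \<phi> measurable_cong_sets[OF refl sets_P] by blast
  have "distr M P \<phi> = P"
  proof (rule measure_eqI)
    fix A assume "A \<in> sets (distr M P \<phi>)"
    then have A: "A \<in> sets P" by simp
    have "emeasure (distr M P \<phi>) A = emeasure M (\<phi> -` A \<inter> space M)" by (rule emeasure_distr[OF \<phi>P A])
    also have "\<dots> = emeasure M A" using eq[of A] A by (simp add: sets_P emeasure_eq_measure)
    also have "\<dots> = emeasure P A" using A by (simp add: M)
    finally show "emeasure (distr M P \<phi>) A = emeasure P A" .
  qed simp
  moreover have "complete_measure M" unfolding M by (rule completion.complete_measure_axioms)
  ultimately show ?thesis
    unfolding measure_preserving_def
    using complete_measure.measurable_completion2[OF _ \<phi>P] complete_measure.completion_distr_eq[OF _ \<phi>P]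
    by (simp add: M[symmetric])
qed

lemma measure_preserving_if_cosine:
  assumes \<phi>: "\<phi> \<in> M \<rightarrow>\<^sub>M path_space"
    and eq: "\<And>\<xi> \<theta>. \<xi> \<in> span coords \<Longrightarrow>
      expectation (\<lambda>\<omega>. cos (\<xi> (\<phi> \<omega>) + \<theta>)) = expectation (\<lambda>\<omega>. cos (\<xi> \<omega> + \<theta>))"
  shows "measure_preserving \<phi>"
proof (rule measure_preserving_if_distr[OF \<phi>])
  fix A assume A: "A \<in> sets path_space"
  let ?D = "\<lambda>\<phi>. distr M path_space \<phi>"
  have "measure (?D \<phi>) A = measure (?D (\<lambda>\<omega>. \<omega>)) A"
  proof (rule cosine_uniqueness[where F = coords])
    show "finite_measure (?D \<phi>)" "finite_measure (?D (\<lambda>\<omega>. \<omega>))"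
      using \<phi> id_measurable by (auto intro: finite_measure_distr)
    show "coords \<subseteq> borel_measurable (?D \<phi>)" using coord_measurable_path_space by auto
    show "(LINT x|?D \<phi>. cos (\<xi> x + \<theta>)) = (LINT x|?D (\<lambda>\<omega>. \<omega>). cos (\<xi> x + \<theta>))" if "\<xi> \<in> span coords" for \<xi> \<theta>
    proof -
      have [measurable]: "\<xi> \<in> borel_measurable path_space" by (rule span_coords_measurable[OF that])
      have "(\<lambda>x. cos (\<xi> x + \<theta>)) \<in> borel_measurable path_space" by measurable
      then show ?thesis
        using integral_distr[OF \<phi>, of "\<lambda>x. cos (\<xi> x + \<theta>)"] integral_distr[OF id_measurable, of "\<lambda>x. cos (\<xi> x + \<theta>)"]
          eq[OF that] by simp
    qed
    show "A \<in> sigma_sets (space (?D \<phi>)) ({f -` B \<inter> space (?D \<phi>) |f B. f \<in> coords \<and> B \<in> sets borel} \<union>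
        (null_sets (?D \<phi>) \<inter> null_sets (?D (\<lambda>\<omega>. \<omega>))))"
      unfolding space_distr by (rule subsetD[OF sigma_sets_mono'[OF Un_upper1] subsetD[OF sets_path_space A]])
  qed simp
  then show "measure M (\<phi> -` A \<inter> space M) = measure M A"
    using A sets.sets_into_space[OF A] measure_distr[OF \<phi> A] measure_distr[OF id_measurable A]
    by (simp add: space_M Int_absorb2)
qed

lemma sets_M_sigma_gen: "sets M \<subseteq> sigma_gen coords"
proof
  fix A assume "A \<in> sets M"
  then obtain S N N' where A: "A = S \<union> N" "N \<subseteq> N'" "N' \<in> null_sets P" "S \<in> sets P"
    unfolding M by (rule sets_completionE)
  interpret S: sigma_algebra "space M" "sigma_gen coords"
    by (rule sigma_algebra_sigma_gen) auto
  have "{f -` B \<inter> space path_space | f B. f \<in> coords \<and> B \<in> sets borel} \<subseteq> sigma_gen coords"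
    unfolding sigma_gen_def space_M by auto
  from S.sigma_sets_subset[OF this] have "S \<in> sigma_gen coords"
    using A(4) sets_path_space by (auto simp: sets_P space_M)
  moreover have "N \<in> null_sets M"
    using A(2,3) null_sets_completionI[OF A(3)] unfolding M by (metis null_sets_completion_subset)
  then have "N \<in> sigma_gen coords" using null_sets_sigma_gen by blast
  ultimately show "A \<in> sigma_gen coords" unfolding A(1) by (rule S.Un)
qed

lemma coord_0_inner: "y \<in> L2 M \<Longrightarrow> L2_inner M (coord 0) y = 0" "y \<in> L2 M \<Longrightarrow> L2_inner M y (coord 0) = 0"
  using L2.nrm_zero_ip[OF coord_0(1), of y] L2.ip_commute[of y] by auto

lemma coord_0_Z_AE: "AE \<omega> in M. (coord 0 \<circ> Z) \<omega> = 0" using Z by (simp add: is_Z_transform_def)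

lemma zero_in_closed:
  assumes S: "L2.closed_sub S" and f: "f \<in> borel_measurable M" "AE \<omega> in M. f \<omega> = 0"
  shows "f \<in> S"
  by (rule L2_closed_sub_cong_AE[OF S subspace_0[OF L2.closed_subD(1)[OF S]] f(1)]) (use f(2) in auto)

lemma coord_cspan_mono: "A \<subseteq> B \<Longrightarrow> f \<in> L2.cspan (coord ` A) \<Longrightarrow> f \<in> L2.cspan (coord ` B)"
  using L2.cspan_mono[OF image_mono] by blast

text \<open>\<open>Z\<close> at time \<open>s\<close> is an average over the past of \<open>s\<close>, so it never leaves the closed span of the past.\<close>

lemma coord_Z_causal:
  assumes "0 \<le> s" "s \<le> t"
  shows "coord s \<circ> Z \<in> L2.cspan (coord ` {0..t})"
proof -
  have cl: "L2.closed_sub (L2.cspan (coord ` {0..t}))" by (rule L2.closed_sub_cspan) auto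
  show ?thesis
  proof (cases "s = 0")
    case True
    have "coord 0 \<circ> Z \<in> L2.cspan (coord ` {0..t})"
      by (rule zero_in_closed[OF cl coord_Z_measurable[OF order_refl] coord_0_Z_AE])
    then show ?thesis unfolding True .
  next
    case False
    then have "J s \<in> L2.cspan (coord ` {0..t})"
      using assms by (intro coord_cspan_mono[OF _ J_cspan]) auto
    moreover have "coord s \<in> L2.cspan (coord ` {0..t})"
      using assms by (intro coord_in_cspan) auto
    ultimately show ?thesis
      unfolding coord_Z using L2.closed_subD(1)[OF cl] by (intro subspace_diff subspace_scale)
  qed
qed

lemma coord_Z_cspan: "t \<ge> 0 \<Longrightarrow> coord t \<circ> Z \<in> L2.cspan coords"
  by (rule coord_cspan_mono[OF _ coord_Z_causal[of t t]]) auto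

lemma coord_Z_L2': "t \<ge> 0 \<Longrightarrow> coord t \<circ> Z \<in> L2 M"
  using coord_Z_cspan by (auto simp: L2.cspan_def)

lemma coord_Z_inner:
  assumes "s \<ge> 0" "t \<ge> 0"
  shows "L2_inner M (coord s \<circ> Z) (coord t \<circ> Z) = L2_inner M (coord s) (coord t)"
proof (cases "s = 0 \<or> t = 0")
  case True
  have "L2.nrm (coord 0 \<circ> Z) = 0"
    using coord_0_Z_AE L2_nrm_zero_iff[OF coord_Z_L2'[of 0]] by simp
  then have "L2_inner M (coord 0 \<circ> Z) y = 0" if "y \<in> L2 M" for y
    using L2.nrm_zero_ip[OF _ coord_Z_L2'[of 0] that] by simp
  moreover from this have "L2_inner M y (coord 0 \<circ> Z) = 0" if "y \<in> L2 M" for y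
    using that L2.ip_commute by metis
  ultimately show ?thesis using True assms coord_Z_L2' coord_0_inner by auto
next
  case False
  then show ?thesis using flt.Z_isometric[of s t] assms by (simp add: flt_Z)
qed

text \<open>The image process is again Gaussian, as a family of mean-square limits, and it has the same covariance
because the filter is isometric.\<close>

lemma Z_measure_preserving: "measure_preserving Z"
proof (rule measure_preserving_if_cosine[OF Z_measurable])
  fix \<xi> \<theta> assume \<xi>: "\<xi> \<in> span coords"
  then obtain F c where F: "finite F" "F \<subseteq> {0..}" "\<xi> = (\<Sum>t\<in>F. c t *\<^sub>R coord t)" by (rule span_image_sum)
  have \<xi>Z: "\<xi> \<circ> Z = (\<Sum>t\<in>F. c t *\<^sub>R (coord t \<circ> Z))"
    by (simp add: F(3) fun_eq_iff sum_fun_apply)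
  have "\<xi> \<circ> Z \<in> L2.cspan coords"
    unfolding \<xi>Z using F(2) coord_Z_cspan L2.closed_subD(1)[OF L2.closed_sub_cspan[OF coords_L2]]
    by (intro subspace_sum subspace_scale) auto
  then have g: "gaussian (\<xi> \<circ> Z)" by (rule gaussian_cspan[rotated]) (rule gaussian_coords)
  have "L2_inner M (\<xi> \<circ> Z) (\<xi> \<circ> Z) = (\<Sum>s\<in>F. \<Sum>t\<in>F. c s * c t * L2_inner M (coord s \<circ> Z) (coord t \<circ> Z))"
    unfolding \<xi>Z using F(2) coord_Z_L2' by (intro L2.ip_sum_sum) auto
  also have "\<dots> = (\<Sum>s\<in>F. \<Sum>t\<in>F. c s * c t * L2_inner M (coord s) (coord t))"
    using F(2) by (intro sum.cong refl) (simp add: coord_Z_inner subset_iff)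
  also have "\<dots> = L2_inner M \<xi> \<xi>"
    unfolding F(3) using F(2) by (intro L2.ip_sum_sum[symmetric]) auto
  finally show "expectation (\<lambda>\<omega>. cos (\<xi> (Z \<omega>) + \<theta>)) = expectation (\<lambda>\<omega>. cos (\<xi> \<omega> + \<theta>))"
    using gaussian_cos[OF g, of \<theta>] gaussian_cos[OF gaussian_coords[OF \<xi>], of \<theta>] by simp
qed

lemma Zi_measurable: "Zi \<in> M \<rightarrow>\<^sub>M path_space" using Zi by (simp add: is_Z_inverse_transform_def)

lemma coord_Zi_measurable: "t \<ge> 0 \<Longrightarrow> coord t \<circ> Zi \<in> borel_measurable M"
  by (rule measurable_comp[OF Zi_measurable coord_measurable_path_space])

lemma
  assumes t: "t > 0"
  shows coord_Zi_cspan_pos: "coord t \<circ> Zi \<in> L2.cspan coords"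
    and coord_Zi_Z_pos: "AE \<omega> in M. coord t (Zi (Z \<omega>)) = coord t \<omega>"
proof -
  define g where "g s = s powr (- \<beta> - a - 1) *\<^sub>R coord s" for s
  define c where "c = 2 * a * t powr (a + \<beta>)"
  have e1: "- \<beta> - \<alpha> - 3/2 = - \<beta> - a - 1" "2 * \<alpha> + 1 = 2 * a" "\<alpha> + \<beta> + 1/2 = a + \<beta>" by (simp_all add: a_def)
  obtain Y where Y0: "ms_integral_to_infinity M (\<lambda>s \<omega>. coord s \<omega> * s powr (- \<beta> - \<alpha> - 3/2)) t Y"
    and Y: "AE \<omega> in M. coord t (Zi \<omega>) = coord t \<omega> - (2 * \<alpha> + 1) * t powr (\<alpha> + \<beta> + 1/2) * Y \<omega>"
    using Zi t unfolding is_Z_inverse_transform_def by blast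
  have geq: "(\<lambda>s \<omega>. coord s \<omega> * s powr (- \<beta> - \<alpha> - 3/2)) = g"
    unfolding e1 by (simp add: g_def fun_eq_iff)
  obtain I where I: "\<And>b. t < b \<Longrightarrow> ms_riemann_integral M g t b (I b)"
    and Ilim: "((\<lambda>b. l2_dist2 M (I b) Y) \<longlongrightarrow> 0) at_top" and Ym: "Y \<in> borel_measurable M"
    using Y0 unfolding ms_integral_to_infinity_def geq by blast
  have gL: "g s \<in> L2 M" if "s \<in> {t..b}" for s b using that t by (auto simp: g_def)
  have R: "I b \<in> L2 M" "I b \<in> L2.cspan (g ` {t..b})" if b: "t < b" for b
    using ms_riemann_integral_L2(1,2)[OF I[OF b] gL[of _ b]] by auto
  have ev: "\<forall>\<^sub>F b in at_top. t < b" by (rule eventually_gt_at_top)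
  then have evL: "\<forall>\<^sub>F b in at_top. I b \<in> L2 M" by eventually_elim (simp add: R(1))
  note lim = L2_limit[OF Ilim evL trivial_limit_at_top_linorder Ym]
  note YL = lim(1)
  have cl: "L2.closed_sub (L2.cspan coords)" by (rule L2.closed_sub_cspan[OF coords_L2])
  have "\<forall>\<^sub>F b in at_top. I b \<in> L2.cspan coords"
    using ev
  proof eventually_elim
    case (elim b)
    have "g ` {t..b} \<subseteq> L2.cspan coords"
      using L2.closed_subD(1)[OF cl] L2.cspan_superset[OF coords_L2] t unfolding g_def
      by (auto intro!: subspace_scale)
    then show ?case using R(2)[OF elim] L2.cspan_minimal[OF _ cl] by blast
  qed
  note Ycs = lim(4)[OF cl this]
  have AEZi: "AE \<omega> in M. (coord t - c *\<^sub>R Y) \<omega> = (coord t \<circ> Zi) \<omega>"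
    using Y unfolding e1 c_def by eventually_elim simp
  have cs: "coord t - c *\<^sub>R Y \<in> L2.cspan coords"
    using L2.closed_subD(1)[OF cl] Ycs L2.cspan_superset[OF coords_L2] t
    by (intro subspace_diff subspace_scale) auto
  show "coord t \<circ> Zi \<in> L2.cspan coords"
    by (rule L2_closed_sub_cong_AE[OF cl cs coord_Zi_measurable AEZi]) (use t in simp)
  \<comment> \<open>As \<open>Z\<close> preserves the measure, the mean-square integral \<open>Y\<close> of the coordinate process becomes, along
    \<open>Z\<close>, the mean-square integral of the image process.\<close>
  define h where "h = (coord t \<circ> Z) - c *\<^sub>R (Y \<circ> Z)"
  have YZ: "Y \<circ> Z \<in> L2 M" by (rule measure_preserving_L2[OF Z_measure_preserving YL])
  have hL: "h \<in> L2 M" unfolding h_def using YZ coord_Z_L2'[of t] t by auto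
  have YZ_inner: "L2_inner M (Y \<circ> Z) y = - (t powr (- a - \<beta>) * L2_inner M (J t) y)" if y: "y \<in> L2 M" for y
  proof -
    have IZ: "L2_inner M (I b \<circ> Z) y = b powr (- a - \<beta>) * L2_inner M (J b) y - t powr (- a - \<beta>) * L2_inner M (J t) y"
      if b: "t < b" for b
    proof (rule has_integral_unique)
      have gZ: "g s \<circ> Z = s powr (- \<beta> - a - 1) *\<^sub>R (coord s \<circ> Z)" for s by (simp add: g_def fun_eq_iff)
      have gZL: "g s \<circ> Z \<in> L2 M" if "s \<in> {t..b}" for s
        unfolding gZ using that t coord_Z_L2'[of s] by auto
      have int: "ms_riemann_integral M (\<lambda>s. g s \<circ> Z) t b (I b \<circ> Z)"
        by (rule ms_riemann_integral_comp[OF Z_measure_preserving I[OF b] L2_measurable[OF gL]])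
      show "((\<lambda>s. L2_inner M (g s \<circ> Z) y) has_integral L2_inner M (I b \<circ> Z) y) {t..b}"
        by (rule ms_riemann_integral_L2(3)[OF int gZL y])
      have "((\<lambda>s. s powr (- \<beta> - a - 1) * L2_inner M (flt.Z s) y) has_integral
         b powr (- a - \<beta>) * L2_inner M (J b) y - t powr (- a - \<beta>) * L2_inner M (J t) y) {t..b}"
        using flt.Z_future_integral[OF y t, of b] b by simp
      then show "((\<lambda>s. L2_inner M (g s \<circ> Z) y) has_integral
         b powr (- a - \<beta>) * L2_inner M (J b) y - t powr (- a - \<beta>) * L2_inner M (J t) y) {t..b}"
        by (rule has_integral_eq[rotated]) (use t y coord_Z_L2' in \<open>simp add: flt_Z gZ L2.ip_scale_left\<close>)
    qed
    have "((\<lambda>b. l2_dist2 M (I b \<circ> Z) (Y \<circ> Z)) \<longlongrightarrow> 0) at_top"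
    proof (rule Lim_transform_eventually[OF Ilim])
      show "\<forall>\<^sub>F b in at_top. l2_dist2 M (I b) Y = l2_dist2 M (I b \<circ> Z) (Y \<circ> Z)"
        using ev by eventually_elim (use l2_dist2_comp[OF Z_measure_preserving L2_measurable[OF R(1)] Ym] in simp)
    qed
    moreover have "\<forall>\<^sub>F b in at_top. I b \<circ> Z \<in> L2 M"
      using evL by eventually_elim (rule measure_preserving_L2[OF Z_measure_preserving])
    ultimately have "((\<lambda>b. L2_inner M (I b \<circ> Z) y) \<longlongrightarrow> L2_inner M (Y \<circ> Z) y) at_top"
      by (rule L2_limit(3)[OF _ _ trivial_limit_at_top_linorder L2_measurable[OF YZ] y])
    moreover have "\<forall>\<^sub>F b in at_top. L2_inner M (I b \<circ> Z) y =
        b powr (- a - \<beta>) * L2_inner M (J b) y - t powr (- a - \<beta>) * L2_inner M (J t) y"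
      using ev by eventually_elim (rule IZ)
    ultimately have "((\<lambda>b. b powr (- a - \<beta>) * L2_inner M (J b) y - t powr (- a - \<beta>) * L2_inner M (J t) y)
        \<longlongrightarrow> L2_inner M (Y \<circ> Z) y) at_top"
      by (rule Lim_transform_eventually)
    moreover have "((\<lambda>b. b powr (- a - \<beta>) * L2_inner M (J b) y - t powr (- a - \<beta>) * L2_inner M (J t) y)
        \<longlongrightarrow> 0 - t powr (- a - \<beta>) * L2_inner M (J t) y) at_top"
      by (intro tendsto_diff flt.J_decay[OF y] tendsto_const)
    ultimately show ?thesis
      using tendsto_unique[OF trivial_limit_at_top_linorder] by fastforce
  qed
  have "L2_inner M h y = L2_inner M (coord t) y" if y: "y \<in> L2 M" for y
  proof -
    have cc: "c * t powr (- a - \<beta>) = 2 * a" using t by (simp add: c_def powr_add[symmetric] mult.assoc)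
    have "L2_inner M h y = L2_inner M (coord t \<circ> Z) y + (c * t powr (- a - \<beta>)) * L2_inner M (J t) y"
      unfolding h_def using YZ_inner[OF y] YZ coord_Z_L2'[of t] t y by (simp add: L2.ip_linear)
    also have "\<dots> = L2_inner M (coord t) y"
      unfolding cc coord_Z using t y J_L2[of t] by (simp add: L2.ip_linear)
    finally show ?thesis .
  qed
  then have "L2_inner M (h - coord t) (h - coord t) = 0"
    using hL t by (simp add: L2.ip_diff_left)
  then have "AE \<omega> in M. (h - coord t) \<omega> = 0"
    using L2_nrm_zero_iff[of "h - coord t"] hL t by (simp add: L2.nrm_def)
  moreover have "AE \<omega> in M. (coord t - c *\<^sub>R Y) (Z \<omega>) = (coord t \<circ> Zi) (Z \<omega>)"
    by (rule measure_preserving_AE[OF Z_measure_preserving AEZi])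
  ultimately show "AE \<omega> in M. coord t (Zi (Z \<omega>)) = coord t \<omega>"
    by eventually_elim (simp add: h_def)
qed

lemma coord_0_Zi_AE: "AE \<omega> in M. (coord 0 \<circ> Zi) \<omega> = 0" using Zi by (simp add: is_Z_inverse_transform_def)

lemma coord_Zi_cspan:
  assumes "t \<ge> 0"
  shows "coord t \<circ> Zi \<in> L2.cspan coords"
proof (cases "t = 0")
  case True
  have "coord 0 \<circ> Zi \<in> L2.cspan coords"
    by (rule zero_in_closed[OF L2.closed_sub_cspan[OF coords_L2] coord_Zi_measurable[OF order_refl] coord_0_Zi_AE])
  then show ?thesis unfolding True .
qed (use assms coord_Zi_cspan_pos[of t] in simp)

lemma Zi_Z_id: "AE \<omega> in M. Zi (Z \<omega>) = \<omega>"
proof -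
  have "AE \<omega> in M. coord t (Zi (Z \<omega>)) = coord t \<omega>" if "t \<ge> 0" for t
  proof (cases "t = 0")
    case True
    have "AE \<omega> in M. coord 0 (Zi (Z \<omega>)) = 0"
      using measure_preserving_AE[OF Z_measure_preserving coord_0_Zi_AE] by simp
    with coord_0(2) show ?thesis unfolding True by eventually_elim simp
  next
    case False
    then show ?thesis using coord_Zi_Z_pos[of t] that by simp
  qed
  then have "AE \<omega> in M. \<forall>t\<in>\<rat> \<inter> {0..}. coord t (Zi (Z \<omega>)) = coord t \<omega>"
    by (subst AE_ball_countable) (auto intro: countable_subset[OF _ countable_rat])
  moreover have "AE \<omega> in M. \<omega> \<in> space M \<and> Zi (Z \<omega>) \<in> space path_space"
  proof (intro AE_I2 conjI)
    fix \<omega> assume "\<omega> \<in> space M"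
    then have "Z \<omega> \<in> space M" using measurable_space[OF Z_measurable] by (simp add: space_M)
    then show "Zi (Z \<omega>) \<in> space path_space" by (rule measurable_space[OF Zi_measurable])
  qed
  ultimately show ?thesis
    by eventually_elim (rule path_eqI, auto simp: space_M)
qed

text \<open>A left inverse of a measure-preserving map preserves the measure, and by the same token it is a right
inverse almost everywhere: \<open>Z (Zi \<omega>) = \<omega>\<close> holds for all \<open>\<omega>\<close> in the image of almost every path under
\<open>Z\<close>.\<close>

lemma Zi_measure_preserving: "measure_preserving Zi"
proof (rule measure_preserving_if_distr[OF Zi_measurable])
  fix A assume A: "A \<in> sets path_space"
  have 1: "Zi -` A \<inter> space M \<in> sets M" by (rule measurable_sets[OF Zi_measurable A])
  have ZM: "Z \<in> M \<rightarrow>\<^sub>M M" and dZ: "distr M M Z = M" using Z_measure_preserving by (auto simp: measure_preserving_def)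
  have 2: "Z -` (Zi -` A \<inter> space M) \<inter> space M \<in> sets M" by (rule measurable_sets[OF ZM 1])
  have AM: "A \<in> sets M" using A sets_path_space_subset by auto
  have "measure M (Zi -` A \<inter> space M) = measure (distr M M Z) (Zi -` A \<inter> space M)" by (simp add: dZ)
  also have "\<dots> = measure M (Z -` (Zi -` A \<inter> space M) \<inter> space M)" by (rule measure_distr[OF ZM 1])
  also have "\<dots> = measure M A"
  proof (rule finite_measure_eq_AE[OF _ 2 AM])
    show "AE \<omega> in M. (\<omega> \<in> Z -` (Zi -` A \<inter> space M) \<inter> space M) = (\<omega> \<in> A)"
      using Zi_Z_id AE_space
    proof eventually_elim
      case (elim \<omega>)
      then show ?case using measurable_space[OF ZM, of \<omega>] by auto
    qed
  qed
  finally show "measure M (Zi -` A \<inter> space M) = measure M A" .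
qed

lemma Z_Zi_id: "AE \<omega> in M. Z (Zi \<omega>) = \<omega>"
proof -
  have ZM: "Z \<in> M \<rightarrow>\<^sub>M M" and dZ: "distr M M Z = M" and ZiM: "Zi \<in> M \<rightarrow>\<^sub>M M"
    using Z_measure_preserving Zi_measure_preserving by (auto simp: measure_preserving_def)
  let ?Q = "\<lambda>t \<omega>. coord t (Z (Zi \<omega>)) = coord t \<omega>"
  have "AE \<omega> in M. ?Q t \<omega>" if t: "t \<ge> 0" for t
  proof -
    have [measurable]: "(\<lambda>\<omega>. coord t (Z (Zi \<omega>))) \<in> borel_measurable M" "coord t \<in> borel_measurable M"
      using measurable_comp[OF ZiM coord_Z_measurable[OF t]] t by (auto simp: comp_def)
    have "{\<omega> \<in> space M. ?Q t \<omega>} \<in> sets M" by measurable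
    moreover have "AE \<omega> in M. ?Q t (Z \<omega>)" using Zi_Z_id by eventually_elim simp
    ultimately have "AE \<omega> in distr M M Z. ?Q t \<omega>" by (subst AE_distr_iff[OF ZM])
    then show ?thesis unfolding dZ .
  qed
  then have "AE \<omega> in M. \<forall>t\<in>\<rat> \<inter> {0..}. ?Q t \<omega>"
    by (subst AE_ball_countable) (auto intro: countable_subset[OF _ countable_rat])
  moreover have "AE \<omega> in M. \<omega> \<in> space M \<and> Z (Zi \<omega>) \<in> space M"
    using measurable_space[OF ZM] measurable_space[OF ZiM] by (intro AE_I2) auto
  ultimately show ?thesis
    by eventually_elim (rule path_eqI, auto simp: space_M)
qed

sublocale aut: measure_automorphism M Z Zi
  using Z_measure_preserving Zi_measure_preserving Zi_Z_id Z_Zi_id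
  by unfold_locales (simp add: automorphism_def measure_preserving_def)

text \<open>\<open>invariant_form_vanishes\<close> for the form \<open>(x, y) \<mapsto> (P x, y)\<close> of the projection \<open>P\<close> onto \<open>N\<close>: a reducing subspace
is orthogonal to the whole process as soon as the normalised process comes close to its complement.\<close>

lemma orthogonal_to_reducing:
  assumes N: "L2.closed_sub N" and inv: "\<And>h. h \<in> N \<Longrightarrow> h \<circ> Z \<in> N" "\<And>h. h \<in> N \<Longrightarrow> h \<circ> Zi \<in> N"
    and small: "\<And>e. e > 0 \<Longrightarrow> \<exists>u>0. u powr (- 2 * \<beta>) * (L2.nrm (L2.proj N (coord u)))\<^sup>2 < e"
    and t: "t \<ge> 0" and k: "k \<in> N"
  shows "L2_inner M (coord t) k = 0"
proof (cases "t = 0")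
  case True
  then show ?thesis using coord_0_inner L2.closed_subD(3)[OF N k] by simp
next
  case False
  then have t: "t > 0" using t by simp
  define q where "q x y = L2_inner M (L2.proj N x) y" for x y
  have qq: "q x x = (L2.nrm (L2.proj N x))\<^sup>2" if "x \<in> L2 M" for x
    using L2.ip_proj_left[OF N that that] by (simp add: q_def L2.nrm_square)
  have q: "L2.contraction_form q"
    unfolding L2.contraction_form_def
  proof (intro conjI ballI)
    fix x y assume x: "x \<in> L2 M" and y: "y \<in> L2 M"
    show "q x y = q y x" using L2.ip_proj_sym[OF N x y] L2.ip_commute by (simp add: q_def)
  next
    fix x assume x: "x \<in> L2 M"
    show "0 \<le> q x x" by (simp add: qq[OF x])
    show "q x x \<le> L2_inner M x x"
      unfolding qq[OF x] L2.nrm_square[symmetric] by (rule power_mono[OF L2.nrm_proj_le[OF N x]]) simp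
  next
    fix y assume y: "y \<in> L2 M"
    show "\<exists>y'\<in>L2 M. \<forall>x\<in>L2 M. q x y = L2_inner M x y'"
      using L2.ip_proj_sym[OF N _ y] L2.proj_in_H[OF N y] by (auto simp: q_def)
  qed
  have "q (coord t) (coord t) = 0"
  proof (rule flt.invariant_form_vanishes[OF q _ _ t])
    show "q (flt.Z u) (flt.Z u) = q (coord u) (coord u)" if "u > 0" for u
      unfolding flt_Z q_def by (rule aut.proj_invariant[OF N inv]) (use that in auto)
    show "\<exists>u>0. u powr (- 2 * \<beta>) * q (coord u) (coord u) < e" if "e > 0" for e
      using small[OF that] by (auto simp: qq)
  qed
  then have "L2.nrm (L2.proj N (coord t)) = 0" using qq[of "coord t"] t by simp
  then show ?thesis using L2.ip_le_nrm_proj[OF N _ k, of "coord t"] t by simp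
qed

text \<open>The complementary use of \<open>invariant_form_vanishes\<close>, with the projection onto the orthogonal complement
of \<open>K\<close>: a reducing subspace that contains the process at one time contains it at all times.\<close>

lemma coords_in_reducing:
  assumes K: "L2.closed_sub K" and inv: "\<And>h. h \<in> K \<Longrightarrow> h \<circ> Z \<in> K" "\<And>h. h \<in> K \<Longrightarrow> h \<circ> Zi \<in> K"
    and T: "T > 0" "coord T \<in> K" and t: "t \<ge> 0"
  shows "coord t \<in> K"
proof (cases "t = 0")
  case True
  then show ?thesis using zero_in_closed[OF K _ coord_0(2)] by simp
next
  case False
  then have t: "t > 0" using t by simp
  define q where "q x y = L2_inner M (x - L2.proj K x) y" for x y
  have alt: "q x y = L2_inner M x (y - L2.proj K y)" if "x \<in> L2 M" "y \<in> L2 M" for x y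
    using that L2.ip_proj_sym[OF K that] L2.proj_in_H[OF K] by (simp add: q_def L2.ip_linear)
  have orth: "q x y = L2_inner M (x - L2.proj K x) (y - L2.proj K y)" if "x \<in> L2 M" "y \<in> L2 M" for x y
    using that L2.proj_orth[OF K that(1) L2.proj_in[OF K that(2)]] L2.proj_in_H[OF K]
    by (simp add: q_def L2.ip_diff_right)
  have qq: "q x x = L2_inner M x x - L2_inner M (L2.proj K x) x" if "x \<in> L2 M" for x
    using that L2.proj_in_H[OF K that] by (simp add: q_def L2.ip_linear)
  have q: "L2.contraction_form q"
    unfolding L2.contraction_form_def
  proof (intro conjI ballI)
    fix x y assume x: "x \<in> L2 M" and y: "y \<in> L2 M"
    show "q x y = q y x" using orth[OF x y] orth[OF y x] L2.ip_commute by simp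
  next
    fix x assume x: "x \<in> L2 M"
    show "0 \<le> q x x" unfolding orth[OF x x] by (rule L2.ip_nonneg)
    show "q x x \<le> L2_inner M x x"
      using L2.ip_proj_left[OF K x x] L2.ip_nonneg[of "L2.proj K x"] unfolding qq[OF x] by simp
  next
    fix y assume y: "y \<in> L2 M"
    show "\<exists>y'\<in>L2 M. \<forall>x\<in>L2 M. q x y = L2_inner M x y'"
      using alt[OF _ y] L2.proj_in_H[OF K y] y by (intro bexI[of _ "y - L2.proj K y"]) auto
  qed
  have TL: "coord T \<in> L2 M" using T by auto
  have qT: "q (coord T) (coord T) = 0"
    using L2.proj_orth[OF K TL T(2)] by (simp add: q_def)
  have "q (coord t) (coord t) = 0"
  proof (rule flt.invariant_form_vanishes[OF q _ _ t])
    fix u :: real assume u: "u > 0"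
    then have uL: "coord u \<in> L2 M" by simp
    have uZ: "coord u \<circ> Z \<in> L2 M" by (rule coord_Z_L2[OF u])
    show "q (flt.Z u) (flt.Z u) = q (coord u) (coord u)"
      using aut.proj_invariant[OF K inv uL] coord_Z_inner[of u u] u by (simp only: flt_Z qq[OF uL] qq[OF uZ] less_imp_le)
  next
    show "\<exists>u>0. u powr (- 2 * \<beta>) * q (coord u) (coord u) < e" if "e > 0" for e
      using T(1) qT that by (intro exI[of _ T]) simp
  qed
  then have "L2.nrm (coord t - L2.proj K (coord t)) = 0"
    using orth[of "coord t" "coord t"] t by (simp add: L2.nrm_def)
  then show ?thesis
    using t by (intro L2.closed_sub_congruent[OF K L2.proj_in[OF K]]) auto
qed

text \<open>Almost everywhere the orbit of \<open>coord T\<close> is permuted by \<open>Z\<close> and \<open>Zi\<close>, hence its closed span is reducing.\<close>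

lemma total_orbit:
  assumes T: "T > 0"
  shows "coords \<subseteq> L2.cspan (range (\<lambda>n. coord T \<circ> iterate Z Zi n))"
proof -
  let ?F = "range (\<lambda>n. coord T \<circ> iterate Z Zi n)"
  have orbL: "coord T \<circ> iterate Z Zi n \<in> L2 M" for n
    using T by (intro measure_preserving_L2[OF aut.iterate_mp]) auto
  then have L: "?F \<subseteq> L2 M" by auto
  have K: "L2.closed_sub (L2.cspan ?F)" by (rule L2.closed_sub_cspan[OF L])
  have sup: "coord T \<circ> iterate Z Zi n \<in> L2.cspan ?F" for n using L2.cspan_superset[OF L] by auto
  have inv: "h \<circ> \<phi> \<in> L2.cspan ?F" if h: "h \<in> L2.cspan ?F" and \<phi>: "measure_preserving \<phi>"
    and shift: "\<And>n. \<exists>m. AE \<omega> in M. iterate Z Zi n (\<phi> \<omega>) = iterate Z Zi m \<omega>" for h \<phi>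
  proof -
    have "(\<lambda>g. g \<circ> \<phi>) ` ?F \<subseteq> L2.cspan ?F"
    proof safe
      fix n
      obtain m where m: "AE \<omega> in M. iterate Z Zi n (\<phi> \<omega>) = iterate Z Zi m \<omega>" using shift by blast
      show "coord T \<circ> iterate Z Zi n \<circ> \<phi> \<in> L2.cspan ?F"
      proof (rule L2_closed_sub_cong_AE[OF K sup[of m]])
        show "coord T \<circ> iterate Z Zi n \<circ> \<phi> \<in> borel_measurable M"
          by (rule L2_measurable[OF measure_preserving_L2[OF \<phi> orbL]])
        show "AE x in M. (coord T \<circ> iterate Z Zi m) x = (coord T \<circ> iterate Z Zi n \<circ> \<phi>) x"
          using m by eventually_elim simp
      qed
    qed
    then show ?thesis using comp_cspan[OF \<phi> L h] L2.cspan_minimal[OF _ K] by blast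
  qed
  have "coord T \<in> L2.cspan ?F" using sup[of 0] by (simp add: iterate_def comp_def)
  then show ?thesis
    using coords_in_reducing[OF K inv[OF _ aut.Z_mp] inv[OF _ aut.Zi_mp] T] aut.iterate_Z_AE aut.iterate_Zi_AE
    by blast
qed

lemma kernel_L2:
  assumes "t \<ge> 0"
  shows "z t \<in> L2 (lebesgue_on {0..S})"
proof -
  have sq: "z t \<in> borel_measurable (lebesgue_on {0..})" "integrable (lebesgue_on {0..}) (\<lambda>u. (z t u)\<^sup>2)"
    using kernel assms by (auto simp: volterra_kernel_def square_integrable_def)
  have eq: "lebesgue_on {0..S} = restrict_space (lebesgue_on {0..}) {0..S}"
    by (subst restrict_restrict_space) (auto intro!: arg_cong[where f = "restrict_space lebesgue"])
  have S: "{0..S} \<inter> space (lebesgue_on {0..}) \<in> sets (lebesgue_on {0..})"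
    by (auto simp: sets_restrict_space)
  show ?thesis
  proof (rule L2I)
    show "z t \<in> borel_measurable (lebesgue_on {0..S})"
      unfolding eq by (rule measurable_restrict_space1[OF sq(1)])
    have "integrable (lebesgue_on {0..}) (\<lambda>u. indicator {0..S} u *\<^sub>R (z t u)\<^sup>2)"
      using sq(2) by (rule integrable_mult_indicator[rotated]) (auto simp: sets_restrict_space)
    then show "integrable (lebesgue_on {0..S}) (\<lambda>u. (z t u)\<^sup>2)"
      unfolding eq using S by (subst integrable_restrict_space) auto
  qed
qed

lemma covariance_kernel:
  assumes "s \<ge> 0" "t \<ge> 0" "min s t \<le> S"
  shows "L2_inner M (coord s) (coord t) = L2_inner (lebesgue_on {0..S}) (z s) (z t)"
proof -
  have "z s u * z t u = 0" if "u \<ge> min s t" for u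
    using kernel assms that by (auto simp: volterra_kernel_def min_def split: if_splits)
  then have "indicat_real {0..min s t} u * (z s u * z t u) = indicat_real {0..S} u * (z s u * z t u)" for u
    using assms(3) by (cases "min s t \<le> u") (auto simp: indicator_def)
  then have "(LINT u|lebesgue. indicat_real {0..min s t} u * (z s u * z t u)) =
      (LINT u|lebesgue. indicat_real {0..S} u * (z s u * z t u))"
    by (intro Bochner_Integration.integral_cong refl)
  then show ?thesis
    unfolding covariance[OF assms(1,2)] unfolding volterra_covariance_def L2_inner_def
    by (simp add: integral_restrict_space)
qed

text \<open>By the covariance formula, \<open>coord t \<mapsto> z t\<close> is an isometry. For times in \<open>{0..S}\<close> the functions \<open>z t\<close> live on
\<open>{0..S}\<close>, so only the restriction of \<open>z r\<close> to this interval contributes to the inner product.\<close>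

lemma kernel_bound:
  assumes r: "r \<ge> 0" and F: "finite F" "F \<subseteq> {0..S}"
  shows "\<bar>L2_inner M (coord r) (\<Sum>t\<in>F. c t *\<^sub>R coord t)\<bar>
    \<le> sqrt (L2_inner (lebesgue_on {0..S}) (z r) (z r)) * L2.nrm (\<Sum>t\<in>F. c t *\<^sub>R coord t)"
proof -
  let ?K = "lebesgue_on {0..S}"
  interpret K: semi_inner "L2 ?K" "L2_inner ?K" by (rule semi_inner_L2)
  have pos: "t \<ge> 0" "t \<le> S" if "t \<in> F" for t using F that by auto
  define y where "y = (\<Sum>t\<in>F. c t *\<^sub>R coord t)"
  define h where "h = (\<Sum>t\<in>F. c t *\<^sub>R z t)"
  have hL: "h \<in> L2 ?K"
    unfolding h_def using pos kernel_L2 by (intro subspace_sum[OF L2_subspace] subspace_scale[OF L2_subspace]) auto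
  have "L2_inner M (\<Sum>s\<in>{r}. 1 *\<^sub>R coord s) y = (\<Sum>s\<in>{r}. \<Sum>t\<in>F. 1 * c t * L2_inner M (coord s) (coord t))"
    unfolding y_def by (rule L2.ip_sum_sum) (use r pos in auto)
  also have "\<dots> = (\<Sum>s\<in>{r}. \<Sum>t\<in>F. 1 * c t * L2_inner ?K (z s) (z t))"
    using pos r by (intro sum.cong refl) (auto simp: covariance_kernel[where S = S] min_le_iff_disj)
  also have "\<dots> = L2_inner ?K (\<Sum>s\<in>{r}. 1 *\<^sub>R z s) h"
    unfolding h_def by (rule K.ip_sum_sum[symmetric]) (use r pos kernel_L2 in auto)
  finally have 1: "L2_inner M (coord r) y = L2_inner ?K (z r) h" by simp
  have "L2_inner M y y = (\<Sum>s\<in>F. \<Sum>t\<in>F. c s * c t * L2_inner M (coord s) (coord t))"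
    unfolding y_def by (rule L2.ip_sum_sum) (use pos in auto)
  also have "\<dots> = (\<Sum>s\<in>F. \<Sum>t\<in>F. c s * c t * L2_inner ?K (z s) (z t))"
    using pos by (intro sum.cong refl) (auto simp: covariance_kernel[where S = S] min_le_iff_disj)
  also have "\<dots> = L2_inner ?K h h"
    unfolding h_def by (rule K.ip_sum_sum[symmetric]) (use pos kernel_L2 in auto)
  finally have 2: "L2.nrm y = K.nrm h" by (simp add: L2.nrm_def K.nrm_def)
  show ?thesis
    using K.Cauchy_Schwarz[OF kernel_L2[OF r] hL] unfolding y_def[symmetric] 1 2 K.nrm_def[of "z r"] .
qed

text \<open>Self-similarity moves the bound from the fixed past \<open>{0..T}\<close> of a late time \<open>u\<close> to the shrinking past
\<open>{0..T/u}\<close> of time \<open>1\<close>. Together with \<open>kernel_mass_near_0\<close> it says that the normalised process forgets its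
past.\<close>

lemma past_bound:
  assumes u: "u > 0" and y: "y \<in> span (coord ` {0..T})"
  shows "\<bar>L2_inner M (coord u) y\<bar>
    \<le> (u powr \<beta> * sqrt (L2_inner (lebesgue_on {0..T/u}) (z 1) (z 1))) * L2.nrm y"
proof -
  obtain F c where F: "finite F" "F \<subseteq> {0..T}" "y = (\<Sum>t\<in>F. c t *\<^sub>R coord t)" using span_image_sum[OF y] .
  have pos: "t \<ge> 0" if "t \<in> F" for t using F(2) that by auto
  have inj: "inj_on (\<lambda>t. t / u) F" using u by (auto simp: inj_on_def)
  define y' where "y' = (\<Sum>t\<in>F. c t *\<^sub>R coord (t / u))"
  have y'_alt: "y' = (\<Sum>t\<in>(\<lambda>t. t / u) ` F. c (u * t) *\<^sub>R coord t)"
    unfolding y'_def using u by (simp add: sum.reindex[OF inj])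
  have hom: "L2_inner M (coord s) (coord t) = u powr (2 * \<beta>) * L2_inner M (coord (s / u)) (coord (t / u))"
    if "s \<ge> 0" "t \<ge> 0" for s t
    using coord_homogeneous[of "s / u" "t / u" u] that u by simp
  have hom1: "1 * c t * L2_inner M (coord s) (coord t) = u powr (2 * \<beta>) * (1 * c t * L2_inner M (coord (s / u)) (coord (t / u)))"
    if "s \<in> {u}" "t \<in> F" for s t
    using hom[of s t] pos[OF that(2)] that(1) u by simp
  have hom2: "c s * c t * L2_inner M (coord s) (coord t) = u powr (2 * \<beta>) * (c s * c t * L2_inner M (coord (s / u)) (coord (t / u)))"
    if "s \<in> F" "t \<in> F" for s t
    using hom[of s t] pos[OF that(1)] pos[OF that(2)] by simp
  have "L2_inner M (\<Sum>s\<in>{u}. 1 *\<^sub>R coord s) y = (\<Sum>s\<in>{u}. \<Sum>t\<in>F. 1 * c t * L2_inner M (coord s) (coord t))"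
    unfolding F(3) by (rule L2.ip_sum_sum) (use u pos in auto)
  also have "\<dots> = u powr (2 * \<beta>) * (\<Sum>s\<in>{u}. \<Sum>t\<in>F. 1 * c t * L2_inner M (coord (s / u)) (coord (t / u)))"
    unfolding sum_distrib_left by (intro sum.cong refl hom1)
  also have "(\<Sum>s\<in>{u}. \<Sum>t\<in>F. 1 * c t * L2_inner M (coord (s / u)) (coord (t / u))) =
      L2_inner M (\<Sum>s\<in>{u}. 1 *\<^sub>R coord (s / u)) y'"
    unfolding y'_def by (rule L2.ip_sum_sum[symmetric]) (use u pos in auto)
  finally have 1: "L2_inner M (coord u) y = u powr (2 * \<beta>) * L2_inner M (coord 1) y'" using u by simp
  have "L2_inner M y y = (\<Sum>s\<in>F. \<Sum>t\<in>F. c s * c t * L2_inner M (coord s) (coord t))"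
    unfolding F(3) by (rule L2.ip_sum_sum) (use pos in auto)
  also have "\<dots> = u powr (2 * \<beta>) * (\<Sum>s\<in>F. \<Sum>t\<in>F. c s * c t * L2_inner M (coord (s / u)) (coord (t / u)))"
    unfolding sum_distrib_left by (intro sum.cong refl hom2)
  also have "(\<Sum>s\<in>F. \<Sum>t\<in>F. c s * c t * L2_inner M (coord (s / u)) (coord (t / u))) = L2_inner M y' y'"
    unfolding y'_def by (rule L2.ip_sum_sum[symmetric]) (use u pos in auto)
  finally have "L2.nrm y = sqrt (u powr (2 * \<beta>)) * L2.nrm y'" by (simp add: L2.nrm_def real_sqrt_mult)
  moreover have uu: "u powr (2 * \<beta>) = u powr \<beta> * u powr \<beta>" by (simp add: powr_add[symmetric])
  ultimately have 2: "L2.nrm y = u powr \<beta> * L2.nrm y'" by simp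
  have "\<bar>L2_inner M (coord 1) y'\<bar> \<le> sqrt (L2_inner (lebesgue_on {0..T/u}) (z 1) (z 1)) * L2.nrm y'"
  proof -
    have "(\<lambda>t. t / u) ` F \<subseteq> {0..T / u}"
      using F(2) u by (auto simp: subset_iff divide_right_mono)
    then show ?thesis unfolding y'_alt using F(1) by (intro kernel_bound) auto
  qed
  then have "(u powr \<beta> * u powr \<beta>) * \<bar>L2_inner M (coord 1) y'\<bar> \<le>
      (u powr \<beta> * u powr \<beta>) * (sqrt (L2_inner (lebesgue_on {0..T/u}) (z 1) (z 1)) * L2.nrm y')"
    by (intro mult_left_mono) auto
  then show ?thesis unfolding 1 2 uu by (simp add: abs_mult mult_ac)
qed

lemma kernel_mass_near_0: "(\<lambda>n. L2_inner (lebesgue_on {0..1 / real (Suc n)}) (z 1) (z 1)) \<longlonglongrightarrow> 0"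
proof -
  have sq: "z 1 \<in> borel_measurable (lebesgue_on {0..})" "integrable (lebesgue_on {0..}) (\<lambda>u. (z 1 u)\<^sup>2)"
    using kernel by (auto simp: volterra_kernel_def square_integrable_def)
  have int: "L2_inner (lebesgue_on {0..1 / real (Suc n)}) (z 1) (z 1) =
      (LINT u|lebesgue_on {0..}. indicat_real {0..1 / real (Suc n)} u * (z 1 u)\<^sup>2)" for n
    unfolding L2_inner_def
    by (simp add: integral_restrict_space power2_eq_square)
      (intro Bochner_Integration.integral_cong refl, auto simp: indicator_def)
  have AE0: "AE u in lebesgue_on {0..}. (u::real) \<noteq> 0"
    using AE_completion[OF AE_lborel_singleton[of "0::real"]]
    by (subst AE_restrict_space_iff) auto
  have "(\<lambda>n. LINT u|lebesgue_on {0..}. indicat_real {0..1 / real (Suc n)} u * (z 1 u)\<^sup>2) \<longlonglongrightarrow>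
      (LINT u::real|lebesgue_on {0..}. (0::real))"
  proof (rule integral_dominated_convergence[where w = "\<lambda>u. (z 1 u)\<^sup>2"])
    show "(\<lambda>u. indicat_real {0..1 / real (Suc n)} u * (z 1 u)\<^sup>2) \<in> borel_measurable (lebesgue_on {0..})" for n
    proof (intro borel_measurable_times borel_measurable_power sq(1))
      have "indicat_real {0..1 / real (Suc n)} \<in> borel_measurable lebesgue"
        by (rule borel_measurable_indicator) simp
      then show "indicat_real {0..1 / real (Suc n)} \<in> borel_measurable (lebesgue_on {0..})"
        by (rule measurable_restrict_space1)
    qed
    show "AE u in lebesgue_on {0..}. (\<lambda>n. indicat_real {0..1 / real (Suc n)} u * (z 1 u)\<^sup>2) \<longlonglongrightarrow> 0"
      using AE0 AE_space
    proof eventually_elim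
      case (elim u)
      then have u: "u > 0" by simp
      have "eventually (\<lambda>n. 1 / real (Suc n) < u) sequentially"
        using order_tendstoD(2)[OF LIMSEQ_inverse_real_of_nat u] by (simp add: inverse_eq_divide)
      then have "eventually (\<lambda>n. indicat_real {0..1 / real (Suc n)} u * (z 1 u)\<^sup>2 = 0) sequentially"
        by eventually_elim (simp add: indicator_def)
      then show ?case by (rule tendsto_eventually)
    qed
    show "AE u in lebesgue_on {0..}. norm (indicat_real {0..1 / real (Suc n)} u * (z 1 u)\<^sup>2) \<le> (z 1 u)\<^sup>2" for n
      by (rule AE_I2) (simp add: indicator_def)
  qed (use sq(2) in simp_all)
  then show ?thesis unfolding int by simp
qed

text \<open>The intersection \<open>N\<close> of the images of the past under \<open>Z ^^ m\<close> is reducing and contained in the past \<open>{0..T}\<close>,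
which the normalised process forgets.\<close>

lemma tail_of_filtration:
  assumes T: "T > 0" and t: "t \<ge> 0" and k: "k \<in> (\<Inter>m. L2.cspan ((\<lambda>f. f \<circ> (Z ^^ m)) ` coord ` {0..T}))"
  shows "L2_inner M (coord t) k = 0"
proof -
  interpret sw: measure_automorphism M Zi Z by (rule aut.swapped)
  let ?F = "coord ` {0..T}"
  let ?K = "\<lambda>m. L2.cspan ((\<lambda>f. f \<circ> (Z ^^ m)) ` ?F)"
  have FL: "?F \<subseteq> L2 M" by auto
  have L: "(\<lambda>f. f \<circ> (Z ^^ m)) ` ?F \<subseteq> L2 M" for m
    using FL measure_preserving_L2[OF measure_preserving_funpow[OF aut.Z_mp]] by auto
  have N: "L2.closed_sub (\<Inter>m. ?K m)"
    using L2.closed_sub_Inter[of UNIV ?K] L2.closed_sub_cspan[OF L] by simp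
  have K0: "L2.closed_sub (L2.cspan ?F)" by (rule L2.closed_sub_cspan[OF FL])
  have shift: "f \<circ> Z \<in> L2.cspan ?F" if "f \<in> ?F" for f
    using that coord_Z_causal[of _ T] by auto
  have NK: "(\<Inter>m. ?K m) \<subseteq> L2.cspan ?F"
  proof
    fix x assume "x \<in> (\<Inter>m. ?K m)"
    then have "x \<in> ?K 0" by blast
    then show "x \<in> L2.cspan ?F" by simp
  qed
  show ?thesis
  proof (rule orthogonal_to_reducing[OF N _ _ _ t k])
    show "h \<circ> Z \<in> (\<Inter>m. ?K m)" "h \<circ> Zi \<in> (\<Inter>m. ?K m)" if "h \<in> (\<Inter>m. ?K m)" for h
      using sw.tail_subspace_invariant[OF FL shift that] by auto
    fix e :: real assume "e > 0"
    then have "\<forall>\<^sub>F n in sequentially. L2_inner (lebesgue_on {0..1 / real (Suc n)}) (z 1) (z 1) < e"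
      using kernel_mass_near_0 by (intro order_tendstoD)
    then obtain n where n: "L2_inner (lebesgue_on {0..1 / real (Suc n)}) (z 1) (z 1) < e"
      using eventually_happens by fastforce
    define u where "u = T * real (Suc n)"
    have u: "u > 0" and Tu: "T / u = 1 / real (Suc n)" using T by (simp_all add: u_def)
    define d where "d = sqrt (L2_inner (lebesgue_on {0..T/u}) (z 1) (z 1))"
    have d0: "0 \<le> L2_inner (lebesgue_on {0..T/u}) (z 1) (z 1)" by (simp add: L2_inner_def)
    then have d: "0 \<le> d" "d\<^sup>2 < e" using n Tu by (simp_all add: d_def)
    have uL: "coord u \<in> L2 M" using u by auto
    have "L2.nrm (L2.proj (\<Inter>m. ?K m) (coord u)) \<le> L2.nrm (L2.proj (L2.cspan ?F) (coord u))"
      by (rule L2.proj_mono[OF N K0 NK uL])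
    also have "\<dots> \<le> u powr \<beta> * d"
    proof (rule L2.nrm_proj_le_bound[OF K0 uL])
      show "\<bar>L2_inner M (coord u) y\<bar> \<le> u powr \<beta> * d * L2.nrm y" if "y \<in> L2.cspan ?F" for y
      proof (rule L2.ip_bound_cspan[OF FL uL that])
        show "0 \<le> u powr \<beta> * d" using d(1) by simp
        show "\<bar>L2_inner M (coord u) y\<bar> \<le> u powr \<beta> * d * L2.nrm y" if "y \<in> span ?F" for y
          using past_bound[OF u that] by (simp only: d_def)
      qed
    qed (use d(1) in simp)
    finally have "(L2.nrm (L2.proj (\<Inter>m. ?K m) (coord u)))\<^sup>2 \<le> (u powr \<beta> * d)\<^sup>2"
      by (intro power_mono) auto
    then have "u powr (- 2 * \<beta>) * (L2.nrm (L2.proj (\<Inter>m. ?K m) (coord u)))\<^sup>2 \<le> u powr (- 2 * \<beta>) * (u powr \<beta> * d)\<^sup>2"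
      by (intro mult_left_mono) auto
    also have "u powr (- 2 * \<beta>) * (u powr \<beta> * d)\<^sup>2 = (u powr (- 2 * \<beta>) * (u powr \<beta> * u powr \<beta>)) * d\<^sup>2"
      by (simp add: power2_eq_square)
    also have "u powr (- 2 * \<beta>) * (u powr \<beta> * u powr \<beta>) = 1" using u by (simp add: powr_add[symmetric])
    finally have "u powr (- 2 * \<beta>) * (L2.nrm (L2.proj (\<Inter>m. ?K m) (coord u)))\<^sup>2 \<le> d\<^sup>2"
      by (simp only: mult_1)
    from le_less_trans[OF this d(2)]
    show "\<exists>u>0. u powr (- 2 * \<beta>) * (L2.nrm (L2.proj (\<Inter>m. ?K m) (coord u)))\<^sup>2 < e"
      by (intro exI[of _ u] conjI u)
  qed
qed

text \<open>The orbit of one variable under a measure-preserving transformation is a real stationary sequence, so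
its covariances do not change under time reversal.\<close>

lemma inner_reversal:
  assumes x: "x \<in> L2 M"
  shows "L2_inner M (x \<circ> (Zi ^^ i)) (x \<circ> (Zi ^^ j)) = L2_inner M (x \<circ> (Z ^^ i)) (x \<circ> (Z ^^ j))"
proof -
  have mpZ: "measure_preserving (Z ^^ n)" and mpZi: "measure_preserving (Zi ^^ n)" for n
    by (rule measure_preserving_funpow[OF aut.Z_mp] measure_preserving_funpow[OF aut.Zi_mp])+
  have *: "L2_inner M (x \<circ> (Zi ^^ i)) (x \<circ> (Zi ^^ j)) = L2_inner M (x \<circ> (Z ^^ i)) (x \<circ> (Z ^^ j))"
    if "i \<le> j" for i j
  proof -
    define k where "k = j - i"
    have j: "j = k + i" using that by (simp add: k_def)
    have "L2_inner M (x \<circ> (Zi ^^ i)) (x \<circ> (Zi ^^ j)) = L2_inner M (x \<circ> (Zi ^^ i)) ((x \<circ> (Zi ^^ k)) \<circ> (Zi ^^ i))"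
      by (simp add: j funpow_add comp_assoc)
    also have "\<dots> = L2_inner M x (x \<circ> (Zi ^^ k))"
      by (rule measure_preserving_inner[OF mpZi x measure_preserving_L2[OF mpZi x]])
    also have "\<dots> = L2_inner M (x \<circ> (Z ^^ k)) x" by (rule aut.inner_shift_funpow[OF x x, symmetric])
    also have "\<dots> = L2_inner M x (x \<circ> (Z ^^ k))" by (rule L2.ip_commute)
    also have "\<dots> = L2_inner M (x \<circ> (Z ^^ i)) ((x \<circ> (Z ^^ k)) \<circ> (Z ^^ i))"
      by (rule measure_preserving_inner[OF mpZ x measure_preserving_L2[OF mpZ x], symmetric])
    also have "\<dots> = L2_inner M (x \<circ> (Z ^^ i)) (x \<circ> (Z ^^ j))" by (simp add: j funpow_add comp_assoc)
    finally show ?thesis .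
  qed
  show ?thesis using *[of i j] *[of j i] L2.ip_commute by (cases "i \<le> j") (auto simp: not_le)
qed

definition orbit_past :: "real \<Rightarrow> ((real \<Rightarrow> real) \<Rightarrow> real) set" where
  "orbit_past T = (\<lambda>n. coord T \<circ> iterate Z Zi n) ` {n. n < 0}"

lemma orbit_past_alt: "orbit_past T = (\<lambda>k. coord T \<circ> (Zi ^^ k)) ` {1..}"
proof -
  have "{n::int. n < 0} = (\<lambda>k. - int k) ` {1..}"
  proof safe
    fix n :: int assume "n < 0"
    then show "n \<in> (\<lambda>k. - int k) ` {1..}" by (intro image_eqI[of _ _ "nat (- n)"]) auto
  qed auto
  moreover have "iterate Z Zi (- int k) = Zi ^^ k" if "k \<ge> 1" for k
    using that by (simp add: iterate_def fun_eq_iff)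
  ultimately show ?thesis unfolding orbit_past_def by (auto simp: image_image intro!: image_cong)
qed

lemma orbit_past_L2: "T > 0 \<Longrightarrow> orbit_past T \<subseteq> L2 M"
  unfolding orbit_past_alt using measure_preserving_L2[OF measure_preserving_funpow[OF aut.Zi_mp]] by auto

lemma orbit_past_shift:
  assumes T: "T > 0" and f: "f \<in> orbit_past T"
  shows "f \<circ> Zi \<in> orbit_past T"
proof -
  obtain k where k: "k \<ge> 1" "f = coord T \<circ> (Zi ^^ k)" using f unfolding orbit_past_alt by auto
  have "f \<circ> Zi = coord T \<circ> (Zi ^^ Suc k)" by (simp add: k(2) fun_eq_iff funpow_swap1)
  moreover have "coord T \<circ> (Zi ^^ Suc k) \<in> orbit_past T"
    unfolding orbit_past_alt by (rule imageI) simp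
  ultimately show ?thesis by (simp only:)
qed

lemma coord_funpow_Z_causal:
  assumes T: "T > 0"
  shows "coord T \<circ> (Z ^^ k) \<in> L2.cspan (coord ` {0..T})"
proof (induction k)
  case 0
  show ?case using T by (auto intro: coord_in_cspan)
next
  case (Suc k)
  have FL: "coord ` {0..T} \<subseteq> L2 M" by auto
  have "(coord T \<circ> (Z ^^ k)) \<circ> Z \<in> L2.cspan ((\<lambda>g. g \<circ> Z) ` coord ` {0..T})"
    by (rule comp_cspan[OF aut.Z_mp FL Suc])
  moreover have "(\<lambda>g. g \<circ> Z) ` coord ` {0..T} \<subseteq> L2.cspan (coord ` {0..T})"
    using coord_Z_causal[of _ T] by auto
  moreover have "(coord T \<circ> (Z ^^ k)) \<circ> Z = coord T \<circ> (Z ^^ Suc k)" by (simp add: fun_eq_iff funpow_swap1)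
  ultimately show ?case
    using subsetD[OF L2.cspan_minimal[OF _ L2.closed_sub_cspan[OF FL]]] by (simp only:)
qed

text \<open>By reversal, the remote past of the orbit of \<open>coord T\<close> is as far from \<open>coord T\<close> as its remote future is. The
remote future is contained in the tail of the filtration, by causality of \<open>Z\<close>, so both are orthogonal to
\<open>coord T\<close>. The remote past is reducing, and orthogonality at time \<open>T\<close> spreads to all times.\<close>

lemma tail_of_orbit_past:
  assumes T: "T > 0" and t: "t \<ge> 0" and k: "k \<in> (\<Inter>m. L2.cspan ((\<lambda>f. f \<circ> (Zi ^^ m)) ` orbit_past T))"
  shows "L2_inner M (coord t) k = 0"
proof -
  let ?F = "coord ` {0..T}"
  let ?K = "\<lambda>m. L2.cspan ((\<lambda>f. f \<circ> (Zi ^^ m)) ` orbit_past T)"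
  define K2 where "K2 m = L2.cspan ((\<lambda>f. f \<circ> (Z ^^ m)) ` ?F)" for m
  have FL: "?F \<subseteq> L2 M" by auto
  have mpZ: "measure_preserving (Z ^^ n)" and mpZi: "measure_preserving (Zi ^^ n)" for n
    by (rule measure_preserving_funpow[OF aut.Z_mp] measure_preserving_funpow[OF aut.Zi_mp])+
  have L: "(\<lambda>f. f \<circ> (Zi ^^ m)) ` orbit_past T \<subseteq> L2 M" for m
    using orbit_past_L2[OF T] measure_preserving_L2[OF mpZi] by auto
  have L2': "(\<lambda>f. f \<circ> (Z ^^ m)) ` ?F \<subseteq> L2 M" for m
    using FL measure_preserving_L2[OF mpZ] by auto
  have K: "L2.closed_sub (?K m)" and K2: "L2.closed_sub (K2 m)" for m
    unfolding K2_def by (rule L2.closed_sub_cspan[OF L] L2.closed_sub_cspan[OF L2'])+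
  have N: "L2.closed_sub (\<Inter>m. ?K m)" and N2: "L2.closed_sub (\<Inter>m. K2 m)"
    using L2.closed_sub_Inter[of UNIV ?K] L2.closed_sub_Inter[of UNIV K2] K K2 by simp_all
  have shift: "f \<circ> Zi \<in> L2.cspan (orbit_past T)" if "f \<in> orbit_past T" for f
    using orbit_past_shift[OF T that] L2.cspan_superset[OF orbit_past_L2[OF T]] by auto
  have TL: "coord T \<in> L2 M" using T by auto
  have dec: "K2 (Suc m) \<subseteq> K2 m" for m
    unfolding K2_def[of "Suc m"]
  proof (rule L2.cspan_minimal[OF _ K2], safe)
    fix s assume "s \<in> {0..T}"
    then have "coord s \<circ> Z \<in> L2.cspan ?F" using coord_Z_causal by auto
    from comp_cspan[OF mpZ FL this, of m]
    show "coord s \<circ> (Z ^^ Suc m) \<in> K2 m" unfolding K2_def by (simp add: comp_assoc)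
  qed
  define \<delta> where "\<delta> m = L2.nrm (L2.proj (K2 m) (coord T))" for m
  have "L2.nrm (L2.proj (\<Inter>m. K2 m) (coord T)) = 0"
  proof -
    have "L2.proj (\<Inter>m. K2 m) (coord T) \<in> (\<Inter>m. K2 m)" by (rule L2.proj_in[OF N2 TL])
    then have "L2_inner M (coord T) (L2.proj (\<Inter>m. K2 m) (coord T)) = 0"
      using tail_of_filtration[OF T] T unfolding K2_def by simp
    then show ?thesis
      using L2.ip_proj[OF N2 TL L2.proj_in[OF N2 TL]] by (simp add: L2.nrm_def)
  qed
  then have \<delta>: "\<delta> \<longlonglongrightarrow> 0"
    using L2.proj_decreasing_tendsto_zero[where S = K2 and x = "coord T", OF K2 dec TL] by (simp add: \<delta>_def[abs_def])
  have bound: "\<bar>L2_inner M (coord T) y\<bar> \<le> \<delta> m * L2.nrm y"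
    if y: "y \<in> span ((\<lambda>f. f \<circ> (Zi ^^ m)) ` orbit_past T)" for y m
  proof -
    have im: "(\<lambda>f. f \<circ> (Zi ^^ m)) ` orbit_past T = (\<lambda>k. coord T \<circ> (Zi ^^ (k + m))) ` {1..}"
      unfolding orbit_past_alt by (simp add: image_image funpow_add comp_assoc)
    obtain F c where F: "finite F" "F \<subseteq> {1..}" "y = (\<Sum>k\<in>F. c k *\<^sub>R (coord T \<circ> (Zi ^^ (k + m))))"
      using span_image_sum[OF y[unfolded im]] .
    define y' where "y' = (\<Sum>k\<in>F. c k *\<^sub>R (coord T \<circ> (Z ^^ (k + m))))"
    have "coord T \<circ> (Z ^^ (k + m)) \<in> K2 m" for k
      using comp_cspan[OF mpZ FL coord_funpow_Z_causal[OF T, of k], of m]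
      by (simp add: K2_def funpow_add comp_assoc)
    then have y'K: "y' \<in> K2 m"
      unfolding y'_def using L2.closed_subD(1)[OF K2] by (intro subspace_sum subspace_scale)
    have ZL: "coord T \<circ> (Z ^^ k) \<in> L2 M" and ZiL: "coord T \<circ> (Zi ^^ k) \<in> L2 M" for k
      using measure_preserving_L2[OF mpZ TL] measure_preserving_L2[OF mpZi TL] by auto
    have "L2_inner M y (coord T) = (\<Sum>k\<in>F. c k * L2_inner M (coord T \<circ> (Zi ^^ (k + m))) (coord T))"
      unfolding F(3) using ZiL TL by (subst L2.ip_sum_left) (auto simp: L2.ip_scale_left)
    also have "\<dots> = (\<Sum>k\<in>F. c k * L2_inner M (coord T \<circ> (Z ^^ (k + m))) (coord T))"
      using inner_reversal[OF TL, of _ 0] by simp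
    also have "\<dots> = L2_inner M y' (coord T)"
      unfolding y'_def using ZL TL by (subst L2.ip_sum_left) (auto simp: L2.ip_scale_left)
    finally have 1: "L2_inner M (coord T) y = L2_inner M (coord T) y'" by (simp add: L2.ip_commute)
    have "L2_inner M y y = L2_inner M y' y'"
      unfolding F(3) y'_def using ZL ZiL by (simp only: L2.ip_sum_sum inner_reversal[OF TL])
    then have 2: "L2.nrm y = L2.nrm y'" by (simp add: L2.nrm_def)
    show ?thesis
      unfolding 1 2 \<delta>_def by (rule L2.ip_le_nrm_proj[OF K2 TL y'K])
  qed
  have le: "L2.nrm (L2.proj (\<Inter>m. ?K m) (coord T)) \<le> \<delta> m" for m
  proof -
    have "L2.nrm (L2.proj (\<Inter>m. ?K m) (coord T)) \<le> L2.nrm (L2.proj (?K m) (coord T))"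
      by (rule L2.proj_mono[OF N K _ TL]) blast
    also have "\<dots> \<le> \<delta> m"
    proof (rule L2.nrm_proj_le_bound[OF K TL])
      show \<delta>0: "0 \<le> \<delta> m" by (simp add: \<delta>_def)
      show "\<bar>L2_inner M (coord T) y\<bar> \<le> \<delta> m * L2.nrm y" if "y \<in> ?K m" for y
        by (rule L2.ip_bound_cspan[OF L TL that \<delta>0 bound])
    qed
    finally show ?thesis .
  qed
  have zero: "L2.nrm (L2.proj (\<Inter>m. ?K m) (coord T)) = 0"
  proof (rule antisym)
    show "L2.nrm (L2.proj (\<Inter>m. ?K m) (coord T)) \<le> 0"
      by (rule LIMSEQ_le_const[OF \<delta>]) (intro exI allI impI le)
  qed simp
  show ?thesis
  proof (rule orthogonal_to_reducing[OF N _ _ _ t k])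
    show "h \<circ> Z \<in> (\<Inter>m. ?K m)" "h \<circ> Zi \<in> (\<Inter>m. ?K m)" if "h \<in> (\<Inter>m. ?K m)" for h
      using aut.tail_subspace_invariant[OF orbit_past_L2[OF T] shift that] by auto
    show "\<exists>u>0. u powr (- 2 * \<beta>) * (L2.nrm (L2.proj (\<Inter>m. ?K m) (coord u)))\<^sup>2 < e" if "e > 0" for e
      using T zero that by (intro exI[of _ T]) simp
  qed
qed

lemma coord_funpow_Zi_cspan:
  assumes T: "T > 0"
  shows "coord T \<circ> (Zi ^^ k) \<in> L2.cspan coords"
proof (induction k)
  case 0
  show ?case using L2.cspan_superset[OF coords_L2] T by auto
next
  case (Suc k)
  have "(coord T \<circ> (Zi ^^ k)) \<circ> Zi \<in> L2.cspan ((\<lambda>g. g \<circ> Zi) ` coords)"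
    by (rule comp_cspan[OF aut.Zi_mp coords_L2 Suc])
  moreover have "(\<lambda>g. g \<circ> Zi) ` coords \<subseteq> L2.cspan coords" using coord_Zi_cspan by auto
  moreover have "(coord T \<circ> (Zi ^^ k)) \<circ> Zi = coord T \<circ> (Zi ^^ Suc k)" by (simp add: fun_eq_iff funpow_swap1)
  ultimately show ?case
    using subsetD[OF L2.cspan_minimal[OF _ L2.closed_sub_cspan[OF coords_L2]]] by (simp only:)
qed

theorem kolmogorov_Z:
  assumes T: "T > 0"
  shows "kolmogorov_automorphism M Z Zi
    (sigma_join M {n::int. n < 0} (\<lambda>n. sigma_rv M (\<lambda>\<omega>. coord T (iterate Z Zi n \<omega>))))"
proof -
  have L: "orbit_past T \<subseteq> L2 M" by (rule orbit_past_L2[OF T])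
  have "sigma_join M {n::int. n < 0} (\<lambda>n. sigma_rv M (\<lambda>\<omega>. coord T (iterate Z Zi n \<omega>))) =
      sigma_join M {n::int. n < 0} (\<lambda>n. sigma_gen {coord T \<circ> iterate Z Zi n})"
    by (simp add: sigma_rv_eq_sigma_gen comp_def)
  also have "\<dots> = sigma_gen (\<Union>n\<in>{n. n < 0}. {coord T \<circ> iterate Z Zi n})"
    by (rule sigma_join_sigma_gen) (use T measure_preserving_L2[OF aut.iterate_mp] in auto)
  also have "(\<Union>n\<in>{n. n < 0}. {coord T \<circ> iterate Z Zi n}) = orbit_past T" by (auto simp: orbit_past_def)
  finally have eq: "sigma_join M {n::int. n < 0} (\<lambda>n. sigma_rv M (\<lambda>\<omega>. coord T (iterate Z Zi n \<omega>))) = sigma_gen (orbit_past T)" .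
  show ?thesis
    unfolding eq
  proof (rule aut.kolmogorov_if_gaussian[OF L coords_L2 sets_M_sigma_gen gaussian_coords])
    show "orbit_past T \<subseteq> L2.cspan coords" unfolding orbit_past_alt using coord_funpow_Zi_cspan[OF T] by auto
    show "f \<circ> Zi \<in> L2.cspan (orbit_past T)" if "f \<in> orbit_past T" for f
      using orbit_past_shift[OF T that] L2.cspan_superset[OF L] by auto
    let ?U = "\<Union>n. (\<lambda>f. f \<circ> iterate Z Zi n) ` orbit_past T"
    have UL: "?U \<subseteq> L2 M" using L measure_preserving_L2[OF aut.iterate_mp] by blast
    have U: "L2.closed_sub (L2.cspan ?U)" by (rule L2.closed_sub_cspan[OF UL])
    have "coord T \<circ> iterate Z Zi n \<in> L2.cspan ?U" for n
    proof (cases "n < 0")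
      case True
      then have "coord T \<circ> iterate Z Zi n \<in> orbit_past T" by (auto simp: orbit_past_def)
      then have "(coord T \<circ> iterate Z Zi n) \<circ> iterate Z Zi 0 \<in> ?U" by (intro UN_I[of "0::int", OF UNIV_I] imageI)
      moreover have "(coord T \<circ> iterate Z Zi n) \<circ> iterate Z Zi 0 = coord T \<circ> iterate Z Zi n"
        by (simp add: iterate_def fun_eq_iff)
      ultimately have "coord T \<circ> iterate Z Zi n \<in> ?U" by (simp only:)
      then show ?thesis using L2.cspan_superset[OF UL] by blast
    next
      case False
      have f: "coord T \<circ> Zi \<in> orbit_past T"
        unfolding orbit_past_alt by (intro image_eqI[of _ _ 1]) auto
      show ?thesis
      proof (rule L2_closed_sub_cong_AE[OF U])
        show "(coord T \<circ> Zi) \<circ> iterate Z Zi (n + 1) \<in> L2.cspan ?U"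
          using f L2.cspan_superset[OF UL] by blast
        show "coord T \<circ> iterate Z Zi n \<in> borel_measurable M"
          using T by (intro L2_measurable[OF measure_preserving_L2[OF aut.iterate_mp]]) auto
        have it: "iterate Z Zi (n + 1) \<omega> = Z (iterate Z Zi n \<omega>)" for \<omega>
          using False by (simp add: iterate_def nat_add_distrib)
        have "AE \<omega> in M. Zi (Z (iterate Z Zi n \<omega>)) = iterate Z Zi n \<omega>"
          by (rule measure_preserving_AE[OF aut.iterate_mp aut.Zi_Z])
        then show "AE \<omega> in M. (coord T \<circ> Zi \<circ> iterate Z Zi (n + 1)) \<omega> = (coord T \<circ> iterate Z Zi n) \<omega>"
          by eventually_elim (simp add: it)
      qed
    qed
    then have "L2.cspan (range (\<lambda>n. coord T \<circ> iterate Z Zi n)) \<subseteq> L2.cspan ?U"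
      by (intro L2.cspan_minimal[OF _ U]) auto
    then show "coords \<subseteq> L2.cspan ?U" using total_orbit[OF T] by blast
    show "L2_inner M g k = 0" if "g \<in> coords" "k \<in> (\<Inter>m. L2.cspan ((\<lambda>f. f \<circ> (Zi ^^ m)) ` orbit_past T))" for g k
      using that tail_of_orbit_past[OF T] by auto
  qed
qed

theorem kolmogorov_Zi:
  assumes T: "T > 0"
  shows "kolmogorov_automorphism M Zi Z (completed_natural_filtration M coord T)"
proof -
  interpret sw: measure_automorphism M Zi Z by (rule aut.swapped)
  let ?F = "coord ` {0..T}"
  have L: "?F \<subseteq> L2 M" by auto
  have "completed_natural_filtration M coord T = sigma_gen (\<Union>s\<in>{0..T}. {coord s})"
    unfolding completed_natural_filtration_def sigma_rv_eq_sigma_gen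
    by (rule sigma_join_sigma_gen) auto
  also have "(\<Union>s\<in>{0..T}. {coord s}) = ?F" by auto
  finally have eq: "completed_natural_filtration M coord T = sigma_gen ?F" .
  show ?thesis
    unfolding eq
  proof (rule sw.kolmogorov_if_gaussian[OF L coords_L2 sets_M_sigma_gen gaussian_coords])
    show "?F \<subseteq> L2.cspan coords" using L2.cspan_superset[OF coords_L2] by auto
    show "f \<circ> Z \<in> L2.cspan ?F" if "f \<in> ?F" for f using that coord_Z_causal[of _ T] by auto
    have "iterate Z Zi n = iterate Zi Z (- n)" for n
      by (cases n "0::int" rule: linorder_cases) (simp_all add: iterate_def fun_eq_iff)
    then have "coord T \<circ> iterate Z Zi n \<in> (\<lambda>f. f \<circ> iterate Zi Z (- n)) ` ?F" for n
      using T by (intro image_eqI[of _ _ "coord T"]) (simp_all only:, auto)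
    then have "range (\<lambda>n. coord T \<circ> iterate Z Zi n) \<subseteq> (\<Union>n. (\<lambda>f. f \<circ> iterate Zi Z n) ` ?F)"
      by blast
    from L2.cspan_mono[OF this] show "coords \<subseteq> L2.cspan (\<Union>n. (\<lambda>f. f \<circ> iterate Zi Z n) ` ?F)"
      using total_orbit[OF T] by blast
    show "L2_inner M g k = 0" if "g \<in> coords" "k \<in> (\<Inter>m. L2.cspan ((\<lambda>f. f \<circ> (Z ^^ m)) ` ?F))" for g k
      using that tail_of_filtration[OF T] by auto
  qed
qed

end

theorem theorem2p13:
  fixes z :: "real \<Rightarrow> real \<Rightarrow> real" and W :: "real \<Rightarrow> (real \<Rightarrow> real) \<Rightarrow> real"
    and \<alpha> \<beta> T :: real
    and P M :: "(real \<Rightarrow> real) measure"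
    and Z Zi :: "(real \<Rightarrow> real) \<Rightarrow> (real \<Rightarrow> real)"
  assumes "\<beta> > 0" and "\<alpha> > - (1/2)" and "T > 0"
    and law: "coordinate_law z P"
    and M: "M = completion P"
    and volterra: "continuous_volterra_gaussian_process M W z coord"
    and nondegenerate: "nondegenerate_kernel z"
    and self_similar: "self_similar M \<beta> coord"
    and Z: "is_Z_transform M \<alpha> \<beta> Z"
    and Zi: "is_Z_inverse_transform M \<alpha> \<beta> Zi"
  shows "kolmogorov_automorphism M Z Zi
           (sigma_join M {n::int. n < 0} (\<lambda>n. sigma_rv M (\<lambda>\<omega>. coord T (iterate Z Zi n \<omega>))))
       \<and> kolmogorov_automorphism M Zi Z (completed_natural_filtration M coord T)"
proof -
  interpret coordinate_process z \<alpha> \<beta> P M Z Zi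
    using assms by unfold_locales (auto simp: continuous_volterra_gaussian_process_def)
  show ?thesis using kolmogorov_Z[OF \<open>T > 0\<close>] kolmogorov_Zi[OF \<open>T > 0\<close>] by blast
qed

end
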